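(* Let $(\mathfrak{A},G,\gamma)$ be a $G$-graded unital $C^*$-algebra, with $G$ a compact abelian group, let $v:\widehat{G}\times\widehat{G}\to\mathbb{T}$ be a bicharacter, and let $\omega$ be a state on $\mathfrak{A}$. There exists a (unique) state $\omega\times\omega$ on the twisted tensor product $\mathfrak{A}\otimes_v\mathfrak{A}$ such that $(\omega\times\omega)(a\otimes b)=\omega(a)\omega(b)$ for all $a,b\in\mathfrak{A}$ if and only if $v(\eta_1,\eta_2)=1$ for all $\eta_1,\eta_2\in{\rm supp}_G\,\omega$.
   Context: A $G$-graded unital $C^*$-algebra $(\mathfrak{A},G,\gamma)$ consists of a unital $C^*$-algebra $\mathfrak{A}$, a compact abelian group $G$ with dual $\widehat{G}$, and a group homomorphism $\gamma:G\to{\rm Aut}(\mathfrak{A})$ that is pointwise norm continuous. For $\chi\in\widehat{G}$ set $V_\chi=\mathfrak{A}_\chi=\{a\in\mathfrak{A}:\gamma_g(a)=\chi(g)a\ \text{for all } g\in G\}$; elements of $V_\chi$ are called homogeneous of degree $\partial a=\chi$. The algebraic direct sum $\mathfrak{A}_0=\bigoplus_\chi V_\chi$ is a dense $*$-subalgebra. A bicharacter is a map $v:\widehat{G}\times\widehat{G}\to\mathbb{T}$ that is a character in each variable separately. $\mathfrak{A}\otimes_v\mathfrak{A}$ is the completion, in the maximal $C^*$-norm, of the $*$-algebra whose underlying vector space is the algebraic tensor product $\mathfrak{A}_0\otimes\mathfrak{A}_0$, with operations, for homogeneous elements, $(a\otimes b)^*=\overline{v(\partial a,\partial b)}\,a^*\otimes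 b^*$ and $(a\otimes b)(c\otimes d)=\overline{v(\partial c,\partial b)}\,ac\otimes bd$. The maps $a\mapsto a\otimes 1$ and $b\mapsto 1\otimes b$ extend to injective $*$-homomorphisms of $\mathfrak{A}$, and $a\otimes b:=(a\otimes1)(1\otimes b)$ for all $a,b\in\mathfrak{A}$. The spectral support of a state $\omega$ on $\mathfrak{A}$ is ${\rm supp}_G\,\omega=\{\eta\in\widehat{G}:\exists\,a\in V_\eta\text{ with }\omega(a)\neq0\}$. *)

theory Defs
  imports "HOL-Analysis.Analysis" "HOL-Library.Function_Algebras"
begin

section \<open>Unital C*-algebras\<close>

text \<open>
  The norm, the completeness and the real algebra structure come from the library classes; the
  complex structure extends the real one. The class \<^class>\<open>real_normed_algebra_1\<close> requires
  \<open>norm 1 = 1\<close>, so the zero algebra (which has no states) is excluded.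
\<close>

class unital_cstar_algebra = banach + real_normed_algebra_1 +
  fixes scaleC :: "complex \<Rightarrow> 'a \<Rightarrow> 'a" (infixr \<open>*\<^sub>C\<close> 75)
    and star :: "'a \<Rightarrow> 'a"
  assumes scaleC_add_right: "c *\<^sub>C (x + y) = c *\<^sub>C x + c *\<^sub>C y"
    and scaleC_add_left: "(c + d) *\<^sub>C x = c *\<^sub>C x + d *\<^sub>C x"
    and scaleC_scaleC: "c *\<^sub>C d *\<^sub>C x = (c * d) *\<^sub>C x"
    and scaleC_of_real: "complex_of_real r *\<^sub>C x = r *\<^sub>R x"
    and mult_scaleC_left: "(c *\<^sub>C x) * y = c *\<^sub>C (x * y)"
    and mult_scaleC_right: "x * (c *\<^sub>C y) = c *\<^sub>C (x * y)"
    and norm_scaleC: "norm (c *\<^sub>C x) = cmod c * norm x"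
    and star_star: "star (star x) = x"
    and star_add: "star (x + y) = star x + star y"
    and star_scaleC: "star (c *\<^sub>C x) = cnj c *\<^sub>C star x"
    and star_mult: "star (x * y) = star y * star x"
    and cstar_identity: "norm (star x * x) = (norm x)\<^sup>2"

instantiation complex :: unital_cstar_algebra
begin

definition scaleC_complex :: "complex \<Rightarrow> complex \<Rightarrow> complex"
  where "scaleC_complex c x = c * x"

definition star_complex :: "complex \<Rightarrow> complex"
  where "star_complex = cnj"

instance
  by standard
    (auto simp: scaleC_complex_def star_complex_def algebra_simps norm_mult power2_eq_square
      scaleR_conv_of_real)

end

definition unital_star_hom ::
  "('a::unital_cstar_algebra \<Rightarrow> 'b::unital_cstar_algebra) \<Rightarrow> bool"
  where "unital_star_hom f \<longleftrightarrow>
    (\<forall>x y. f (x + y) = f x + f y) \<and> (\<forall>c x. f (c *\<^sub>C x) = c *\<^sub>C f x) \<and>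
    (\<forall>x y. f (x * y) = f x * f y) \<and> (\<forall>x. f (star x) = star (f x)) \<and> f 1 = 1"

definition state :: "('a::unital_cstar_algebra \<Rightarrow> complex) \<Rightarrow> bool"
  where "state \<omega> \<longleftrightarrow>
    (\<forall>x y. \<omega> (x + y) = \<omega> x + \<omega> y) \<and> (\<forall>c x. \<omega> (c *\<^sub>C x) = c * \<omega> x) \<and>
    (\<forall>x. \<omega> (star x * x) \<in> \<real>\<^sub>\<ge>\<^sub>0) \<and> \<omega> 1 = 1"


section \<open>Gradings\<close>

text \<open>
  The compact abelian group is written additively. Since it is compact, its dual is discrete, so
  continuity of characters of the dual is void.
\<close>

definition dual_group :: "('g::topological_ab_group_add \<Rightarrow> complex) set"
  where "dual_group = {\<xi>. continuous_on UNIV \<xi> \<and> (\<forall>g. cmod (\<xi> g) = 1) \<and>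
    (\<forall>g h. \<xi> (g + h) = \<xi> g * \<xi> h)}"

definition bicharacter ::
  "(('g::topological_ab_group_add \<Rightarrow> complex) \<Rightarrow> ('g \<Rightarrow> complex) \<Rightarrow> complex) \<Rightarrow> bool"
  where "bicharacter v \<longleftrightarrow>
    (\<forall>\<xi>\<in>dual_group. \<forall>\<eta>\<in>dual_group. cmod (v \<xi> \<eta>) = 1) \<and>
    (\<forall>\<xi>\<in>dual_group. \<forall>\<xi>'\<in>dual_group. \<forall>\<eta>\<in>dual_group.
      v (\<lambda>g. \<xi> g * \<xi>' g) \<eta> = v \<xi> \<eta> * v \<xi>' \<eta>) \<and>
    (\<forall>\<xi>\<in>dual_group. \<forall>\<eta>\<in>dual_group. \<forall>\<eta>'\<in>dual_group.
      v \<xi> (\<lambda>g. \<eta> g * \<eta>' g) = v \<xi> \<eta> * v \<xi> \<eta>')"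

definition homogeneous ::
  "('g \<Rightarrow> 'a::unital_cstar_algebra \<Rightarrow> 'a) \<Rightarrow> ('g \<Rightarrow> complex) \<Rightarrow> 'a set"
  where "homogeneous \<gamma> \<xi> = {a. \<forall>g. \<gamma> g a = \<xi> g *\<^sub>C a}"

definition algebraic_sum ::
  "('g::topological_ab_group_add \<Rightarrow> 'a::unital_cstar_algebra \<Rightarrow> 'a) \<Rightarrow> 'a set"
  where "algebraic_sum \<gamma> = {a. \<exists>F f. finite F \<and> F \<subseteq> dual_group \<and>
    (\<forall>\<xi>\<in>F. f \<xi> \<in> homogeneous \<gamma> \<xi>) \<and> a = (\<Sum>\<xi>\<in>F. f \<xi>)}"

text \<open>
  Density of the algebraic direct sum of the spectral subspaces holds for every pointwise norm
  continuous action of a compact abelian Hausdorff group (a consequence of the Peter-Weyl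
  theorem). The library has no Peter-Weyl theorem, so this fact is recorded as part of the
  structure; it does not restrict the class of systems.
\<close>

locale graded_cstar_algebra =
  fixes \<gamma> :: "'g::{topological_ab_group_add,t2_space} \<Rightarrow> 'a::unital_cstar_algebra \<Rightarrow> 'a"
  assumes compact_group: "compact (UNIV :: 'g set)"
    and action_aut: "unital_star_hom (\<gamma> g)" "bij (\<gamma> g)"
    and action_add: "\<gamma> (g + h) = \<gamma> g \<circ> \<gamma> h"
    and action_continuous: "continuous_on UNIV (\<lambda>g. \<gamma> g a)"
    and dense_algebraic_sum: "closure (algebraic_sum \<gamma>) = UNIV"

definition spectral_support ::
  "('g::topological_ab_group_add \<Rightarrow> 'a::unital_cstar_algebra \<Rightarrow> 'a) \<Rightarrow> ('a \<Rightarrow> complex) \<Rightarrow>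
    ('g \<Rightarrow> complex) set"
  where "spectral_support \<gamma> \<omega> = {\<eta> \<in> dual_group. \<exists>a\<in>homogeneous \<gamma> \<eta>. \<omega> a \<noteq> 0}"


section \<open>Algebraic tensor products\<close>

text \<open>
  For a complex subspace \<open>U\<close>, the algebraic tensor product of \<open>U\<close> with itself is realised
  as the space of functionals on the bilinear forms on \<open>U \<times> U\<close> spanned by the
  evaluations \<open>\<beta> \<mapsto> \<beta> a b\<close>, which are the elementary tensors. Two
  formal sums of elementary tensors agree in the tensor product iff every bilinear form takes the
  same value on both. Addition of tensors is pointwise addition of functionals.
\<close>

type_synonym 'a tensor = "('a \<Rightarrow> 'a \<Rightarrow> complex) \<Rightarrow> complex"

definition bilinear_form_on ::
  "'a::unital_cstar_algebra set \<Rightarrow> ('a \<Rightarrow> 'a \<Rightarrow> complex) \<Rightarrow> bool"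
  where "bilinear_form_on U \<beta> \<longleftrightarrow>
    (\<forall>a\<in>U. \<forall>b\<in>U. \<forall>c\<in>U. \<beta> (a + b) c = \<beta> a c + \<beta> b c \<and> \<beta> a (b + c) = \<beta> a b + \<beta> a c) \<and>
    (\<forall>k. \<forall>a\<in>U. \<forall>b\<in>U. \<beta> (k *\<^sub>C a) b = k * \<beta> a b \<and> \<beta> a (k *\<^sub>C b) = k * \<beta> a b)"

definition elem_tensor :: "'a::unital_cstar_algebra set \<Rightarrow> 'a \<Rightarrow> 'a \<Rightarrow> 'a tensor"
  where "elem_tensor U a b = (\<lambda>\<beta>. if bilinear_form_on U \<beta> then \<beta> a b else 0)"

definition tensor_space :: "'a::unital_cstar_algebra set \<Rightarrow> 'a tensor set"
  where "tensor_space U = {x. \<exists>(n::nat) a b. (\<forall>i<n. a i \<in> U \<and> b i \<in> U) \<and>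
    x = (\<Sum>i<n. elem_tensor U (a i) (b i))}"

definition scale_tensor :: "complex \<Rightarrow> 'a tensor \<Rightarrow> 'a tensor"
  where "scale_tensor c x = (\<lambda>\<beta>. c * x \<beta>)"


section \<open>Twisted tensor products\<close>

definition tens ::
  "('g::topological_ab_group_add \<Rightarrow> 'a::unital_cstar_algebra \<Rightarrow> 'a) \<Rightarrow> 'a \<Rightarrow> 'a \<Rightarrow> 'a tensor"
  where "tens \<gamma> = elem_tensor (algebraic_sum \<gamma>)"

definition alg_tensor ::
  "('g::topological_ab_group_add \<Rightarrow> 'a::unital_cstar_algebra \<Rightarrow> 'a) \<Rightarrow> 'a tensor set"
  where "alg_tensor \<gamma> = tensor_space (algebraic_sum \<gamma>)"

text \<open>
  Multiplication and involution are the bilinear, respectively conjugate linear, extensions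
  of the formulas for homogeneous elements; outside the tensor product they are set to 0. That they
  are well-defined is shown at the end of this theory.
\<close>

definition is_twisted_mult ::
  "('g::topological_ab_group_add \<Rightarrow> 'a::unital_cstar_algebra \<Rightarrow> 'a) \<Rightarrow>
    (('g \<Rightarrow> complex) \<Rightarrow> ('g \<Rightarrow> complex) \<Rightarrow> complex) \<Rightarrow>
    ('a tensor \<Rightarrow> 'a tensor \<Rightarrow> 'a tensor) \<Rightarrow> bool"
  where "is_twisted_mult \<gamma> v m \<longleftrightarrow>
    (\<forall>x y. x \<notin> alg_tensor \<gamma> \<or> y \<notin> alg_tensor \<gamma> \<longrightarrow> m x y = 0) \<and>
    (\<forall>x\<in>alg_tensor \<gamma>. \<forall>y\<in>alg_tensor \<gamma>. \<forall>z\<in>alg_tensor \<gamma>.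
      m (x + y) z = m x z + m y z \<and> m x (y + z) = m x y + m x z) \<and>
    (\<forall>k. \<forall>x\<in>alg_tensor \<gamma>. \<forall>y\<in>alg_tensor \<gamma>.
      m (scale_tensor k x) y = scale_tensor k (m x y) \<and>
      m x (scale_tensor k y) = scale_tensor k (m x y)) \<and>
    (\<forall>\<xi>\<^sub>1\<in>dual_group. \<forall>\<xi>\<^sub>2\<in>dual_group. \<forall>\<xi>\<^sub>3\<in>dual_group. \<forall>\<xi>\<^sub>4\<in>dual_group.
      \<forall>a\<in>homogeneous \<gamma> \<xi>\<^sub>1. \<forall>b\<in>homogeneous \<gamma> \<xi>\<^sub>2. \<forall>c\<in>homogeneous \<gamma> \<xi>\<^sub>3. \<forall>d\<in>homogeneous \<gamma> \<xi>\<^sub>4.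
      m (tens \<gamma> a b) (tens \<gamma> c d) = scale_tensor (cnj (v \<xi>\<^sub>3 \<xi>\<^sub>2)) (tens \<gamma> (a * c) (b * d)))"

definition is_twisted_star ::
  "('g::topological_ab_group_add \<Rightarrow> 'a::unital_cstar_algebra \<Rightarrow> 'a) \<Rightarrow>
    (('g \<Rightarrow> complex) \<Rightarrow> ('g \<Rightarrow> complex) \<Rightarrow> complex) \<Rightarrow>
    ('a tensor \<Rightarrow> 'a tensor) \<Rightarrow> bool"
  where "is_twisted_star \<gamma> v s \<longleftrightarrow>
    (\<forall>x. x \<notin> alg_tensor \<gamma> \<longrightarrow> s x = 0) \<and>
    (\<forall>x\<in>alg_tensor \<gamma>. \<forall>y\<in>alg_tensor \<gamma>. s (x + y) = s x + s y) \<and>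
    (\<forall>k. \<forall>x\<in>alg_tensor \<gamma>. s (scale_tensor k x) = scale_tensor (cnj k) (s x)) \<and>
    (\<forall>\<xi>\<^sub>1\<in>dual_group. \<forall>\<xi>\<^sub>2\<in>dual_group. \<forall>a\<in>homogeneous \<gamma> \<xi>\<^sub>1. \<forall>b\<in>homogeneous \<gamma> \<xi>\<^sub>2.
      s (tens \<gamma> a b) = scale_tensor (cnj (v \<xi>\<^sub>1 \<xi>\<^sub>2)) (tens \<gamma> (star a) (star b)))"

definition twisted_mult ::
  "('g::topological_ab_group_add \<Rightarrow> 'a::unital_cstar_algebra \<Rightarrow> 'a) \<Rightarrow>
    (('g \<Rightarrow> complex) \<Rightarrow> ('g \<Rightarrow> complex) \<Rightarrow> complex) \<Rightarrow> 'a tensor \<Rightarrow> 'a tensor \<Rightarrow> 'a tensor"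
  where "twisted_mult \<gamma> v = (THE m. is_twisted_mult \<gamma> v m)"

definition twisted_star ::
  "('g::topological_ab_group_add \<Rightarrow> 'a::unital_cstar_algebra \<Rightarrow> 'a) \<Rightarrow>
    (('g \<Rightarrow> complex) \<Rightarrow> ('g \<Rightarrow> complex) \<Rightarrow> complex) \<Rightarrow> 'a tensor \<Rightarrow> 'a tensor"
  where "twisted_star \<gamma> v = (THE s. is_twisted_star \<gamma> v s)"

definition twisted_cstar_norm ::
  "('g::topological_ab_group_add \<Rightarrow> 'a::unital_cstar_algebra \<Rightarrow> 'a) \<Rightarrow>
    (('g \<Rightarrow> complex) \<Rightarrow> ('g \<Rightarrow> complex) \<Rightarrow> complex) \<Rightarrow> ('a tensor \<Rightarrow> real) \<Rightarrow> bool"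
  where "twisted_cstar_norm \<gamma> v p \<longleftrightarrow>
    (\<forall>x\<in>alg_tensor \<gamma>. 0 \<le> p x \<and> (p x = 0 \<longleftrightarrow> x = 0)) \<and>
    (\<forall>x\<in>alg_tensor \<gamma>. \<forall>y\<in>alg_tensor \<gamma>. p (x + y) \<le> p x + p y) \<and>
    (\<forall>k. \<forall>x\<in>alg_tensor \<gamma>. p (scale_tensor k x) = cmod k * p x) \<and>
    (\<forall>x\<in>alg_tensor \<gamma>. \<forall>y\<in>alg_tensor \<gamma>. p (twisted_mult \<gamma> v x y) \<le> p x * p y) \<and>
    (\<forall>x\<in>alg_tensor \<gamma>. p (twisted_mult \<gamma> v (twisted_star \<gamma> v x) x) = (p x)\<^sup>2)"

definition maximal_twisted_cstar_norm ::
  "('g::topological_ab_group_add \<Rightarrow> 'a::unital_cstar_algebra \<Rightarrow> 'a) \<Rightarrow>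
    (('g \<Rightarrow> complex) \<Rightarrow> ('g \<Rightarrow> complex) \<Rightarrow> complex) \<Rightarrow> ('a tensor \<Rightarrow> real) \<Rightarrow> bool"
  where "maximal_twisted_cstar_norm \<gamma> v p \<longleftrightarrow> twisted_cstar_norm \<gamma> v p \<and>
    (\<forall>q. twisted_cstar_norm \<gamma> v q \<longrightarrow> (\<forall>x\<in>alg_tensor \<gamma>. q x \<le> p x))"

text \<open>
  The type \<open>'b\<close> is the twisted tensor product, presented by the canonical map \<open>\<iota>\<close>
  of the algebraic twisted tensor product into its completion: a *-homomorphism with dense range
  that is isometric for the maximal C*-norm. This determines the pair of \<open>'b\<close> and \<open>\<iota>\<close>
  up to a unique isometric *-isomorphism. The maps \<open>j\<^sub>1\<close> and \<open>j\<^sub>2\<close> are the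
  extensions of \<open>a \<mapsto> a \<otimes> 1\<close> and \<open>b \<mapsto> 1 \<otimes> b\<close> to the
  whole C*-algebra; they exist, and they are unique because *-homomorphisms between C*-algebras are
  continuous. For arbitrary \<open>a\<close> and \<open>b\<close> the element \<open>a \<otimes> b\<close> of the completion
  is \<open>j\<^sub>1 a * j\<^sub>2 b\<close>.
\<close>

locale twisted_tensor_product =
  fixes \<gamma> :: "'g::topological_ab_group_add \<Rightarrow> 'a::unital_cstar_algebra \<Rightarrow> 'a"
    and v :: "('g \<Rightarrow> complex) \<Rightarrow> ('g \<Rightarrow> complex) \<Rightarrow> complex"
    and \<iota> :: "'a tensor \<Rightarrow> 'b::unital_cstar_algebra"
    and j\<^sub>1 j\<^sub>2 :: "'a \<Rightarrow> 'b"
  assumes completion_add: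
      "x \<in> alg_tensor \<gamma> \<Longrightarrow> y \<in> alg_tensor \<gamma> \<Longrightarrow> \<iota> (x + y) = \<iota> x + \<iota> y"
    and completion_scale: "x \<in> alg_tensor \<gamma> \<Longrightarrow> \<iota> (scale_tensor k x) = k *\<^sub>C \<iota> x"
    and completion_mult:
      "x \<in> alg_tensor \<gamma> \<Longrightarrow> y \<in> alg_tensor \<gamma> \<Longrightarrow> \<iota> (twisted_mult \<gamma> v x y) = \<iota> x * \<iota> y"
    and completion_star: "x \<in> alg_tensor \<gamma> \<Longrightarrow> \<iota> (twisted_star \<gamma> v x) = star (\<iota> x)"
    and completion_norm: "maximal_twisted_cstar_norm \<gamma> v (\<lambda>x. norm (\<iota> x))"
    and completion_dense: "closure (\<iota> ` alg_tensor \<gamma>) = UNIV"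
    and left_hom: "unital_star_hom j\<^sub>1" "inj j\<^sub>1"
    and left_extends: "a \<in> algebraic_sum \<gamma> \<Longrightarrow> j\<^sub>1 a = \<iota> (tens \<gamma> a 1)"
    and right_hom: "unital_star_hom j\<^sub>2" "inj j\<^sub>2"
    and right_extends: "b \<in> algebraic_sum \<gamma> \<Longrightarrow> j\<^sub>2 b = \<iota> (tens \<gamma> 1 b)"

section \<open>Well-definedness of the twisted operations\<close>

declare plus_fun_apply [simp del] zero_fun_apply [simp del]

lemma scaleC_zero_right [simp]: "c *\<^sub>C 0 = (0::'a::unital_cstar_algebra)"
  using scaleC_add_right[of c "0::'a" 0] by simp

lemma scaleC_zero_left [simp]: "0 *\<^sub>C x = (0::'a::unital_cstar_algebra)"
  using scaleC_add_left[of 0 0 x] by simp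

lemma scaleC_one [simp]: "1 *\<^sub>C x = (x::'a::unital_cstar_algebra)"
  using scaleC_of_real[of 1 x] by simp

lemma scaleC_sum: "c *\<^sub>C (\<Sum>i\<in>F. f i) = (\<Sum>i\<in>F. c *\<^sub>C (f i :: 'a::unital_cstar_algebra))"
  by (induction F rule: infinite_finite_induct) (auto simp: scaleC_add_right)

lemma scaleC_diff_left: "(c - d) *\<^sub>C x = c *\<^sub>C x - d *\<^sub>C (x::'a::unital_cstar_algebra)"
  using scaleC_add_left[of "c - d" d x] by simp

lemma scaleC_commute: "c *\<^sub>C d *\<^sub>C x = d *\<^sub>C c *\<^sub>C (x::'a::unital_cstar_algebra)"
  by (simp add: scaleC_scaleC mult.commute)

lemma scaleC_eq_0_iff: "c *\<^sub>C x = 0 \<longleftrightarrow> c = 0 \<or> x = (0::'a::unital_cstar_algebra)"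
  using norm_scaleC[of c x] by (metis mult_eq_0_iff norm_eq_zero)

lemma star_zero [simp]: "star 0 = (0::'a::unital_cstar_algebra)"
  using star_add[of "0::'a" 0] by simp

lemma elem_tensor_simps:
  assumes "a \<in> U" "b \<in> U" "c \<in> U"
  shows "elem_tensor U (a + b) c = elem_tensor U a c + elem_tensor U b c"
    and "elem_tensor U a (b + c) = elem_tensor U a b + elem_tensor U a c"
    and "elem_tensor U (k *\<^sub>C a) b = scale_tensor k (elem_tensor U a b)"
    and "elem_tensor U a (k *\<^sub>C b) = scale_tensor k (elem_tensor U a b)"
  using assms by (auto simp: elem_tensor_def scale_tensor_def fun_eq_iff bilinear_form_on_def plus_fun_apply)

lemma scale_tensor_add: "scale_tensor k (x + y) = scale_tensor k x + scale_tensor k y"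
  by (auto simp: scale_tensor_def fun_eq_iff algebra_simps plus_fun_apply zero_fun_apply)

lemma scale_tensor_zero [simp]: "scale_tensor k 0 = 0" "scale_tensor 0 x = 0"
  by (auto simp: scale_tensor_def fun_eq_iff zero_fun_apply)

lemma scale_tensor_sum: "scale_tensor k (\<Sum>i\<in>I. x i) = (\<Sum>i\<in>I. scale_tensor k (x i))"
  by (induction I rule: infinite_finite_induct) (auto simp: scale_tensor_add)

lemma tensor_spaceI: "a \<in> U \<Longrightarrow> b \<in> U \<Longrightarrow> elem_tensor U a b \<in> tensor_space U"
  unfolding tensor_space_def
  by (rule CollectI, rule exI[of _ 1], rule exI[of _ "\<lambda>_. a"], rule exI[of _ "\<lambda>_. b"]) simp

lemma tensor_space_0: "0 \<in> tensor_space U"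
  unfolding tensor_space_def by (rule CollectI, rule exI[of _ 0]) auto

lemma tensor_space_add_elem:
  assumes "x \<in> tensor_space U" "a' \<in> U" "b' \<in> U"
  shows "x + elem_tensor U a' b' \<in> tensor_space U"
proof -
  obtain n a b where ab: "\<forall>i<n. a i \<in> U \<and> b i \<in> U" "x = (\<Sum>i<(n::nat). elem_tensor U (a i) (b i))"
    using assms(1) unfolding tensor_space_def by blast
  have "x + elem_tensor U a' b' = (\<Sum>i<Suc n. elem_tensor U ((a(n := a')) i) ((b(n := b')) i))"
    by (simp add: ab(2))
  moreover have "\<forall>i<Suc n. (a(n := a')) i \<in> U \<and> (b(n := b')) i \<in> U"
    using ab(1) assms by auto
  ultimately show ?thesis unfolding tensor_space_def by blast
qed

lemma tensor_space_induct [consumes 1, case_names zero add]: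
  assumes "x \<in> tensor_space U" and "P 0"
    and "\<And>x a b. x \<in> tensor_space U \<Longrightarrow> P x \<Longrightarrow> a \<in> U \<Longrightarrow> b \<in> U \<Longrightarrow> P (x + elem_tensor U a b)"
  shows "P x"
proof -
  obtain n a b where ab: "\<forall>i<n. a i \<in> U \<and> b i \<in> U" "x = (\<Sum>i<(n::nat). elem_tensor U (a i) (b i))"
    using assms(1) unfolding tensor_space_def by blast
  have "(\<Sum>i<m. elem_tensor U (a i) (b i)) \<in> tensor_space U \<and>
      P (\<Sum>i<m. elem_tensor U (a i) (b i))" if "m \<le> n" for m
    using that
  proof (induction m)
    case 0
    then show ?case using assms(2) tensor_space_0 by simp
  next
    case (Suc m)
    then have "a m \<in> U" "b m \<in> U" and IH: "(\<Sum>i<m. elem_tensor U (a i) (b i)) \<in> tensor_space U"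
      "P (\<Sum>i<m. elem_tensor U (a i) (b i))"
      using ab(1) by auto
    then show ?case
      using assms(3)[OF IH] tensor_space_add_elem[OF IH(1)] by (simp only: sum.lessThan_Suc)
  qed
  then show ?thesis using ab(2) by blast
qed

lemma tensor_space_add:
  assumes "x \<in> tensor_space U" "y \<in> tensor_space U"
  shows "x + y \<in> tensor_space U"
  using assms(2)
proof (induction rule: tensor_space_induct)
  case zero
  then show ?case using assms(1) by simp
next
  case (add y a b)
  then show ?case using tensor_space_add_elem[of "x + y" U a b] by (simp add: add.assoc)
qed

lemma tensor_space_sum: "(\<And>i. i \<in> I \<Longrightarrow> x i \<in> tensor_space U) \<Longrightarrow> (\<Sum>i\<in>I. x i) \<in> tensor_space U"
  by (induction I rule: infinite_finite_induct) (auto intro: tensor_space_add tensor_space_0)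

lemma tensor_space_scale:
  assumes "\<And>a k. a \<in> U \<Longrightarrow> k *\<^sub>C a \<in> U" "x \<in> tensor_space U"
  shows "scale_tensor k x \<in> tensor_space U"
  using assms(2)
proof (induction rule: tensor_space_induct)
  case zero
  then show ?case using tensor_space_0 by simp
next
  case (add y a b)
  then show ?case
    using tensor_space_add_elem[of "scale_tensor k y" U "k *\<^sub>C a" b] assms(1)
    by (simp add: scale_tensor_add elem_tensor_simps)
qed

lemma tensor_linear:
  assumes "x \<in> tensor_space U" "bilinear_form_on U \<beta>" "bilinear_form_on U \<beta>'"
  shows "x (\<lambda>a b. \<beta> a b + \<beta>' a b) = x \<beta> + x \<beta>'"
    and "x (\<lambda>a b. k * \<beta> a b) = k * x \<beta>"
proof -
  have *: "bilinear_form_on U (\<lambda>a b. \<beta> a b + \<beta>' a b)" "bilinear_form_on U (\<lambda>a b. k * \<beta> a b)"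
    using assms(2,3) by (auto simp: bilinear_form_on_def algebra_simps)
  show "x (\<lambda>a b. \<beta> a b + \<beta>' a b) = x \<beta> + x \<beta>'"
    using assms(1) by (induction rule: tensor_space_induct)
      (use * assms in \<open>auto simp: elem_tensor_def plus_fun_apply zero_fun_apply\<close>)
  show "x (\<lambda>a b. k * \<beta> a b) = k * x \<beta>"
    using assms(1) by (induction rule: tensor_space_induct)
      (use * assms in \<open>auto simp: elem_tensor_def algebra_simps plus_fun_apply zero_fun_apply\<close>)
qed

lemma tensor_cong:
  assumes "x \<in> tensor_space U" "bilinear_form_on U \<beta>" "bilinear_form_on U \<beta>'"
    and "\<And>a b. a \<in> U \<Longrightarrow> b \<in> U \<Longrightarrow> \<beta> a b = \<beta>' a b"
  shows "x \<beta> = x \<beta>'"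
  using assms(1) by (induction rule: tensor_space_induct)
    (use assms in \<open>auto simp: elem_tensor_def plus_fun_apply zero_fun_apply\<close>)

lemma dual_group_mult:
  "\<xi> \<in> dual_group \<Longrightarrow> \<eta> \<in> dual_group \<Longrightarrow> (\<lambda>g. \<xi> g * \<eta> g) \<in> dual_group"
  by (auto simp: dual_group_def norm_mult intro!: continuous_intros)

lemma dual_group_cnj: "\<xi> \<in> dual_group \<Longrightarrow> (\<lambda>g. cnj (\<xi> g)) \<in> dual_group"
  by (auto simp: dual_group_def intro!: continuous_intros)

definition linear_on :: "'a::unital_cstar_algebra set \<Rightarrow> ('a \<Rightarrow> complex) \<Rightarrow> bool"
  where "linear_on U h \<longleftrightarrow> (\<forall>x\<in>U. \<forall>y\<in>U. h (x + y) = h x + h y) \<and> (\<forall>k. \<forall>x\<in>U. h (k *\<^sub>C x) = k * h x)"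

context graded_cstar_algebra
begin

abbreviation U where "U \<equiv> algebraic_sum \<gamma>"

definition is_decomp :: "(('g \<Rightarrow> complex) \<Rightarrow> 'a) \<Rightarrow> 'a \<Rightarrow> bool"
  where "is_decomp f a \<longleftrightarrow> finite {\<xi>. f \<xi> \<noteq> 0} \<and> {\<xi>. f \<xi> \<noteq> 0} \<subseteq> dual_group \<and>
    (\<forall>\<xi>. f \<xi> \<in> homogeneous \<gamma> \<xi>) \<and> a = (\<Sum>\<xi> | f \<xi> \<noteq> 0. f \<xi>)"

definition hcomp :: "'a \<Rightarrow> ('g \<Rightarrow> complex) \<Rightarrow> 'a"
  where "hcomp a = (SOME f. is_decomp f a)"

text \<open>The sum of \<open>h \<xi> a\<^sub>\<xi>\<close> over the homogeneous components \<open>a\<^sub>\<xi>\<close> of \<open>a\<close>.\<close>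

definition csum :: "'a \<Rightarrow> (('g \<Rightarrow> complex) \<Rightarrow> 'a \<Rightarrow> complex) \<Rightarrow> complex"
  where "csum a h = (\<Sum>\<xi> | hcomp a \<xi> \<noteq> 0. h \<xi> (hcomp a \<xi>))"

lemma action_simps:
  "\<gamma> g (a + b) = \<gamma> g a + \<gamma> g b" "\<gamma> g (c *\<^sub>C a) = c *\<^sub>C \<gamma> g a"
  "\<gamma> g (a * b) = \<gamma> g a * \<gamma> g b" "\<gamma> g (star a) = star (\<gamma> g a)" "\<gamma> g 1 = 1"
  using action_aut(1) by (auto simp: unital_star_hom_def)

lemma action_zero: "\<gamma> g 0 = 0"
  using action_simps(1)[of g 0 0] by simp

lemma homogeneous_closed:
  "0 \<in> homogeneous \<gamma> \<xi>"
  "a \<in> homogeneous \<gamma> \<xi> \<Longrightarrow> b \<in> homogeneous \<gamma> \<xi> \<Longrightarrow> a + b \<in> homogeneous \<gamma> \<xi>"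
  "a \<in> homogeneous \<gamma> \<xi> \<Longrightarrow> c *\<^sub>C a \<in> homogeneous \<gamma> \<xi>"
  "a \<in> homogeneous \<gamma> \<xi> \<Longrightarrow> b \<in> homogeneous \<gamma> \<eta> \<Longrightarrow> a * b \<in> homogeneous \<gamma> (\<lambda>g. \<xi> g * \<eta> g)"
  "a \<in> homogeneous \<gamma> \<xi> \<Longrightarrow> star a \<in> homogeneous \<gamma> (\<lambda>g. cnj (\<xi> g))"
  by (auto simp: homogeneous_def action_simps action_zero scaleC_add_right scaleC_commute
      mult_scaleC_left mult_scaleC_right scaleC_scaleC star_scaleC mult.commute)

lemma components_independent:
  assumes "finite F" "F \<subseteq> dual_group" "\<And>\<xi>. \<xi> \<in> F \<Longrightarrow> f \<xi> \<in> homogeneous \<gamma> \<xi>" "(\<Sum>\<xi>\<in>F. f \<xi>) = 0"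
  shows "\<forall>\<xi>\<in>F. f \<xi> = 0"
  using assms
proof (induction F arbitrary: f rule: finite_induct)
  case (insert \<eta> F)
  have act: "\<gamma> g (\<Sum>\<xi>\<in>G. f \<xi>) = (\<Sum>\<xi>\<in>G. \<gamma> g (f \<xi>))" for g and G
    by (induction G rule: infinite_finite_induct) (auto simp: action_zero action_simps)
  have "f \<xi> = 0" if \<xi>: "\<xi> \<in> F" for \<xi>
  proof -
    have "(\<xi> g - \<eta> g) *\<^sub>C f \<xi> = 0" for g
    proof -
      have "(\<Sum>\<xi>\<in>insert \<eta> F. (\<xi> g - \<eta> g) *\<^sub>C f \<xi>) =
          (\<Sum>\<xi>\<in>insert \<eta> F. \<xi> g *\<^sub>C f \<xi>) - \<eta> g *\<^sub>C (\<Sum>\<xi>\<in>insert \<eta> F. f \<xi>)"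
        by (simp only: scaleC_diff_left sum_subtractf scaleC_sum)
      also have "(\<Sum>\<xi>\<in>insert \<eta> F. \<xi> g *\<^sub>C f \<xi>) = (\<Sum>\<xi>\<in>insert \<eta> F. \<gamma> g (f \<xi>))"
      proof (rule sum.cong)
        fix \<zeta> assume "\<zeta> \<in> insert \<eta> F"
        from insert.prems(2)[OF this] show "\<zeta> g *\<^sub>C f \<zeta> = \<gamma> g (f \<zeta>)"
          by (simp add: homogeneous_def)
      qed simp
      also have "\<dots> = 0"
        unfolding act[symmetric] insert.prems(3) by (rule action_zero)
      finally have "(\<Sum>\<xi>\<in>insert \<eta> F. (\<xi> g - \<eta> g) *\<^sub>C f \<xi>) = 0"
        unfolding insert.prems(3) by simp
      then have "(\<Sum>\<xi>\<in>F. (\<xi> g - \<eta> g) *\<^sub>C f \<xi>) = 0"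
        using insert.hyps by simp
      then have "\<forall>\<xi>\<in>F. (\<xi> g - \<eta> g) *\<^sub>C f \<xi> = 0"
        using insert.prems by (intro insert.IH) (auto intro: homogeneous_closed)
      then show ?thesis using \<xi> by blast
    qed
    moreover have "\<exists>g. \<xi> g \<noteq> \<eta> g"
      using \<xi> insert.hyps(2) by (metis ext)
    ultimately show ?thesis by (metis scaleC_eq_0_iff eq_iff_diff_eq_0)
  qed
  moreover from this have "f \<eta> = 0"
    using insert.prems(3) insert.hyps by simp
  ultimately show ?case by blast
qed simp

lemma homogeneous_U: "\<xi> \<in> dual_group \<Longrightarrow> a \<in> homogeneous \<gamma> \<xi> \<Longrightarrow> a \<in> U"
  unfolding algebraic_sum_def by (rule CollectI, rule exI[of _ "{\<xi>}"], rule exI[of _ "\<lambda>_. a"]) simp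

lemma is_decomp_sum:
  assumes "is_decomp f a" "finite F" "{\<xi>. f \<xi> \<noteq> 0} \<subseteq> F"
  shows "a = (\<Sum>\<xi>\<in>F. f \<xi>)"
  using assms unfolding is_decomp_def by (metis (mono_tags, lifting) DiffE mem_Collect_eq sum.mono_neutral_left)

lemma is_decompI:
  assumes "finite F" "F \<subseteq> dual_group" "\<And>\<xi>. \<xi> \<in> F \<Longrightarrow> f \<xi> \<in> homogeneous \<gamma> \<xi>"
    "\<And>\<xi>. \<xi> \<notin> F \<Longrightarrow> f \<xi> = 0" "a = (\<Sum>\<xi>\<in>F. f \<xi>)"
  shows "is_decomp f a"
proof -
  have sub: "{\<xi>. f \<xi> \<noteq> 0} \<subseteq> F" using assms(4) by blast
  moreover have "(\<Sum>\<xi>\<in>F. f \<xi>) = (\<Sum>\<xi> | f \<xi> \<noteq> 0. f \<xi>)"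
    by (rule sum.mono_neutral_right) (use assms(1) sub in auto)
  moreover have "f \<xi> \<in> homogeneous \<gamma> \<xi>" for \<xi>
    using assms(3,4) homogeneous_closed(1) by (cases "\<xi> \<in> F") auto
  ultimately show ?thesis
    using assms finite_subset unfolding is_decomp_def by blast
qed

lemma is_decomp_exists: assumes "a \<in> U" shows "\<exists>f. is_decomp f a"
proof -
  obtain F f where "finite F" "F \<subseteq> dual_group" "\<forall>\<xi>\<in>F. f \<xi> \<in> homogeneous \<gamma> \<xi>" "a = (\<Sum>\<xi>\<in>F. f \<xi>)"
    using assms unfolding algebraic_sum_def by blast
  then have "is_decomp (\<lambda>\<xi>. if \<xi> \<in> F then f \<xi> else 0) a"
    by (intro is_decompI[of F]) auto
  then show ?thesis by blast
qed

lemma is_decomp_U: "is_decomp f a \<Longrightarrow> a \<in> U"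
  unfolding is_decomp_def algebraic_sum_def by blast

lemma is_decomp_add:
  assumes "is_decomp f a" "is_decomp f' b"
  shows "is_decomp (\<lambda>\<xi>. f \<xi> + f' \<xi>) (a + b)"
proof (rule is_decompI[of "{\<xi>. f \<xi> \<noteq> 0} \<union> {\<xi>. f' \<xi> \<noteq> 0}"])
  let ?F = "{\<xi>. f \<xi> \<noteq> 0} \<union> {\<xi>. f' \<xi> \<noteq> 0}"
  show fin: "finite ?F" and "?F \<subseteq> dual_group" using assms unfolding is_decomp_def by auto
  show "f \<xi> + f' \<xi> \<in> homogeneous \<gamma> \<xi>" for \<xi>
    using assms homogeneous_closed(2) unfolding is_decomp_def by blast
  show "a + b = (\<Sum>\<xi>\<in>?F. f \<xi> + f' \<xi>)"
    using is_decomp_sum[OF assms(1) fin] is_decomp_sum[OF assms(2) fin] by (simp add: sum.distrib)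
qed auto

lemma is_decomp_scale:
  assumes "is_decomp f a"
  shows "is_decomp (\<lambda>\<xi>. k *\<^sub>C f \<xi>) (k *\<^sub>C a)"
proof (rule is_decompI[of "{\<xi>. f \<xi> \<noteq> 0}"])
  let ?F = "{\<xi>. f \<xi> \<noteq> 0}"
  show "finite ?F" "?F \<subseteq> dual_group" using assms unfolding is_decomp_def by auto
  show "k *\<^sub>C f \<xi> \<in> homogeneous \<gamma> \<xi>" for \<xi>
    using assms homogeneous_closed(3) unfolding is_decomp_def by blast
  show "k *\<^sub>C a = (\<Sum>\<xi>\<in>?F. k *\<^sub>C f \<xi>)"
    using assms unfolding is_decomp_def by (metis scaleC_sum)
qed auto

lemma is_decomp_unique:
  assumes "is_decomp f a" "is_decomp f' a"
  shows "f = f'"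
proof -
  let ?h = "\<lambda>\<xi>. f \<xi> + (-1) *\<^sub>C f' \<xi>"
  have m1: "(-1) *\<^sub>C x = - x" for x :: 'a
    using scaleC_of_real[of "-1" x] by simp
  have h: "is_decomp ?h 0"
    using is_decomp_add[OF assms(1) is_decomp_scale[OF assms(2), of "-1"]] by (simp add: m1)
  then have "\<forall>\<xi>\<in>{\<xi>. ?h \<xi> \<noteq> 0}. ?h \<xi> = 0"
    unfolding is_decomp_def by (intro components_independent) auto
  then have "f \<xi> = f' \<xi>" for \<xi> by (auto simp: m1)
  then show ?thesis by blast
qed

lemma hcomp_eq: "is_decomp f a \<Longrightarrow> hcomp a = f"
  unfolding hcomp_def by (rule some_equality) (auto intro: is_decomp_unique)

lemma hcomp_decomp: "a \<in> U \<Longrightarrow> is_decomp (hcomp a) a"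
  using is_decomp_exists hcomp_eq by metis

lemma U_add: "a \<in> U \<Longrightarrow> b \<in> U \<Longrightarrow> a + b \<in> U"
  using hcomp_decomp is_decomp_add is_decomp_U by blast

lemma U_scale: "a \<in> U \<Longrightarrow> k *\<^sub>C a \<in> U"
  using hcomp_decomp is_decomp_scale is_decomp_U by blast

lemma U_0: "0 \<in> U"
  unfolding algebraic_sum_def by (rule CollectI, rule exI[of _ "{}"]) auto

lemma U_sum: "(\<And>i. i \<in> I \<Longrightarrow> f i \<in> U) \<Longrightarrow> (\<Sum>i\<in>I. f i) \<in> U"
  by (induction I rule: infinite_finite_induct) (auto intro: U_add U_0)

lemma U_induct [consumes 1, case_names zero add]:
  assumes "a \<in> U" "P 0"
    "\<And>a b \<xi>. a \<in> U \<Longrightarrow> P a \<Longrightarrow> \<xi> \<in> dual_group \<Longrightarrow> b \<in> homogeneous \<gamma> \<xi> \<Longrightarrow> P (a + b)"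
  shows "P a"
proof -
  obtain F f where F: "finite F" "F \<subseteq> dual_group" "\<forall>\<xi>\<in>F. f \<xi> \<in> homogeneous \<gamma> \<xi>" "a = (\<Sum>\<xi>\<in>F. f \<xi>)"
    using assms(1) unfolding algebraic_sum_def by blast
  from F(1-3) have "(\<Sum>\<xi>\<in>F. f \<xi>) \<in> U \<and> P (\<Sum>\<xi>\<in>F. f \<xi>)"
  proof (induction F rule: finite_induct)
    case (insert \<xi> F)
    then show ?case
      using assms(3)[of "\<Sum>\<xi>\<in>F. f \<xi>" \<xi> "f \<xi>"] U_add homogeneous_U[of \<xi> "f \<xi>"]
      by (simp add: add.commute)
  qed (use assms(2) U_0 in auto)
  then show ?thesis using F(4) by blast
qed

lemma U_mult_homogeneous:
  assumes "a \<in> U" "\<xi> \<in> dual_group" "b \<in> homogeneous \<gamma> \<xi>"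
  shows "a * b \<in> U" "b * a \<in> U"
  using assms(1)
proof (induction rule: U_induct)
  case (add a c \<eta>)
  have "c * b \<in> U" "b * c \<in> U"
    using add assms(2,3) homogeneous_closed(4) dual_group_mult homogeneous_U by blast+
  { case 1 then show ?case using add \<open>c * b \<in> U\<close> by (simp add: distrib_right U_add) }
  { case 2 then show ?case using add \<open>b * c \<in> U\<close> by (simp add: distrib_left U_add) }
qed (auto simp: U_0)

lemma star_homogeneous_U: "\<xi> \<in> dual_group \<Longrightarrow> b \<in> homogeneous \<gamma> \<xi> \<Longrightarrow> star b \<in> U"
  using homogeneous_closed(5) dual_group_cnj homogeneous_U by blast

lemma linear_on_0: "linear_on U h \<Longrightarrow> h 0 = 0"
  unfolding linear_on_def using U_0 by (metis mult_zero_left scaleC_zero_left)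

lemma csum_superset:
  assumes "a \<in> U" "\<And>\<xi>. \<xi> \<in> dual_group \<Longrightarrow> linear_on U (h \<xi>)" "finite F" "{\<xi>. hcomp a \<xi> \<noteq> 0} \<subseteq> F"
    "F \<subseteq> dual_group"
  shows "csum a h = (\<Sum>\<xi>\<in>F. h \<xi> (hcomp a \<xi>))"
  unfolding csum_def
proof (rule sum.mono_neutral_left)
  show "\<forall>\<xi>\<in>F - {\<xi>. hcomp a \<xi> \<noteq> 0}. h \<xi> (hcomp a \<xi>) = 0"
    using assms(2,5) linear_on_0 by auto
qed (use assms in auto)

lemma hcomp_props:
  assumes "a \<in> U"
  shows "finite {\<xi>. hcomp a \<xi> \<noteq> 0}" "{\<xi>. hcomp a \<xi> \<noteq> 0} \<subseteq> dual_group"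
    "hcomp a \<xi> \<in> homogeneous \<gamma> \<xi>"
  using hcomp_decomp[OF assms] unfolding is_decomp_def by auto

lemma csum_add:
  assumes "a \<in> U" "b \<in> U" and h: "\<And>\<xi>. \<xi> \<in> dual_group \<Longrightarrow> linear_on U (h \<xi>)"
  shows "csum (a + b) h = csum a h + csum b h"
proof -
  let ?F = "{\<xi>. hcomp a \<xi> \<noteq> 0} \<union> {\<xi>. hcomp b \<xi> \<noteq> 0}"
  have c: "hcomp (a + b) = (\<lambda>\<xi>. hcomp a \<xi> + hcomp b \<xi>)"
    using hcomp_eq is_decomp_add hcomp_decomp assms by blast
  have F: "finite ?F" "?F \<subseteq> dual_group" using hcomp_props assms by auto
  have "csum (a + b) h = (\<Sum>\<xi>\<in>?F. h \<xi> (hcomp (a + b) \<xi>))"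
    by (rule csum_superset) (use assms F U_add c in auto)
  also have "\<dots> = (\<Sum>\<xi>\<in>?F. h \<xi> (hcomp a \<xi>) + h \<xi> (hcomp b \<xi>))"
  proof (rule sum.cong)
    fix \<xi> assume "\<xi> \<in> ?F"
    then have "\<xi> \<in> dual_group" using F by blast
    then show "h \<xi> (hcomp (a + b) \<xi>) = h \<xi> (hcomp a \<xi>) + h \<xi> (hcomp b \<xi>)"
      using h[of \<xi>] hcomp_props(3) homogeneous_U assms(1,2) unfolding c linear_on_def by blast
  qed simp
  also have "\<dots> = (\<Sum>\<xi>\<in>?F. h \<xi> (hcomp a \<xi>)) + (\<Sum>\<xi>\<in>?F. h \<xi> (hcomp b \<xi>))"
    by (rule sum.distrib)
  also have "(\<Sum>\<xi>\<in>?F. h \<xi> (hcomp a \<xi>)) = csum a h"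
    by (rule csum_superset[symmetric, OF assms(1) h F(1) _ F(2)]) auto
  also have "(\<Sum>\<xi>\<in>?F. h \<xi> (hcomp b \<xi>)) = csum b h"
    by (rule csum_superset[symmetric, OF assms(2) h F(1) _ F(2)]) auto
  finally show ?thesis .
qed

lemma csum_scale:
  assumes "a \<in> U" and h: "\<And>\<xi>. \<xi> \<in> dual_group \<Longrightarrow> linear_on U (h \<xi>)"
  shows "csum (k *\<^sub>C a) h = k * csum a h"
proof -
  let ?F = "{\<xi>. hcomp a \<xi> \<noteq> 0}"
  have c: "hcomp (k *\<^sub>C a) = (\<lambda>\<xi>. k *\<^sub>C hcomp a \<xi>)"
    using hcomp_eq is_decomp_scale hcomp_decomp assms by blast
  have F: "finite ?F" "?F \<subseteq> dual_group" using hcomp_props assms by auto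
  have "csum (k *\<^sub>C a) h = (\<Sum>\<xi>\<in>?F. h \<xi> (hcomp (k *\<^sub>C a) \<xi>))"
    by (rule csum_superset) (use assms F U_scale c in auto)
  also have "\<dots> = (\<Sum>\<xi>\<in>?F. k * h \<xi> (hcomp a \<xi>))"
  proof (rule sum.cong)
    fix \<xi> assume "\<xi> \<in> ?F"
    then have "\<xi> \<in> dual_group" using F by blast
    then show "h \<xi> (hcomp (k *\<^sub>C a) \<xi>) = k * h \<xi> (hcomp a \<xi>)"
      using h[of \<xi>] hcomp_props(3) homogeneous_U assms(1) unfolding c linear_on_def by blast
  qed simp
  also have "\<dots> = k * csum a h" by (simp add: csum_def sum_distrib_left)
  finally show ?thesis .
qed

lemma csum_cong:
  assumes "a \<in> U" "\<And>\<xi> b. \<xi> \<in> dual_group \<Longrightarrow> b \<in> homogeneous \<gamma> \<xi> \<Longrightarrow> h \<xi> b = h' \<xi> b"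
  shows "csum a h = csum a h'"
  unfolding csum_def
proof (rule sum.cong)
  fix \<xi> assume "\<xi> \<in> {\<xi>. hcomp a \<xi> \<noteq> 0}"
  then have "\<xi> \<in> dual_group" using hcomp_props(2)[OF assms(1)] by blast
  then show "h \<xi> (hcomp a \<xi>) = h' \<xi> (hcomp a \<xi>)" using assms hcomp_props(3) by blast
qed simp

lemma csum_homogeneous:
  assumes "\<xi> \<in> dual_group" "a \<in> homogeneous \<gamma> \<xi>" and h: "\<And>\<xi>. \<xi> \<in> dual_group \<Longrightarrow> linear_on U (h \<xi>)"
  shows "csum a h = h \<xi> a"
proof -
  have "is_decomp (\<lambda>\<eta>. if \<eta> = \<xi> then a else 0) a"
    by (rule is_decompI[of "{\<xi>}"]) (use assms in auto)
  then have c: "hcomp a = (\<lambda>\<eta>. if \<eta> = \<xi> then a else 0)" by (rule hcomp_eq)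
  show ?thesis
    by (subst csum_superset[where F = "{\<xi>}"]) (use assms homogeneous_U c in auto)
qed

lemma csum_distrib:
  "csum a (\<lambda>\<xi> b. h \<xi> b + h' \<xi> b) = csum a h + csum a h'"
  "csum a (\<lambda>\<xi> b. k * h \<xi> b) = k * csum a h"
  by (simp_all add: csum_def sum.distrib sum_distrib_left)

lemma alg_tensor_closed:
  "x \<in> alg_tensor \<gamma> \<Longrightarrow> y \<in> alg_tensor \<gamma> \<Longrightarrow> x + y \<in> alg_tensor \<gamma>"
  "x \<in> alg_tensor \<gamma> \<Longrightarrow> scale_tensor k x \<in> alg_tensor \<gamma>"
  "0 \<in> alg_tensor \<gamma>"
  "a \<in> U \<Longrightarrow> b \<in> U \<Longrightarrow> tens \<gamma> a b \<in> alg_tensor \<gamma>"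
  unfolding alg_tensor_def tens_def
  by (auto intro: tensor_space_add tensor_space_scale U_scale tensor_space_0 tensor_spaceI)

lemma tens_zero:
  assumes "a \<in> U" shows "tens \<gamma> 0 a = 0" "tens \<gamma> a 0 = 0"
  using elem_tensor_simps(3)[OF assms assms assms, of 0]
    elem_tensor_simps(4)[OF assms assms assms, of 0]
    elem_tensor_simps(3)[OF U_0 assms assms, of 0] elem_tensor_simps(4)[OF assms U_0 assms, of 0]
  unfolding tens_def by simp_all

lemma alg_tensor_induct [consumes 1, case_names zero add]:
  assumes "x \<in> alg_tensor \<gamma>" "P 0"
    and step: "\<And>x a b \<xi> \<eta>. x \<in> alg_tensor \<gamma> \<Longrightarrow> P x \<Longrightarrow> \<xi> \<in> dual_group \<Longrightarrow> \<eta> \<in> dual_group \<Longrightarrow>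
      a \<in> homogeneous \<gamma> \<xi> \<Longrightarrow> b \<in> homogeneous \<gamma> \<eta> \<Longrightarrow> P (x + tens \<gamma> a b)"
  shows "P x"
  using assms(1) unfolding alg_tensor_def
proof (induction rule: tensor_space_induct)
  case (add x a b)
  have hom: "P (x + tens \<gamma> a b)"
    if "\<xi> \<in> dual_group" "a \<in> homogeneous \<gamma> \<xi>" "x \<in> alg_tensor \<gamma>" "P x" "b \<in> U" for x a b \<xi>
    using \<open>b \<in> U\<close>
  proof (induction rule: U_induct)
    case zero
    show ?case using tens_zero(2)[OF homogeneous_U[OF that(1,2)]] that(4) by simp
  next
    case (add b c \<eta>)
    have U: "a \<in> U" "b \<in> U" "c \<in> U"
      using that(1,2) add.hyps homogeneous_U by blast+
    then have "tens \<gamma> a (b + c) = tens \<gamma> a b + tens \<gamma> a c"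
      unfolding tens_def by (intro elem_tensor_simps(2))
    moreover have "x + tens \<gamma> a b \<in> alg_tensor \<gamma>"
      using that(3) U alg_tensor_closed(1,4) by blast
    ultimately show ?case
      using step[OF _ add.IH that(1) add.hyps(2) that(2) add.hyps(3)] by (simp only: add.assoc)
  qed
  have "P (x + tens \<gamma> a b)" using \<open>a \<in> U\<close>
  proof (induction rule: U_induct)
    case zero
    show ?case using tens_zero(1)[OF \<open>b \<in> U\<close>] \<open>P x\<close> by simp
  next
    case (add a c \<eta>)
    note outer = \<open>x \<in> tensor_space U\<close> \<open>b \<in> U\<close> and inner = add.IH add.hyps
    have U: "a \<in> U" "c \<in> U" "b \<in> U"
      using outer inner homogeneous_U by blast+
    then have "tens \<gamma> (a + c) b = tens \<gamma> a b + tens \<gamma> c b"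
      unfolding tens_def by (intro elem_tensor_simps(1))
    moreover have "x + tens \<gamma> a b \<in> alg_tensor \<gamma>"
      using outer(1) U alg_tensor_closed(1,4) unfolding alg_tensor_def[symmetric] by blast
    ultimately show ?case
      using hom[OF add.hyps(2,3) _ add.IH outer(2)] by (simp only: add.assoc)
  qed
  then show ?case by (simp add: tens_def)
qed (rule assms(2))

definition mult_form where
  "mult_form v \<beta> a b = (\<lambda>c d. csum b (\<lambda>\<xi> b'. csum c (\<lambda>\<eta> c'. cnj (v \<eta> \<xi>) * \<beta> (a * c') (b' * d))))"

definition star_form where
  "star_form v \<beta> a b = csum a (\<lambda>\<xi> a'. csum b (\<lambda>\<eta> b'. cnj (cnj (v \<xi> \<eta>) * \<beta> (star a') (star b'))))"

lemma U_mult: assumes "a \<in> U" "b \<in> U" shows "a * b \<in> U"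
  using assms(2)
proof (induction rule: U_induct)
  case (add b c \<xi>)
  then show ?case using U_mult_homogeneous(1)[OF assms(1), of \<xi> c] by (simp add: distrib_left U_add)
qed (simp add: U_0)

lemma U_star: "a \<in> U \<Longrightarrow> star a \<in> U"
proof (induction rule: U_induct)
  case (add b c \<xi>)
  then show ?case using star_homogeneous_U by (simp add: star_add U_add)
qed (simp add: U_0)

lemma bil:
  assumes "bilinear_form_on U \<beta>"
  shows "a \<in> U \<Longrightarrow> b \<in> U \<Longrightarrow> c \<in> U \<Longrightarrow> \<beta> (a + b) c = \<beta> a c + \<beta> b c"
    and "a \<in> U \<Longrightarrow> b \<in> U \<Longrightarrow> c \<in> U \<Longrightarrow> \<beta> a (b + c) = \<beta> a b + \<beta> a c"
    and "a \<in> U \<Longrightarrow> b \<in> U \<Longrightarrow> \<beta> (k *\<^sub>C a) b = k * \<beta> a b"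
    and "a \<in> U \<Longrightarrow> b \<in> U \<Longrightarrow> \<beta> a (k *\<^sub>C b) = k * \<beta> a b"
  using assms unfolding bilinear_form_on_def by blast+

lemma mult_form_inner:
  assumes "bilinear_form_on U \<beta>" "a \<in> U" "b \<in> U" "d \<in> U"
  shows "linear_on U (\<lambda>c. k * \<beta> (a * c) (b * d))"
  using assms unfolding linear_on_def
  by (simp add: distrib_left mult_scaleC_right bil U_mult algebra_simps)

lemma mult_form_outer:
  assumes \<beta>: "bilinear_form_on U \<beta>" and a: "a \<in> U" "c \<in> U" "d \<in> U"
  shows "linear_on U (\<lambda>b. csum c (\<lambda>\<eta> c'. cnj (v \<eta> \<xi>) * \<beta> (a * c') (b * d)))"
  unfolding linear_on_def
proof (intro conjI ballI allI)
  fix x y assume xy: "x \<in> U" "y \<in> U"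
  show "csum c (\<lambda>\<eta> c'. cnj (v \<eta> \<xi>) * \<beta> (a * c') ((x + y) * d)) =
      csum c (\<lambda>\<eta> c'. cnj (v \<eta> \<xi>) * \<beta> (a * c') (x * d)) +
      csum c (\<lambda>\<eta> c'. cnj (v \<eta> \<xi>) * \<beta> (a * c') (y * d))"
    unfolding csum_distrib(1)[symmetric]
    by (rule csum_cong)
      (use a xy homogeneous_U in \<open>auto simp: distrib_right bil[OF \<beta>] U_mult algebra_simps\<close>)
next
  fix k x assume x: "x \<in> U"
  show "csum c (\<lambda>\<eta> c'. cnj (v \<eta> \<xi>) * \<beta> (a * c') ((k *\<^sub>C x) * d)) =
      k * csum c (\<lambda>\<eta> c'. cnj (v \<eta> \<xi>) * \<beta> (a * c') (x * d))"
    unfolding csum_distrib(2)[symmetric]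
    by (rule csum_cong)
      (use a x homogeneous_U in \<open>auto simp: mult_scaleC_left bil[OF \<beta>] U_mult algebra_simps\<close>)
qed

lemma mult_form_linear:
  assumes \<beta>: "bilinear_form_on U \<beta>" and U: "a \<in> U" "b \<in> U" "c \<in> U" "d \<in> U" "x \<in> U"
  shows "mult_form v \<beta> (a + x) b c d = mult_form v \<beta> a b c d + mult_form v \<beta> x b c d"
    and "mult_form v \<beta> (k *\<^sub>C a) b c d = k * mult_form v \<beta> a b c d"
    and "mult_form v \<beta> a (b + x) c d = mult_form v \<beta> a b c d + mult_form v \<beta> a x c d"
    and "mult_form v \<beta> a (k *\<^sub>C b) c d = k * mult_form v \<beta> a b c d"
    and "mult_form v \<beta> a b (c + x) d = mult_form v \<beta> a b c d + mult_form v \<beta> a b x d"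
    and "mult_form v \<beta> a b (k *\<^sub>C c) d = k * mult_form v \<beta> a b c d"
    and "mult_form v \<beta> a b c (d + x) = mult_form v \<beta> a b c d + mult_form v \<beta> a b c x"
    and "mult_form v \<beta> a b c (k *\<^sub>C d) = k * mult_form v \<beta> a b c d"
proof -
  note hU = homogeneous_U
  show "mult_form v \<beta> (a + x) b c d = mult_form v \<beta> a b c d + mult_form v \<beta> x b c d"
    unfolding mult_form_def csum_distrib(1)[symmetric]
    by (intro csum_cong)
      (use U hU in \<open>auto simp: distrib_right bil[OF \<beta>] U_mult distrib_left\<close>)
  show "mult_form v \<beta> (k *\<^sub>C a) b c d = k * mult_form v \<beta> a b c d"
    unfolding mult_form_def csum_distrib(2)[symmetric]
    by (intro csum_cong)
      (use U hU in \<open>auto simp: mult_scaleC_left bil[OF \<beta>] U_mult\<close>)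
  show "mult_form v \<beta> a b c (d + x) = mult_form v \<beta> a b c d + mult_form v \<beta> a b c x"
    unfolding mult_form_def csum_distrib(1)[symmetric]
    by (intro csum_cong)
      (use U hU in \<open>auto simp: bil[OF \<beta>] U_mult distrib_left\<close>)
  show "mult_form v \<beta> a b c (k *\<^sub>C d) = k * mult_form v \<beta> a b c d"
    unfolding mult_form_def csum_distrib(2)[symmetric]
    by (intro csum_cong)
      (use U hU in \<open>auto simp: mult_scaleC_right bil[OF \<beta>] U_mult\<close>)
  show "mult_form v \<beta> a (b + x) c d = mult_form v \<beta> a b c d + mult_form v \<beta> a x c d"
    unfolding mult_form_def by (rule csum_add) (use U in \<open>auto intro: mult_form_outer[OF \<beta>]\<close>)
  show "mult_form v \<beta> a (k *\<^sub>C b) c d = k * mult_form v \<beta> a b c d"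
    unfolding mult_form_def by (rule csum_scale) (use U in \<open>auto intro: mult_form_outer[OF \<beta>]\<close>)
  show "mult_form v \<beta> a b (c + x) d = mult_form v \<beta> a b c d + mult_form v \<beta> a b x d"
    unfolding mult_form_def csum_distrib(1)[symmetric]
    by (intro csum_cong csum_add) (use U hU in \<open>auto intro: mult_form_inner[OF \<beta>]\<close>)
  show "mult_form v \<beta> a b (k *\<^sub>C c) d = k * mult_form v \<beta> a b c d"
    unfolding mult_form_def csum_distrib(2)[of b k, symmetric]
    by (intro csum_cong csum_scale) (use U hU in \<open>auto intro: mult_form_inner[OF \<beta>]\<close>)
qed

lemma mult_form_homogeneous:
  assumes \<beta>: "bilinear_form_on U \<beta>" and d: "\<xi> \<in> dual_group" "\<eta> \<in> dual_group"
    and h: "b \<in> homogeneous \<gamma> \<xi>" "c \<in> homogeneous \<gamma> \<eta>" and U: "a \<in> U" "d \<in> U"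
  shows "mult_form v \<beta> a b c d = cnj (v \<eta> \<xi>) * \<beta> (a * c) (b * d)"
proof -
  have "b \<in> U" "c \<in> U" using d h homogeneous_U by auto
  then have "mult_form v \<beta> a b c d = csum c (\<lambda>\<eta> c'. cnj (v \<eta> \<xi>) * \<beta> (a * c') (b * d))"
    unfolding mult_form_def
    by (intro csum_homogeneous) (use d h U in \<open>auto intro: mult_form_outer[OF \<beta>]\<close>)
  also have "\<dots> = cnj (v \<eta> \<xi>) * \<beta> (a * c) (b * d)"
    by (rule csum_homogeneous) (use \<open>b \<in> U\<close> d h U in \<open>auto intro: mult_form_inner[OF \<beta>]\<close>)
  finally show ?thesis .
qed

lemma mult_form_bilinear:
  assumes "bilinear_form_on U \<beta>" "a \<in> U" "b \<in> U"
  shows "bilinear_form_on U (mult_form v \<beta> a b)"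
  unfolding bilinear_form_on_def
  by (intro conjI ballI allI)
    (rule mult_form_linear(5-8)[OF assms] mult_form_linear(6,8)[OF assms _ _ assms(2)]; assumption)+

lemma mult_form_tensor_bilinear:
  assumes \<beta>: "bilinear_form_on U \<beta>" and y: "y \<in> alg_tensor \<gamma>"
  shows "bilinear_form_on U (\<lambda>a b. y (mult_form v \<beta> a b))"
proof -
  note y' = y[unfolded alg_tensor_def]
  have add: "y \<phi> = y \<psi> + y \<psi>'"
    if "bilinear_form_on U \<phi>" "bilinear_form_on U \<psi>" "bilinear_form_on U \<psi>'"
      "\<And>c d. c \<in> U \<Longrightarrow> d \<in> U \<Longrightarrow> \<phi> c d = \<psi> c d + \<psi>' c d" for \<phi> \<psi> \<psi>'
  proof -
    have "bilinear_form_on U (\<lambda>a b. \<psi> a b + \<psi>' a b)"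
      using that(2,3) by (auto simp: bilinear_form_on_def algebra_simps)
    then have "y \<phi> = y (\<lambda>a b. \<psi> a b + \<psi>' a b)"
      using that(4) by (intro tensor_cong[OF y' that(1)])
    then show ?thesis
      by (simp only: tensor_linear(1)[OF y' that(2,3)])
  qed
  have scale: "y \<phi> = k * y \<psi>"
    if "bilinear_form_on U \<phi>" "bilinear_form_on U \<psi>"
      "\<And>c d. c \<in> U \<Longrightarrow> d \<in> U \<Longrightarrow> \<phi> c d = k * \<psi> c d" for \<phi> \<psi> k
  proof -
    have "bilinear_form_on U (\<lambda>a b. k * \<psi> a b)"
      using that(2) by (auto simp: bilinear_form_on_def algebra_simps)
    then have "y \<phi> = y (\<lambda>a b. k * \<psi> a b)"
      using that(3) by (intro tensor_cong[OF y' that(1)])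
    then show ?thesis
      by (simp only: tensor_linear(2)[OF y' that(2,2)])
  qed
  note B = mult_form_bilinear[OF \<beta>] and L = mult_form_linear[OF \<beta>]
  show ?thesis
    unfolding bilinear_form_on_def
  proof (intro conjI ballI allI)
    fix a b c assume U: "a \<in> U" "b \<in> U" "c \<in> U"
    show "y (mult_form v \<beta> (a + b) c) = y (mult_form v \<beta> a c) + y (mult_form v \<beta> b c)"
      by (rule add) (use U in \<open>auto intro!: B U_add L(1)\<close>)
    show "y (mult_form v \<beta> a (b + c)) = y (mult_form v \<beta> a b) + y (mult_form v \<beta> a c)"
      by (rule add) (use U in \<open>auto intro!: B U_add L(3)\<close>)
  next
    fix k a b assume U: "a \<in> U" "b \<in> U"
    show "y (mult_form v \<beta> (k *\<^sub>C a) b) = k * y (mult_form v \<beta> a b)"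
      by (rule scale) (use U in \<open>auto intro!: B U_scale L(2)\<close>)
    show "y (mult_form v \<beta> a (k *\<^sub>C b)) = k * y (mult_form v \<beta> a b)"
      by (rule scale) (use U in \<open>auto intro!: B U_scale L(4)\<close>)
  qed
qed

lemma twisted_mult_exists: "\<exists>m. is_twisted_mult \<gamma> v m"
proof (rule exI)
  let ?T = "alg_tensor \<gamma>"
  define m :: "'a tensor \<Rightarrow> 'a tensor \<Rightarrow> 'a tensor" where
    "m x y = (\<lambda>\<beta>. if x \<in> ?T \<and> y \<in> ?T \<and> bilinear_form_on U \<beta>
      then x (\<lambda>a b. y (mult_form v \<beta> a b)) else 0)" for x y
  show "is_twisted_mult \<gamma> v m"
    unfolding is_twisted_mult_def
  proof (intro conjI allI ballI impI)
    fix x y assume "x \<notin> ?T \<or> y \<notin> ?T"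
    then show "m x y = 0" by (auto simp: m_def fun_eq_iff zero_fun_apply)
  next
    fix x y z assume T: "x \<in> ?T" "y \<in> ?T" "z \<in> ?T"
    then show "m (x + y) z = m x z + m y z"
      by (auto simp: m_def fun_eq_iff plus_fun_apply alg_tensor_closed)
    show "m x (y + z) = m x y + m x z"
      using T tensor_linear(1)[OF T(1)[unfolded alg_tensor_def]
        mult_form_tensor_bilinear[OF _ T(2)] mult_form_tensor_bilinear[OF _ T(3)]]
      by (auto simp: m_def fun_eq_iff plus_fun_apply alg_tensor_closed)
  next
    fix k x y assume T: "x \<in> ?T" "y \<in> ?T"
    then show "m (scale_tensor k x) y = scale_tensor k (m x y)"
      using alg_tensor_closed(2)[OF T(1), of k]
      by (auto simp: m_def fun_eq_iff scale_tensor_def)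
    show "m x (scale_tensor k y) = scale_tensor k (m x y)"
      using T alg_tensor_closed(2)[OF T(2), of k] tensor_linear(2)[OF T(1)[unfolded alg_tensor_def]
        mult_form_tensor_bilinear[OF _ T(2)] mult_form_tensor_bilinear[OF _ T(2)]]
      by (auto simp: m_def fun_eq_iff scale_tensor_def)
  next
    fix \<xi>\<^sub>1 \<xi>\<^sub>2 \<xi>\<^sub>3 \<xi>\<^sub>4 a b c d
    assume d: "\<xi>\<^sub>1 \<in> dual_group" "\<xi>\<^sub>2 \<in> dual_group" "\<xi>\<^sub>3 \<in> dual_group" "\<xi>\<^sub>4 \<in> dual_group"
      and h: "a \<in> homogeneous \<gamma> \<xi>\<^sub>1" "b \<in> homogeneous \<gamma> \<xi>\<^sub>2" "c \<in> homogeneous \<gamma> \<xi>\<^sub>3" "d \<in> homogeneous \<gamma> \<xi>\<^sub>4"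
    have U: "a \<in> U" "b \<in> U" "c \<in> U" "d \<in> U"
      using d h homogeneous_U by auto
    have T: "tens \<gamma> a b \<in> ?T" "tens \<gamma> c d \<in> ?T"
      using U alg_tensor_closed by auto
    show "m (tens \<gamma> a b) (tens \<gamma> c d) = scale_tensor (cnj (v \<xi>\<^sub>3 \<xi>\<^sub>2)) (tens \<gamma> (a * c) (b * d))"
    proof
      fix \<beta>
      show "m (tens \<gamma> a b) (tens \<gamma> c d) \<beta> = scale_tensor (cnj (v \<xi>\<^sub>3 \<xi>\<^sub>2)) (tens \<gamma> (a * c) (b * d)) \<beta>"
      proof (cases "bilinear_form_on U \<beta>")
        case True
        have "m (tens \<gamma> a b) (tens \<gamma> c d) \<beta> = tens \<gamma> a b (\<lambda>a b. tens \<gamma> c d (mult_form v \<beta> a b))"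
          using True T by (simp add: m_def)
        also have "\<dots> = mult_form v \<beta> a b c d"
          using mult_form_tensor_bilinear[OF True T(2)] mult_form_bilinear[OF True U(1,2)]
          by (simp add: tens_def elem_tensor_def)
        also have "\<dots> = cnj (v \<xi>\<^sub>3 \<xi>\<^sub>2) * \<beta> (a * c) (b * d)"
          by (rule mult_form_homogeneous) (use True d h U in auto)
        finally show ?thesis
          using True by (simp add: scale_tensor_def tens_def elem_tensor_def)
      qed (simp add: m_def scale_tensor_def tens_def elem_tensor_def)
    qed
  qed
qed

lemma twisted_mult_unique:
  assumes m: "is_twisted_mult \<gamma> v m" and m': "is_twisted_mult \<gamma> v m'"
  shows "m = m'"
proof (rule ext, rule ext)
  fix x y
  have null: "f 0 z = 0 \<and> f z 0 = 0" if "is_twisted_mult \<gamma> v f" "z \<in> alg_tensor \<gamma>" for f z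
  proof -
    have "f (scale_tensor 0 0) z = scale_tensor 0 (f 0 z)" "f z (scale_tensor 0 0) = scale_tensor 0 (f z 0)"
      using that alg_tensor_closed(3) unfolding is_twisted_mult_def by blast+
    then show ?thesis by simp
  qed
  have plus: "f (x + y) z = f x z + f y z" "f x (y + z) = f x y + f x z"
    if "is_twisted_mult \<gamma> v f" "x \<in> alg_tensor \<gamma>" "y \<in> alg_tensor \<gamma>" "z \<in> alg_tensor \<gamma>" for f x y z
    using that unfolding is_twisted_mult_def by blast+
  have el: "m (tens \<gamma> a b) (tens \<gamma> c d) = m' (tens \<gamma> a b) (tens \<gamma> c d)"
    if "\<xi>\<^sub>1 \<in> dual_group" "\<xi>\<^sub>2 \<in> dual_group" "\<xi>\<^sub>3 \<in> dual_group" "\<xi>\<^sub>4 \<in> dual_group"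
      "a \<in> homogeneous \<gamma> \<xi>\<^sub>1" "b \<in> homogeneous \<gamma> \<xi>\<^sub>2" "c \<in> homogeneous \<gamma> \<xi>\<^sub>3" "d \<in> homogeneous \<gamma> \<xi>\<^sub>4"
    for \<xi>\<^sub>1 \<xi>\<^sub>2 \<xi>\<^sub>3 \<xi>\<^sub>4 a b c d
  proof -
    have "f (tens \<gamma> a b) (tens \<gamma> c d) = scale_tensor (cnj (v \<xi>\<^sub>3 \<xi>\<^sub>2)) (tens \<gamma> (a * c) (b * d))"
      if "is_twisted_mult \<gamma> v f" for f
      using that \<open>\<xi>\<^sub>1 \<in> _\<close> \<open>\<xi>\<^sub>2 \<in> _\<close> \<open>\<xi>\<^sub>3 \<in> _\<close> \<open>\<xi>\<^sub>4 \<in> _\<close> \<open>a \<in> _\<close> \<open>b \<in> _\<close> \<open>c \<in> _\<close> \<open>d \<in> _\<close>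
      unfolding is_twisted_mult_def by blast
    then show ?thesis using m m' by metis
  qed
  have hom: "tens \<gamma> a b \<in> alg_tensor \<gamma>"
    if "\<xi> \<in> dual_group" "\<eta> \<in> dual_group" "a \<in> homogeneous \<gamma> \<xi>" "b \<in> homogeneous \<gamma> \<eta>" for a b \<xi> \<eta>
    using that homogeneous_U alg_tensor_closed(4) by blast
  show "m x y = m' x y"
  proof (cases "x \<in> alg_tensor \<gamma> \<and> y \<in> alg_tensor \<gamma>")
    case True
    have "m x (tens \<gamma> c d) = m' x (tens \<gamma> c d)"
      if "\<xi>\<^sub>3 \<in> dual_group" "\<xi>\<^sub>4 \<in> dual_group" "c \<in> homogeneous \<gamma> \<xi>\<^sub>3" "d \<in> homogeneous \<gamma> \<xi>\<^sub>4" for c d \<xi>\<^sub>3 \<xi>\<^sub>4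
      using True[THEN conjunct1]
    proof (induction rule: alg_tensor_induct)
      case zero
      then show ?case using null[OF m hom[OF that]] null[OF m' hom[OF that]] by simp
    next
      case (add x a b \<xi> \<eta>)
      then show ?case
        using plus(1)[OF _ add.hyps(1) hom[OF add.hyps(2-5)] hom[OF that]]
          el[OF add.hyps(2,3) that(1,2) add.hyps(4,5) that(3,4)] m m' by simp
    qed
    note left = this
    show ?thesis using True[THEN conjunct2]
    proof (induction rule: alg_tensor_induct)
      case zero
      then show ?case using null[OF m] null[OF m'] True by simp
    next
      case (add y c d \<xi> \<eta>)
      then show ?case
        using plus(2)[OF _ True[THEN conjunct1] add.hyps(1) hom[OF add.hyps(2-5)]]
          left[OF add.hyps(2-5)] m m' by simp
    qed
  next
    case False
    then show ?thesis using m m' unfolding is_twisted_mult_def by metis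
  qed
qed

lemma star_form_inner:
  assumes "bilinear_form_on U \<beta>" "a \<in> U"
  shows "linear_on U (\<lambda>b. cnj (k * \<beta> (star a) (star b)))"
  using assms unfolding linear_on_def
  by (simp add: star_add star_scaleC bil U_star algebra_simps)

lemma star_form_outer:
  assumes \<beta>: "bilinear_form_on U \<beta>" and b: "b \<in> U"
  shows "linear_on U (\<lambda>a. csum b (\<lambda>\<eta> b'. cnj (cnj (v \<xi> \<eta>) * \<beta> (star a) (star b'))))"
  unfolding linear_on_def
proof (intro conjI ballI allI)
  fix x y assume xy: "x \<in> U" "y \<in> U"
  show "csum b (\<lambda>\<eta> b'. cnj (cnj (v \<xi> \<eta>) * \<beta> (star (x + y)) (star b'))) =
      csum b (\<lambda>\<eta> b'. cnj (cnj (v \<xi> \<eta>) * \<beta> (star x) (star b'))) +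
      csum b (\<lambda>\<eta> b'. cnj (cnj (v \<xi> \<eta>) * \<beta> (star y) (star b')))"
    unfolding csum_distrib(1)[symmetric]
    by (rule csum_cong)
      (use b xy homogeneous_U in \<open>auto simp: star_add bil[OF \<beta>] U_star algebra_simps\<close>)
next
  fix k x assume x: "x \<in> U"
  show "csum b (\<lambda>\<eta> b'. cnj (cnj (v \<xi> \<eta>) * \<beta> (star (k *\<^sub>C x)) (star b'))) =
      k * csum b (\<lambda>\<eta> b'. cnj (cnj (v \<xi> \<eta>) * \<beta> (star x) (star b')))"
    unfolding csum_distrib(2)[symmetric]
    by (rule csum_cong)
      (use b x homogeneous_U in \<open>auto simp: star_scaleC bil[OF \<beta>] U_star algebra_simps\<close>)
qed

lemma star_form_bilinear:
  assumes \<beta>: "bilinear_form_on U \<beta>"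
  shows "bilinear_form_on U (star_form v \<beta>)"
  unfolding bilinear_form_on_def
proof (intro conjI ballI allI)
  fix a b c assume U: "a \<in> U" "b \<in> U" "c \<in> U"
  show "star_form v \<beta> (a + b) c = star_form v \<beta> a c + star_form v \<beta> b c"
    unfolding star_form_def by (rule csum_add) (use U in \<open>auto intro: star_form_outer[OF \<beta>] simp del: complex_cnj_mult complex_cnj_cnj\<close>)
  show "star_form v \<beta> a (b + c) = star_form v \<beta> a b + star_form v \<beta> a c"
    unfolding star_form_def csum_distrib(1)[of a, symmetric]
    by (intro csum_cong csum_add) (use U homogeneous_U in \<open>auto intro: star_form_inner[OF \<beta>] simp del: complex_cnj_mult complex_cnj_cnj\<close>)
next
  fix k a b assume U: "a \<in> U" "b \<in> U"
  show "star_form v \<beta> (k *\<^sub>C a) b = k * star_form v \<beta> a b"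
    unfolding star_form_def by (rule csum_scale) (use U in \<open>auto intro: star_form_outer[OF \<beta>] simp del: complex_cnj_mult complex_cnj_cnj\<close>)
  show "star_form v \<beta> a (k *\<^sub>C b) = k * star_form v \<beta> a b"
    unfolding star_form_def csum_distrib(2)[of a k, symmetric]
    by (intro csum_cong csum_scale) (use U homogeneous_U in \<open>auto intro: star_form_inner[OF \<beta>] simp del: complex_cnj_mult complex_cnj_cnj\<close>)
qed

lemma star_form_homogeneous:
  assumes \<beta>: "bilinear_form_on U \<beta>" and d: "\<xi> \<in> dual_group" "\<eta> \<in> dual_group"
    and h: "a \<in> homogeneous \<gamma> \<xi>" "b \<in> homogeneous \<gamma> \<eta>"
  shows "star_form v \<beta> a b = cnj (cnj (v \<xi> \<eta>) * \<beta> (star a) (star b))"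
proof -
  have U: "a \<in> U" "b \<in> U" using d h homogeneous_U by auto
  then have "star_form v \<beta> a b = csum b (\<lambda>\<eta> b'. cnj (cnj (v \<xi> \<eta>) * \<beta> (star a) (star b')))"
    unfolding star_form_def
    by (intro csum_homogeneous) (use d h in \<open>auto intro: star_form_outer[OF \<beta>] simp del: complex_cnj_mult complex_cnj_cnj\<close>)
  also have "\<dots> = cnj (cnj (v \<xi> \<eta>) * \<beta> (star a) (star b))"
    by (rule csum_homogeneous) (use U d h in \<open>auto intro: star_form_inner[OF \<beta>] simp del: complex_cnj_mult complex_cnj_cnj\<close>)
  finally show ?thesis .
qed

lemma twisted_star_exists: "\<exists>s. is_twisted_star \<gamma> v s"
proof (rule exI)
  let ?T = "alg_tensor \<gamma>"
  define s :: "'a tensor \<Rightarrow> 'a tensor" where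
    "s x = (\<lambda>\<beta>. if x \<in> ?T \<and> bilinear_form_on U \<beta> then cnj (x (star_form v \<beta>)) else 0)" for x
  show "is_twisted_star \<gamma> v s"
    unfolding is_twisted_star_def
  proof (intro conjI allI ballI impI)
    fix x assume "x \<notin> ?T"
    then show "s x = 0" by (auto simp: s_def fun_eq_iff zero_fun_apply)
  next
    fix x y assume T: "x \<in> ?T" "y \<in> ?T"
    then show "s (x + y) = s x + s y"
      by (auto simp: s_def fun_eq_iff plus_fun_apply alg_tensor_closed)
  next
    fix k x assume T: "x \<in> ?T"
    then show "s (scale_tensor k x) = scale_tensor (cnj k) (s x)"
      using alg_tensor_closed(2)[OF T, of k] by (auto simp: s_def fun_eq_iff scale_tensor_def)
  next
    fix \<xi>\<^sub>1 \<xi>\<^sub>2 a b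
    assume d: "\<xi>\<^sub>1 \<in> dual_group" "\<xi>\<^sub>2 \<in> dual_group"
      and h: "a \<in> homogeneous \<gamma> \<xi>\<^sub>1" "b \<in> homogeneous \<gamma> \<xi>\<^sub>2"
    have T: "tens \<gamma> a b \<in> ?T"
      using d h homogeneous_U alg_tensor_closed by blast
    show "s (tens \<gamma> a b) = scale_tensor (cnj (v \<xi>\<^sub>1 \<xi>\<^sub>2)) (tens \<gamma> (star a) (star b))"
    proof
      fix \<beta>
      show "s (tens \<gamma> a b) \<beta> = scale_tensor (cnj (v \<xi>\<^sub>1 \<xi>\<^sub>2)) (tens \<gamma> (star a) (star b)) \<beta>"
        using T star_form_bilinear[of \<beta> v] star_form_homogeneous[OF _ d h, of \<beta> v]
        by (simp add: s_def scale_tensor_def tens_def elem_tensor_def)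
    qed
  qed
qed

lemma twisted_star_unique:
  assumes s: "is_twisted_star \<gamma> v s" and s': "is_twisted_star \<gamma> v s'"
  shows "s = s'"
proof
  fix x
  have null: "f 0 = 0" if "is_twisted_star \<gamma> v f" for f
  proof -
    have "f (scale_tensor 0 0) = scale_tensor (cnj 0) (f 0)"
      using that alg_tensor_closed(3) unfolding is_twisted_star_def by blast
    then show ?thesis by simp
  qed
  have plus: "f (x + y) = f x + f y"
    if "is_twisted_star \<gamma> v f" "x \<in> alg_tensor \<gamma>" "y \<in> alg_tensor \<gamma>" for f x y
    using that unfolding is_twisted_star_def by blast
  have el: "f (tens \<gamma> a b) = scale_tensor (cnj (v \<xi> \<eta>)) (tens \<gamma> (star a) (star b))"
    if "is_twisted_star \<gamma> v f" "\<xi> \<in> dual_group" "\<eta> \<in> dual_group"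
      "a \<in> homogeneous \<gamma> \<xi>" "b \<in> homogeneous \<gamma> \<eta>" for f a b \<xi> \<eta>
    using that unfolding is_twisted_star_def by blast
  show "s x = s' x"
  proof (cases "x \<in> alg_tensor \<gamma>")
    case True
    then show ?thesis
    proof (induction rule: alg_tensor_induct)
      case zero
      then show ?case using null[OF s] null[OF s'] by simp
    next
      case (add x a b \<xi> \<eta>)
      have "tens \<gamma> a b \<in> alg_tensor \<gamma>"
        using add.hyps homogeneous_U alg_tensor_closed(4) by blast
      then show ?case
        using add.IH plus[OF s add.hyps(1)] plus[OF s' add.hyps(1)]
          el[OF s add.hyps(2-5)] el[OF s' add.hyps(2-5)] by simp
    qed
  next
    case False
    then show ?thesis using s s' unfolding is_twisted_star_def by metis
  qed
qed

theorem twisted_mult_well_defined: "is_twisted_mult \<gamma> v (twisted_mult \<gamma> v)"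
  unfolding twisted_mult_def
  using twisted_mult_exists twisted_mult_unique by (metis theI)

theorem twisted_star_well_defined: "is_twisted_star \<gamma> v (twisted_star \<gamma> v)"
  unfolding twisted_star_def
  using twisted_star_exists twisted_star_unique by (metis theI)

end

declare plus_fun_apply [simp] zero_fun_apply [simp]

end

theory Submission
  imports Defs
begin

text \<open>
  If \<open>\<omega> \<times> \<omega>\<close> exists, then comparing its values at \<open>a \<otimes> b\<close> and at \<open>(a \<otimes> b)\<^sup>*\<close>, for homogeneous \<open>a\<close> and
  \<open>b\<close> on which \<open>\<omega>\<close> does not vanish, gives \<open>v (\<partial>a) (\<partial>b) = 1\<close>.

  Conversely, for \<open>z = \<Sum>\<^sub>i a\<^sub>i \<otimes> b\<^sub>i\<close> with homogeneous entries of degrees \<open>\<alpha>\<^sub>i\<close> and \<open>\<beta>\<^sub>i\<close>, the value of the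
  product functional at \<open>z\<^sup>* z\<close> is the sum over \<open>i\<close> and \<open>j\<close> of
  \<open>v (\<alpha>\<^sub>j - \<alpha>\<^sub>i) \<beta>\<^sub>i \<omega>(a\<^sub>i\<^sup>* a\<^sub>j) \<omega>(b\<^sub>i\<^sup>* b\<^sub>j)\<close>. If \<open>v\<close> is trivial on the support of \<open>\<omega>\<close>, then on the nonzero
  terms the coefficient has the form \<open>cnj u\<^sub>i * u\<^sub>j\<close>, and Schur's product theorem yields positivity. The
  GNS representation of the product functional is bounded because \<open>a\<^sup>* a\<close> is neutral for homogeneous
  \<open>a\<close>; its operator seminorm is dominated by the maximal C*-norm, so the functional is contractive
  and extends to a state.
\<close>

section \<open>Elementary facts on C*-algebras\<close>

lemma scaleC_minus1: "(-1) *\<^sub>C x = - (x::'a::unital_cstar_algebra)"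
  using scaleC_of_real[of "-1" x] by simp

lemma star_minus: "star (- x) = - star (x::'a::unital_cstar_algebra)"
  using star_scaleC[of "-1" x] by (simp add: scaleC_minus1)

lemma star_diff: "star (x - y) = star x - star (y::'a::unital_cstar_algebra)"
  using star_add[of x "- y"] by (simp add: star_minus)

lemma star_one [simp]: "star 1 = (1::'a::unital_cstar_algebra)"
  by (metis mult.right_neutral star_mult star_star)

lemma star_scaleR: "star (r *\<^sub>R x) = r *\<^sub>R star (x::'a::unital_cstar_algebra)"
  using star_scaleC[of "complex_of_real r" x] by (simp add: scaleC_of_real)

lemma star_sum: "star (\<Sum>i\<in>I. f i) = (\<Sum>i\<in>I. star (f i :: 'a::unital_cstar_algebra))"
  by (induction I rule: infinite_finite_induct) (auto simp: star_add)

lemma star_power: "star (x ^ n) = star (x::'a::unital_cstar_algebra) ^ n"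
  by (induction n) (auto simp: star_mult power_commutes)

lemma norm_star: "norm (star x) = norm (x::'a::unital_cstar_algebra)"
proof -
  have le: "norm y \<le> norm (star y)" for y :: 'a
  proof -
    have "norm y * norm y \<le> norm (star y) * norm y"
      using cstar_identity[of y] norm_mult_ineq[of "star y" y] by (simp add: power2_eq_square)
    then show ?thesis
      by (cases "y = 0") auto
  qed
  show ?thesis using le[of x] le[of "star x"] by (simp add: star_star)
qed

lemma tendsto_star:
  "(f \<longlongrightarrow> (x::'a::unital_cstar_algebra)) F \<Longrightarrow> ((\<lambda>n. star (f n)) \<longlongrightarrow> star x) F"
  unfolding tendsto_iff dist_norm by (simp add: star_diff[symmetric] norm_star)

lemma tendsto_scaleC:
  "(f \<longlongrightarrow> (x::'a::unital_cstar_algebra)) F \<Longrightarrow> ((\<lambda>n. c *\<^sub>C f n) \<longlongrightarrow> c *\<^sub>C x) F"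
proof -
  have "bounded_linear (\<lambda>x::'a. c *\<^sub>C x)"
    by (rule bounded_linear_intro[where K = "cmod c"])
      (auto simp: scaleC_add_right norm_scaleC scaleC_of_real[symmetric] scaleC_commute)
  then show "(f \<longlongrightarrow> x) F \<Longrightarrow> ((\<lambda>n. c *\<^sub>C f n) \<longlongrightarrow> c *\<^sub>C x) F"
    by (rule bounded_linear.tendsto)
qed

lemma unital_star_hom_simps:
  assumes "unital_star_hom j"
  shows "j (x + y) = j x + j y" "j (c *\<^sub>C x) = c *\<^sub>C j x" "j (x * y) = j x * j y"
    "j (star x) = star (j x)" "j 1 = 1" "j (x - y) = j x - j y" "j (r *\<^sub>R x) = r *\<^sub>R j x"
proof -
  show *: "j (x + y) = j x + j y" "j (c *\<^sub>C x) = c *\<^sub>C j x" "j (x * y) = j x * j y"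
    "j (star x) = star (j x)" "j 1 = 1" for x y c
    using assms by (auto simp: unital_star_hom_def)
  show "j (x - y) = j x - j y"
    using *(1)[of "x - y" y] by simp
  show "j (r *\<^sub>R x) = r *\<^sub>R j x"
    using *(2)[of "complex_of_real r"] by (simp add: scaleC_of_real)
qed

text \<open>Square roots of \<^term>\<open>1 - h\<close> come from the binomial series at exponent \<open>1/2\<close>; its partial
  sums matter because they stay in any subalgebra containing \<^term>\<open>h\<close>, closed or not.\<close>

definition sqrt_partial :: "'a::unital_cstar_algebra \<Rightarrow> nat \<Rightarrow> 'a"
  where "sqrt_partial h n = (\<Sum>k<n. ((-1) ^ k * ((1/2) gchoose k)) *\<^sub>R h ^ k)"

lemma sqrt_partial_tendsto:
  assumes "norm (h::'a::unital_cstar_algebra) < 1"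
  obtains s where "sqrt_partial h \<longlonglongrightarrow> s" "s * s = 1 - h"
proof -
  define c :: "nat \<Rightarrow> real" where "c k = (-1) ^ k * ((1/2) gchoose k)" for k
  define t where "t k = c k *\<^sub>R h ^ k" for k
  have "summable (\<lambda>k. norm (((1/2::real) gchoose k) * norm h ^ k))"
    by (rule abs_summable_in_conv_radius)
      (use assms in \<open>auto simp: conv_radius_gchoose one_ereal_def\<close>)
  then have summ: "summable (\<lambda>k. norm (t k))"
  proof (rule summable_comparison_test'[where N = 0])
    show "norm (norm (t k)) \<le> norm (((1/2::real) gchoose k) * norm h ^ k)" for k
      using mult_left_mono[OF norm_power_ineq[of h k], of "\<bar>(1/2::real) gchoose k\<bar>"]
      by (simp add: t_def c_def abs_mult)
  qed
  \<comment> \<open>Vandermonde's convolution adds the exponents 1/2 + 1/2, so the square is the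
    binomial series at exponent 1, which stops after \<open>k = 1\<close>.\<close>
  have coeff: "(\<Sum>i\<le>k. t i * t (k - i)) = ((-1) ^ k * ((1::real) gchoose k)) *\<^sub>R h ^ k" for k
  proof -
    have "(\<Sum>i\<le>k. t i * t (k - i)) = (\<Sum>i\<le>k. ((-1) ^ k * (((1/2) gchoose i) * ((1/2) gchoose (k - i)))) *\<^sub>R h ^ k)"
    proof (rule sum.cong)
      fix i assume "i \<in> {..k}"
      then have "h ^ i * h ^ (k - i) = h ^ k" "(-1::real) ^ i * (-1) ^ (k - i) = (-1) ^ k"
        by (simp_all flip: power_add)
      then show "t i * t (k - i) = ((-1) ^ k * (((1/2) gchoose i) * ((1/2) gchoose (k - i)))) *\<^sub>R h ^ k"
        by (simp add: t_def c_def) (metis mult.assoc mult.commute)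
    qed simp
    also have "\<dots> = ((-1) ^ k * (\<Sum>i=0..k. ((1/2) gchoose i) * ((1/2) gchoose (k - i)))) *\<^sub>R h ^ k"
      by (simp add: scaleR_sum_left sum_distrib_left atMost_atLeast0)
    finally show ?thesis
      by (simp add: gbinomial_Vandermonde)
  qed
  have "(\<lambda>k. \<Sum>i\<le>k. t i * t (k - i)) sums (suminf t * suminf t)"
    by (rule Cauchy_product_sums[OF summ summ])
  moreover have "(\<lambda>k. \<Sum>i\<le>k. t i * t (k - i)) sums (\<Sum>k<2. ((-1) ^ k * ((1::real) gchoose k)) *\<^sub>R h ^ k)"
    unfolding coeff
  proof (rule sums_finite)
    fix k :: nat assume "k \<notin> {..<2}"
    then have "(1::real) gchoose k = 0"
      using binomial_gbinomial[of 1 k, where ?'a = real] by (simp add: binomial_eq_0)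
    then show "((-1) ^ k * ((1::real) gchoose k)) *\<^sub>R h ^ k = 0" by simp
  qed simp
  ultimately have "suminf t * suminf t = 1 - h"
    by (auto dest: sums_unique2 simp: numeral_2_eq_2)
  moreover have "sqrt_partial h \<longlonglongrightarrow> suminf t"
    using summable_LIMSEQ[OF summable_norm_cancel[OF summ]]
    by (simp add: sqrt_partial_def[abs_def] t_def[abs_def] c_def)
  ultimately show ?thesis using that by blast
qed

lemma star_sqrt_partial: "star h = h \<Longrightarrow> star (sqrt_partial h n) = sqrt_partial h n"
  by (simp add: sqrt_partial_def star_sum star_scaleR star_power)

section \<open>Positive functionals on *-subalgebras\<close>

text \<open>Covers both a state on a whole algebra (\<open>B = UNIV\<close>) and the product
  functional on the dense algebraic part of the twisted tensor product, whose boundedness has to be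
  proved.\<close>

locale positive_functional =
  fixes B :: "'b::unital_cstar_algebra set" and f :: "'b \<Rightarrow> complex"
  assumes B_one: "1 \<in> B"
    and B_add: "x \<in> B \<Longrightarrow> y \<in> B \<Longrightarrow> x + y \<in> B"
    and B_scaleC: "x \<in> B \<Longrightarrow> c *\<^sub>C x \<in> B"
    and B_mult: "x \<in> B \<Longrightarrow> y \<in> B \<Longrightarrow> x * y \<in> B"
    and B_star: "x \<in> B \<Longrightarrow> star x \<in> B"
    and f_add: "x \<in> B \<Longrightarrow> y \<in> B \<Longrightarrow> f (x + y) = f x + f y"
    and f_scaleC: "x \<in> B \<Longrightarrow> f (c *\<^sub>C x) = c * f x"
    and f_pos: "x \<in> B \<Longrightarrow> f (star x * x) \<in> \<real>\<^sub>\<ge>\<^sub>0"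
    and f_one: "f 1 = 1"
begin

text \<open>The squared length of the class of \<open>x\<close> in the GNS space of
  \<open>f\<close>; on \<open>B\<close> the value of \<open>f\<close> is already real.\<close>

definition sqn :: "'b \<Rightarrow> real" where "sqn x = Re (f (star x * x))"

definition seminorm :: "'b \<Rightarrow> real" where "seminorm x = sqrt (sqn x)"

lemma B_zero: "0 \<in> B"
  using B_scaleC[OF B_one, of 0] by simp

lemma B_minus: "x \<in> B \<Longrightarrow> - x \<in> B"
  using B_scaleC[of x "-1"] by (simp add: scaleC_minus1)

lemma B_diff: "x \<in> B \<Longrightarrow> y \<in> B \<Longrightarrow> x - y \<in> B"
  using B_add[of x "- y"] B_minus by simp

lemma f_zero: "f 0 = 0"
  using f_scaleC[OF B_one, of 0] by simp

lemma f_diff: "x \<in> B \<Longrightarrow> y \<in> B \<Longrightarrow> f (x - y) = f x - f y"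
  using f_add[of "x - y" y] B_diff by simp

lemma f_star_self: "x \<in> B \<Longrightarrow> f (star x * x) = complex_of_real (sqn x)"
  using f_pos[of x] by (auto simp: sqn_def complex_nonneg_Reals_iff complex_eq_iff)

lemma sqn_nonneg: "x \<in> B \<Longrightarrow> 0 \<le> sqn x"
  using f_pos[of x] by (auto simp: sqn_def complex_nonneg_Reals_iff)

lemma f_expand:
  assumes "x \<in> B" "y \<in> B"
  shows "f (star (x + t *\<^sub>C y) * (x + t *\<^sub>C y)) =
    f (star x * x) + t * f (star x * y) + cnj t * f (star y * x) + (cnj t * t) * f (star y * y)"
  using assms
  by (simp add: star_add star_scaleC distrib_left distrib_right f_add f_scaleC B_add B_mult
      B_star B_scaleC mult_scaleC_left mult_scaleC_right scaleC_scaleC algebra_simps)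

text \<open>The value in \<open>f_expand\<close> is real for every \<open>t\<close>;
  \<open>t = 1\<close> compares the imaginary parts of the two mixed terms and
  \<open>t = \<i>\<close> their real parts.\<close>

lemma f_hermitian:
  assumes xy: "x \<in> B" "y \<in> B"
  shows "f (star y * x) = cnj (f (star x * y))"
proof -
  have im: "Im (t * f (star x * y) + cnj t * f (star y * x)) = 0" for t
  proof -
    have "Im (f (star (x + t *\<^sub>C y) * (x + t *\<^sub>C y))) = 0"
      using f_star_self[of "x + t *\<^sub>C y"] xy by (simp add: B_add B_scaleC)
    then show ?thesis
      unfolding f_expand[OF xy] f_star_self[OF xy(1)] f_star_self[OF xy(2)]
      by (simp add: algebra_simps)
  qed
  show ?thesis using im[of 1] im[of \<i>] by (simp add: complex_eq_iff)
qed

lemma f_star: "x \<in> B \<Longrightarrow> f (star x) = cnj (f x)"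
  using f_hermitian[of 1 x] B_one by simp

lemma Cauchy_Schwarz:
  assumes xy: "x \<in> B" "y \<in> B"
  shows "(cmod (f (star x * y)))\<^sup>2 \<le> sqn x * sqn y"
proof -
  let ?w = "f (star x * y)"
  have ineq: "0 \<le> sqn x - 2 * s * (cmod ?w)\<^sup>2 + s\<^sup>2 * (cmod ?w)\<^sup>2 * sqn y" for s :: real
  proof -
    \<comment> \<open>This coefficient makes both mixed terms real and equal, leaving a real
      quadratic polynomial in \<open>s\<close>.\<close>
    let ?t = "- complex_of_real s * cnj ?w"
    have "f (star (x + ?t *\<^sub>C y) * (x + ?t *\<^sub>C y)) =
        complex_of_real (sqn x) + ?t * ?w + cnj ?t * cnj ?w + (cnj ?t * ?t) * complex_of_real (sqn y)"
      unfolding f_expand[OF xy] f_star_self[OF xy(1)] f_star_self[OF xy(2)]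
      by (simp only: f_hermitian[OF xy])
    also have "\<dots> = complex_of_real (sqn x) - 2 * complex_of_real s * (?w * cnj ?w)
        + (complex_of_real s)\<^sup>2 * (?w * cnj ?w) * complex_of_real (sqn y)"
      by (simp add: algebra_simps power2_eq_square)
    also have "\<dots> = complex_of_real (sqn x - 2 * s * (cmod ?w)\<^sup>2 + s\<^sup>2 * (cmod ?w)\<^sup>2 * sqn y)"
      by (simp only: complex_norm_square[symmetric]) simp
    finally show ?thesis
      using sqn_nonneg[of "x + ?t *\<^sub>C y"] xy by (simp add: sqn_def B_add B_scaleC)
  qed
  show ?thesis
  proof (cases "sqn y = 0")
    case True
    \<comment> \<open>The polynomial is affine in \<open>s\<close> here, and a nonzero slope would
      make it negative at this \<open>s\<close>.\<close>
    have "2 * (sqn x + 1) \<le> sqn x" if "cmod ?w \<noteq> 0"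
      using ineq[of "(sqn x + 1) / (cmod ?w)\<^sup>2"] that True by simp
    then have "cmod ?w = 0" using sqn_nonneg[OF xy(1)] by fastforce
    then show ?thesis using True by simp
  next
    case False
    then have "0 < sqn y" using sqn_nonneg[OF xy(2)] by simp
    then show ?thesis
      using ineq[of "1 / sqn y"] by (simp add: field_simps power2_eq_square)
  qed
qed

lemma seminorm_nonneg: "x \<in> B \<Longrightarrow> 0 \<le> seminorm x"
  by (simp add: seminorm_def sqn_nonneg)

lemma seminorm_sq: "x \<in> B \<Longrightarrow> (seminorm x)\<^sup>2 = sqn x"
  by (simp add: seminorm_def sqn_nonneg)

lemma f_le_seminorm:
  assumes "x \<in> B" "y \<in> B"
  shows "cmod (f (star x * y)) \<le> seminorm x * seminorm y"
proof (rule power2_le_imp_le)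
  show "(cmod (f (star x * y)))\<^sup>2 \<le> (seminorm x * seminorm y)\<^sup>2"
    unfolding power_mult_distrib seminorm_sq[OF assms(1)] seminorm_sq[OF assms(2)]
    by (rule Cauchy_Schwarz[OF assms])
  show "0 \<le> seminorm x * seminorm y"
    using assms by (simp add: seminorm_nonneg)
qed

lemma seminorm_one: "seminorm 1 = 1"
  by (simp add: seminorm_def sqn_def f_one)

lemma seminorm_scaleC: "x \<in> B \<Longrightarrow> seminorm (c *\<^sub>C x) = cmod c * seminorm x"
proof -
  assume x: "x \<in> B"
  have "f (star (c *\<^sub>C x) * (c *\<^sub>C x)) = (cnj c * c) * f (star x * x)"
    using x by (simp add: star_scaleC mult_scaleC_left mult_scaleC_right scaleC_scaleC f_scaleC
        B_mult B_star)
  also have "cnj c * c = complex_of_real ((cmod c)\<^sup>2)"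
    by (metis complex_norm_square mult.commute)
  finally have "sqn (c *\<^sub>C x) = (cmod c)\<^sup>2 * sqn x"
    by (simp add: sqn_def)
  then show ?thesis by (simp add: seminorm_def real_sqrt_mult)
qed

lemma seminorm_triangle:
  assumes xy: "x \<in> B" "y \<in> B"
  shows "seminorm (x + y) \<le> seminorm x + seminorm y"
proof (rule power2_le_imp_le)
  have "sqn (x + y) = sqn x + sqn y + 2 * Re (f (star x * y))"
    using f_expand[OF xy, of 1] f_hermitian[OF xy] by (simp add: sqn_def)
  also have "\<dots> \<le> sqn x + sqn y + 2 * (seminorm x * seminorm y)"
    using f_le_seminorm[OF xy] complex_Re_le_cmod[of "f (star x * y)"] by simp
  finally show "(seminorm (x + y))\<^sup>2 \<le> (seminorm x + seminorm y)\<^sup>2"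
    using xy by (simp add: seminorm_sq B_add power2_sum)
  show "0 \<le> seminorm x + seminorm y" using xy by (simp add: seminorm_nonneg)
qed

text \<open>The operator norm of left multiplication in the GNS space.\<close>

definition op_bound :: "'b \<Rightarrow> real \<Rightarrow> bool"
  where "op_bound x C \<longleftrightarrow> 0 \<le> C \<and> (\<forall>y\<in>B. seminorm (x * y) \<le> C * seminorm y)"

definition op_norm :: "'b \<Rightarrow> real"
  where "op_norm x = Inf {C. op_bound x C}"

lemma op_norm_le: "op_bound x C \<Longrightarrow> op_norm x \<le> C"
  unfolding op_norm_def by (rule cInf_lower) (auto simp: op_bound_def bdd_below_def)

text \<open>Each quotient \<open>seminorm (x * y) / seminorm y\<close> lies below every bound, hence
  below their infimum. Some bound must exist, because \<open>Inf\<close> of the empty set carries no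
  information.\<close>

lemma op_bound_op_norm:
  assumes "op_bound x C"
  shows "op_bound x (op_norm x)"
proof -
  have ge: "r \<le> op_norm x" if "\<And>C. op_bound x C \<Longrightarrow> r \<le> C" for r
    unfolding op_norm_def using assms that by (intro cInf_greatest) auto
  have "seminorm (x * y) \<le> op_norm x * seminorm y" if y: "y \<in> B" for y
  proof (cases "seminorm y = 0")
    case True
    then show ?thesis using assms y by (auto simp: op_bound_def)
  next
    case False
    then have pos: "0 < seminorm y" using seminorm_nonneg[OF y] by simp
    have "seminorm (x * y) / seminorm y \<le> op_norm x"
      by (rule ge) (use y pos in \<open>auto simp: op_bound_def field_simps\<close>)
    then show ?thesis using pos by (simp add: field_simps)
  qed
  moreover have "0 \<le> op_norm x" by (rule ge) (auto simp: op_bound_def)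
  ultimately show ?thesis by (simp add: op_bound_def)
qed

lemma op_bound_add:
  assumes "op_bound x C" "op_bound y D" "x \<in> B" "y \<in> B"
  shows "op_bound (x + y) (C + D)"
  unfolding op_bound_def
proof (intro conjI ballI)
  fix z assume z: "z \<in> B"
  have "seminorm ((x + y) * z) \<le> seminorm (x * z) + seminorm (y * z)"
    unfolding distrib_right using assms z by (intro seminorm_triangle B_mult)
  also have "\<dots> \<le> C * seminorm z + D * seminorm z"
    using assms z by (intro add_mono) (auto simp: op_bound_def)
  finally show "seminorm ((x + y) * z) \<le> (C + D) * seminorm z"
    by (simp add: distrib_right)
qed (use assms in \<open>auto simp: op_bound_def\<close>)

lemma op_bound_mult:
  assumes "op_bound x C" "op_bound y D" "y \<in> B"
  shows "op_bound (x * y) (C * D)"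
  unfolding op_bound_def
proof (intro conjI ballI)
  fix z assume z: "z \<in> B"
  have "seminorm (x * (y * z)) \<le> C * seminorm (y * z)"
    using assms z by (auto simp: op_bound_def B_mult)
  also have "\<dots> \<le> C * (D * seminorm z)"
    using assms z by (intro mult_left_mono) (auto simp: op_bound_def)
  finally show "seminorm (x * y * z) \<le> C * D * seminorm z"
    by (simp add: mult.assoc)
qed (use assms in \<open>auto simp: op_bound_def\<close>)

lemma op_bound_scaleC:
  assumes "op_bound x C" "x \<in> B"
  shows "op_bound (c *\<^sub>C x) (cmod c * C)"
  using assms
  by (auto simp: op_bound_def mult_scaleC_left seminorm_scaleC B_mult mult.assoc mult_left_mono)

text \<open>The squared length of \<open>star x * y\<close> is
  \<open>f (star y * (x * (star x * y)))\<close>; Cauchy-Schwarz and the bound for \<open>x\<close>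
  leave one factor \<open>seminorm (star x * y)\<close>, which cancels.\<close>

lemma op_bound_star:
  assumes "op_bound x C" "x \<in> B"
  shows "op_bound (star x) C"
  unfolding op_bound_def
proof (intro conjI ballI)
  fix y assume y: "y \<in> B"
  have B: "star x * y \<in> B" using assms y by (simp add: B_mult B_star)
  have "(seminorm (star x * y))\<^sup>2 \<le> cmod (f (star y * (x * (star x * y))))"
    using seminorm_sq[OF B] complex_Re_le_cmod
    by (simp add: sqn_def star_mult star_star mult.assoc)
  also have "\<dots> \<le> seminorm y * seminorm (x * (star x * y))"
    using y B assms(2) by (intro f_le_seminorm B_mult[of x])
  also have "\<dots> \<le> seminorm y * (C * seminorm (star x * y))"
    using y B assms by (intro mult_left_mono seminorm_nonneg) (auto simp: op_bound_def)
  finally have "seminorm (star x * y) * seminorm (star x * y) \<le> (C * seminorm y) * seminorm (star x * y)"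
    by (simp add: power2_eq_square mult_ac)
  then show "seminorm (star x * y) \<le> C * seminorm y"
    using seminorm_nonneg[OF B] seminorm_nonneg[OF y] assms(1)
    by (cases "seminorm (star x * y) = 0") (auto simp: op_bound_def)
qed (use assms in \<open>auto simp: op_bound_def\<close>)

text \<open>The squared length of \<open>x * y\<close> is the inner product of \<open>y\<close> with
  \<open>star x * x * y\<close>, to which Cauchy-Schwarz applies.\<close>

lemma op_bound_cstar:
  assumes "op_bound (star x * x) C" "x \<in> B"
  shows "op_bound x (sqrt C)"
  unfolding op_bound_def
proof (intro conjI ballI)
  fix y assume y: "y \<in> B"
  have B: "x * y \<in> B" "star x * x * y \<in> B" using assms y by (simp_all add: B_mult B_star)
  have "(seminorm (x * y))\<^sup>2 \<le> cmod (f (star y * (star x * x * y)))"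
    using seminorm_sq[OF B(1)] complex_Re_le_cmod
    by (simp add: sqn_def star_mult mult.assoc)
  also have "\<dots> \<le> seminorm y * seminorm (star x * x * y)"
    using y B by (intro f_le_seminorm)
  also have "\<dots> \<le> seminorm y * (C * seminorm y)"
    using y assms by (intro mult_left_mono seminorm_nonneg) (auto simp: op_bound_def)
  finally have "(seminorm (x * y))\<^sup>2 \<le> C * (seminorm y)\<^sup>2"
    by (simp add: power2_eq_square mult_ac)
  then have "sqrt ((seminorm (x * y))\<^sup>2) \<le> sqrt (C * (seminorm y)\<^sup>2)"
    by (rule real_sqrt_le_mono)
  then show "seminorm (x * y) \<le> sqrt C * seminorm y"
    using B y by (simp add: real_sqrt_mult seminorm_nonneg)
qed (use assms in \<open>auto simp: op_bound_def\<close>)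

end

section \<open>The GNS operator norm as a C*-seminorm\<close>

locale bounded_positive_functional = positive_functional +
  assumes bounded: "x \<in> B \<Longrightarrow> \<exists>C. op_bound x C"
begin

lemma op_norm: "x \<in> B \<Longrightarrow> op_bound x (op_norm x)"
  using bounded op_bound_op_norm by blast

lemma op_norm_nonneg: "x \<in> B \<Longrightarrow> 0 \<le> op_norm x"
  using op_norm by (simp add: op_bound_def)

lemma op_norm_add: "x \<in> B \<Longrightarrow> y \<in> B \<Longrightarrow> op_norm (x + y) \<le> op_norm x + op_norm y"
  by (intro op_norm_le op_bound_add op_norm)

lemma op_norm_mult: "x \<in> B \<Longrightarrow> y \<in> B \<Longrightarrow> op_norm (x * y) \<le> op_norm x * op_norm y"
  by (intro op_norm_le op_bound_mult op_norm)

lemma op_norm_scaleC: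
  assumes "x \<in> B"
  shows "op_norm (c *\<^sub>C x) = cmod c * op_norm x"
proof (cases "c = 0")
  case True
  have "op_bound 0 0"
    by (simp add: op_bound_def seminorm_def sqn_def f_zero)
  then have "op_norm 0 = 0" using op_norm_le op_norm_nonneg[OF B_zero] by fastforce
  then show ?thesis using True by simp
next
  case False
  have "op_norm x = op_norm (inverse c *\<^sub>C c *\<^sub>C x)"
    using False by (simp add: scaleC_scaleC)
  also have "\<dots> \<le> cmod (inverse c) * op_norm (c *\<^sub>C x)"
    using assms by (intro op_norm_le op_bound_scaleC op_norm B_scaleC)
  finally have "cmod c * op_norm x \<le> op_norm (c *\<^sub>C x)"
    using False by (simp add: norm_divide divide_simps mult.commute)
  moreover have "op_norm (c *\<^sub>C x) \<le> cmod c * op_norm x"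
    using assms by (intro op_norm_le op_bound_scaleC op_norm)
  ultimately show ?thesis by simp
qed

lemma op_norm_cstar:
  assumes "x \<in> B"
  shows "op_norm (star x * x) = (op_norm x)\<^sup>2"
proof (rule antisym)
  have "op_norm (star x * x) \<le> op_norm (star x) * op_norm x"
    using assms by (intro op_norm_mult B_star)
  also have "\<dots> \<le> op_norm x * op_norm x"
    using assms by (intro mult_right_mono op_norm_le op_bound_star op_norm op_norm_nonneg)
  finally show "op_norm (star x * x) \<le> (op_norm x)\<^sup>2" by (simp add: power2_eq_square)
  have B: "star x * x \<in> B" using assms by (simp add: B_mult B_star)
  have "(op_norm x)\<^sup>2 \<le> (sqrt (op_norm (star x * x)))\<^sup>2"
    using assms B by (intro power_mono op_norm_le op_bound_cstar op_norm op_norm_nonneg)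
  then show "(op_norm x)\<^sup>2 \<le> op_norm (star x * x)"
    using B by (simp add: op_norm_nonneg)
qed

text \<open>\<open>f x\<close> is the inner product of the unit vector 1 with its image under
  \<open>x\<close>.\<close>

lemma f_le_op_norm:
  assumes "x \<in> B"
  shows "cmod (f x) \<le> op_norm x"
proof -
  have "cmod (f x) \<le> seminorm x"
    using f_le_seminorm[OF B_one assms] by (simp add: seminorm_one)
  also have "\<dots> \<le> op_norm x"
    using op_norm[OF assms] B_one unfolding op_bound_def by (metis mult.right_neutral seminorm_one)
  finally show ?thesis .
qed

end

section \<open>Automatic continuity of states and extension from dense subalgebras\<close>

lemma state_positive_functional: "state \<omega> \<Longrightarrow> positive_functional UNIV \<omega>"
  by (auto simp: state_def positive_functional_def)

text \<open>For \<open>r > (norm x)\<^sup>2\<close> the element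
  \<open>1 - (1 / r) *\<^sub>R (star x * x)\<close> is the square of a self-adjoint element, so
  positivity gives \<open>sqn x \<le> r\<close>; Cauchy-Schwarz against 1 then bounds
  \<open>\<omega> x\<close> itself.\<close>

lemma state_bounded:
  assumes "state \<omega>"
  shows "cmod (\<omega> x) \<le> norm x"
proof -
  interpret positive_functional UNIV \<omega>
    using assms by (rule state_positive_functional)
  \<comment> \<open>The inequality for \<open>r\<close> is strict because the square-root series
    requires norm below 1; \<open>dense_ge\<close> recovers the endpoint.\<close>
  have le: "sqn x \<le> r" if r: "r > (norm x)\<^sup>2" for r
  proof -
    have r0: "r > 0" using r by (smt (verit) zero_le_power2)
    define h where "h = (1 / r) *\<^sub>R (star x * x)"
    have "norm h < 1" using r r0 by (simp add: h_def cstar_identity)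
    then obtain s where s: "sqrt_partial h \<longlonglongrightarrow> s" "s * s = 1 - h"
      by (rule sqrt_partial_tendsto)
    have "star h = h" by (simp add: h_def star_scaleR star_mult star_star)
    then have "star s = s"
      using LIMSEQ_unique[OF tendsto_star[OF s(1)]] s(1) by (simp add: star_sqrt_partial)
    then have "0 \<le> Re (\<omega> (1 - h))"
      using sqn_nonneg[of s] s(2) by (simp add: sqn_def)
    moreover have "\<omega> h = complex_of_real (1 / r) * \<omega> (star x * x)"
      unfolding h_def scaleC_of_real[symmetric] by (rule f_scaleC) simp
    ultimately have "0 \<le> 1 - sqn x / r"
      by (simp add: f_diff f_one sqn_def)
    then show ?thesis using r0 by (simp add: field_simps)
  qed
  have "sqn x \<le> (norm x)\<^sup>2" by (rule dense_ge) (rule le)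
  moreover have "(cmod (\<omega> x))\<^sup>2 \<le> sqn x"
    using Cauchy_Schwarz[of 1 x] by (simp add: sqn_def f_one)
  ultimately have "(cmod (\<omega> x))\<^sup>2 \<le> (norm x)\<^sup>2" by linarith
  then show ?thesis by (rule power2_le_imp_le) simp
qed

text \<open>\<open>f\<close> is Lipschitz on \<open>B\<close>, hence extends continuously to the
  closure; linearity passes to limits, and so does positivity because the nonnegative reals are
  closed.\<close>

lemma (in positive_functional) extends_to_state:
  assumes dense: "closure B = UNIV" and le: "\<And>x. x \<in> B \<Longrightarrow> cmod (f x) \<le> norm x"
  obtains \<phi> where "state \<phi>" "\<And>x. x \<in> B \<Longrightarrow> \<phi> x = f x"
proof -
  have "uniformly_continuous_on B f"
    unfolding uniformly_continuous_on_def
  proof (intro allI impI)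
    fix e :: real assume "e > 0"
    moreover have "dist (f y) (f x) \<le> dist y x" if "x \<in> B" "y \<in> B" for x y
      using le[of "y - x"] that by (simp add: dist_norm f_diff B_diff)
    ultimately show "\<exists>d>0. \<forall>x\<in>B. \<forall>y\<in>B. dist y x < d \<longrightarrow> dist (f y) (f x) < e"
      by (meson le_less_trans)
  qed
  then obtain \<phi> where uc: "uniformly_continuous_on UNIV \<phi>" and eq: "\<And>x. x \<in> B \<Longrightarrow> \<phi> x = f x"
    using uniformly_continuous_on_extension_on_closure dense by metis
  have lim: "(\<lambda>n. \<phi> (X n)) \<longlonglongrightarrow> \<phi> x" if "X \<longlonglongrightarrow> x" for X x
    using uniformly_continuous_imp_continuous[OF uc] that
    by (intro continuous_on_tendsto_compose[of UNIV \<phi>]) auto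
  have approx: "\<exists>X. (\<forall>n. X n \<in> B) \<and> X \<longlonglongrightarrow> x" for x
    using dense closure_sequential[of x B] by simp
  have "state \<phi>"
    unfolding state_def
  proof (intro conjI allI)
    fix x y c
    obtain X Y where X: "\<And>n. X n \<in> B" "X \<longlonglongrightarrow> x" and Y: "\<And>n. Y n \<in> B" "Y \<longlonglongrightarrow> y"
      using approx by metis
    have "(\<lambda>n. \<phi> (X n + Y n)) \<longlonglongrightarrow> \<phi> (x + y)" using X Y by (intro lim tendsto_add)
    moreover have "(\<lambda>n. \<phi> (X n + Y n)) \<longlonglongrightarrow> \<phi> x + \<phi> y"
      using tendsto_add[OF lim[OF X(2)] lim[OF Y(2)]] X Y by (simp add: eq f_add B_add)
    ultimately show "\<phi> (x + y) = \<phi> x + \<phi> y" by (rule LIMSEQ_unique)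
    have "(\<lambda>n. \<phi> (c *\<^sub>C X n)) \<longlonglongrightarrow> \<phi> (c *\<^sub>C x)" using X by (intro lim tendsto_scaleC)
    moreover have "(\<lambda>n. \<phi> (c *\<^sub>C X n)) \<longlonglongrightarrow> c * \<phi> x"
      using tendsto_mult[OF tendsto_const lim[OF X(2)], of c] X by (simp add: eq f_scaleC B_scaleC)
    ultimately show "\<phi> (c *\<^sub>C x) = c * \<phi> x" by (rule LIMSEQ_unique)
    have "(\<lambda>n. \<phi> (star (X n) * X n)) \<longlonglongrightarrow> \<phi> (star x * x)"
      using X by (intro lim tendsto_mult tendsto_star)
    then show "\<phi> (star x * x) \<in> \<real>\<^sub>\<ge>\<^sub>0"
      by (rule closed_sequentially[OF closed_nonneg_Reals_complex, rotated])
        (simp add: X eq B_mult B_star f_pos)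
  next
    show "\<phi> 1 = 1" using eq[OF B_one] f_one by simp
  qed
  then show ?thesis using that eq by blast
qed

section \<open>Positive semidefinite matrices and Schur products\<close>

lemma (in positive_functional) B_sum: "(\<And>i. i \<in> I \<Longrightarrow> x i \<in> B) \<Longrightarrow> (\<Sum>i\<in>I. x i) \<in> B"
  by (induction I rule: infinite_finite_induct) (auto simp: B_zero B_add)

lemma (in positive_functional) f_sum:
  "(\<And>i. i \<in> I \<Longrightarrow> x i \<in> B) \<Longrightarrow> f (\<Sum>i\<in>I. x i) = (\<Sum>i\<in>I. f (x i))"
  by (induction I rule: infinite_finite_induct) (auto simp: f_zero f_add B_sum)

definition psd :: "'i set \<Rightarrow> ('i \<Rightarrow> 'i \<Rightarrow> complex) \<Rightarrow> bool"
  where "psd I M \<longleftrightarrow> (\<forall>x. (\<Sum>i\<in>I. \<Sum>j\<in>I. cnj (x i) * x j * M i j) \<in> \<real>\<^sub>\<ge>\<^sub>0)"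

lemma psd_insertD:
  assumes "finite I" "k \<notin> I" "psd (insert k I) M"
  shows "psd I M"
  unfolding psd_def
proof
  fix x :: "'a \<Rightarrow> complex"
  have "(\<Sum>i\<in>insert k I. \<Sum>j\<in>insert k I. cnj ((x(k := 0)) i) * (x(k := 0)) j * M i j) \<in> \<real>\<^sub>\<ge>\<^sub>0"
    using assms(3) unfolding psd_def by blast
  moreover have "(\<Sum>i\<in>insert k I. \<Sum>j\<in>insert k I. cnj ((x(k := 0)) i) * (x(k := 0)) j * M i j) =
      (\<Sum>i\<in>I. \<Sum>j\<in>I. cnj ((x(k := 0)) i) * (x(k := 0)) j * M i j)"
    using assms(1,2) by simp
  moreover have "\<dots> = (\<Sum>i\<in>I. \<Sum>j\<in>I. cnj (x i) * x j * M i j)"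
    using assms(2) by (intro sum.cong) auto
  ultimately show "(\<Sum>i\<in>I. \<Sum>j\<in>I. cnj (x i) * x j * M i j) \<in> \<real>\<^sub>\<ge>\<^sub>0" by simp
qed

text \<open>The quadratic form at \<open>x\<close> is the value of \<open>f\<close> at
  \<open>star z * z\<close>, where \<open>z\<close> is the combination of the \<open>a i\<close>
  with coefficients \<open>x i\<close>.\<close>

lemma (in positive_functional) psd_gram:
  assumes "\<And>i. i \<in> I \<Longrightarrow> a i \<in> B"
  shows "psd I (\<lambda>i j. f (star (a i) * a j))"
  unfolding psd_def
proof
  fix x :: "'a \<Rightarrow> complex"
  let ?z = "\<Sum>i\<in>I. x i *\<^sub>C a i"
  have B: "?z \<in> B" using assms by (intro B_sum B_scaleC)
  have "star ?z * ?z = (\<Sum>i\<in>I. \<Sum>j\<in>I. (cnj (x i) * x j) *\<^sub>C (star (a i) * a j))"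
    by (simp add: star_sum star_scaleC sum_product mult_scaleC_left mult_scaleC_right scaleC_scaleC mult.commute)
  then have "f (star ?z * ?z) = (\<Sum>i\<in>I. \<Sum>j\<in>I. cnj (x i) * x j * f (star (a i) * a j))"
    using assms by (simp add: f_sum f_scaleC B_sum B_scaleC B_mult B_star)
  then show "(\<Sum>i\<in>I. \<Sum>j\<in>I. cnj (x i) * x j * f (star (a i) * a j)) \<in> \<real>\<^sub>\<ge>\<^sub>0"
    using f_pos[OF B] by simp
qed

text \<open>Schur's product theorem, one factor being a Gram matrix. The induction splits off the
  projection of the vectors \<^term>\<open>a i\<close> to the line spanned by one of them.\<close>

lemma (in positive_functional) schur_product:
  assumes "finite I" "\<And>i. i \<in> I \<Longrightarrow> a i \<in> B" "psd I M"
  shows "(\<Sum>i\<in>I. \<Sum>j\<in>I. f (star (a i) * a j) * M i j) \<in> \<real>\<^sub>\<ge>\<^sub>0"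
  using assms
proof (induction I arbitrary: a rule: finite_induct)
  case (insert k I)
  define d where "d = sqn (a k)"
  define w where "w j = f (star (a k) * a j)" for j
  \<comment> \<open>The part of \<open>a j\<close> orthogonal to \<open>a k\<close> in the GNS
    space. For \<open>d = 0\<close> the quotient is 0 by convention and \<open>a'\<close> equals
    \<open>a\<close>; all \<open>w j\<close> vanish then by \<open>w0\<close>.\<close>
  define a' where "a' j = a j - (w j / d) *\<^sub>C a k" for j
  let ?J = "insert k I"
  have aB: "a i \<in> B" if "i \<in> ?J" for i using insert.prems that by blast
  have kB: "a k \<in> B" using aB by blast
  have d: "f (star (a k) * a k) = complex_of_real d" "0 \<le> d"
    using f_star_self[OF kB] sqn_nonneg[OF kB] by (simp_all add: d_def)
  have w0: "w j = 0" if "d = 0" "j \<in> ?J" for j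
    using Cauchy_Schwarz[OF kB aB[OF that(2)]] that(1) by (simp add: d_def w_def)
  have w': "f (star (a j) * a k) = cnj (w j)" if "j \<in> ?J" for j
    using f_hermitian[OF kB aB[OF that]] by (simp add: w_def)
  have a'B: "a' i \<in> B" if "i \<in> ?J" for i
    using aB[OF that] kB by (simp add: a'_def B_diff B_scaleC)
  have gram: "f (star (a' i) * a' j) = f (star (a i) * a j) - cnj (w i) * w j / d"
    if ij: "i \<in> ?J" "j \<in> ?J" for i j
  proof -
    have "f (star (a' i) * a' j) = f (star (a i) * a j) - (w j / d) * cnj (w i)
        - (cnj (w i) / d * w j - cnj (w i) / d * (w j / d) * d)"
      using aB[OF ij(1)] aB[OF ij(2)] kB w'[OF ij(1)] d(1)
      by (simp add: a'_def star_diff star_scaleC left_diff_distrib right_diff_distrib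
          mult_scaleC_left mult_scaleC_right scaleC_scaleC f_diff f_scaleC B_diff B_scaleC
          B_mult B_star w_def)
    then show ?thesis by (cases "d = 0") (simp_all add: field_simps)
  qed
  \<comment> \<open>The Schur complement: its row and column at \<open>k\<close> vanish, and on
    \<open>I\<close> it is the Gram matrix of \<open>a'\<close>, to which the induction hypothesis
    applies.\<close>
  define E where "E i j = f (star (a i) * a j) - cnj (w i) * w j / d" for i j
  have null: "E i j = 0" if "i \<in> ?J" "j \<in> ?J" "i = k \<or> j = k" for i j
  proof (cases "d = 0")
    case True
    have "f (star (a i) * a j) = 0"
      using that w'[OF that(1)] w0[OF True that(1)] w0[OF True that(2)] by (auto simp: w_def)
    then show ?thesis using True by (simp add: E_def)
  next
    case False
    have "w k = d" by (simp add: w_def d)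
    then show ?thesis
      using that False w'[OF that(1)] by (auto simp: E_def w_def[of j, symmetric])
  qed
  \<comment> \<open>The matrix split off has rank at most one; multiplied entrywise with
    \<open>M\<close> it contributes the quadratic form of \<open>M\<close> at \<open>w\<close>, up
    to the factor \<open>1 / d\<close>.\<close>
  have "(\<Sum>i\<in>?J. \<Sum>j\<in>?J. f (star (a i) * a j) * M i j) =
      (\<Sum>i\<in>?J. \<Sum>j\<in>?J. E i j * M i j)
      + (\<Sum>i\<in>?J. \<Sum>j\<in>?J. complex_of_real (1 / d) * (cnj (w i) * w j * M i j))"
    by (simp only: sum.distrib[symmetric]) (simp add: E_def algebra_simps)
  also have "(\<Sum>i\<in>?J. \<Sum>j\<in>?J. E i j * M i j) =
      (\<Sum>i\<in>?J. \<Sum>j\<in>I. E i j * M i j)"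
    using insert.hyps null by (intro sum.cong[OF refl]) simp
  also have "\<dots> = (\<Sum>i\<in>I. \<Sum>j\<in>I. E i j * M i j)"
    using insert.hyps null by auto
  also have "\<dots> = (\<Sum>i\<in>I. \<Sum>j\<in>I. f (star (a' i) * a' j) * M i j)"
    using gram by (intro sum.cong) (auto simp: E_def)
  also have "(\<Sum>i\<in>?J. \<Sum>j\<in>?J. complex_of_real (1 / d) * (cnj (w i) * w j * M i j)) =
      complex_of_real (1 / d) * (\<Sum>i\<in>?J. \<Sum>j\<in>?J. cnj (w i) * w j * M i j)"
    by (simp only: sum_distrib_left)
  finally have eq: "(\<Sum>i\<in>?J. \<Sum>j\<in>?J. f (star (a i) * a j) * M i j) =
      (\<Sum>i\<in>I. \<Sum>j\<in>I. f (star (a' i) * a' j) * M i j)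
      + complex_of_real (1 / d) * (\<Sum>i\<in>?J. \<Sum>j\<in>?J. cnj (w i) * w j * M i j)" .
  have 1: "(\<Sum>i\<in>I. \<Sum>j\<in>I. f (star (a' i) * a' j) * M i j) \<in> \<real>\<^sub>\<ge>\<^sub>0"
    using a'B psd_insertD[OF insert.hyps insert.prems(2)] by (intro insert.IH) auto
  have 2: "(\<Sum>i\<in>?J. \<Sum>j\<in>?J. cnj (w i) * w j * M i j) \<in> \<real>\<^sub>\<ge>\<^sub>0"
    using insert.prems(2) unfolding psd_def by blast
  have "complex_of_real (1 / d) \<in> \<real>\<^sub>\<ge>\<^sub>0"
    using d(2) by (simp add: complex_nonneg_Reals_iff)
  then show ?case
    unfolding eq by (intro nonneg_Reals_add_I nonneg_Reals_mult_I 1 2)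
qed simp

section \<open>Continuity and density arguments for states\<close>

lemma state_tendsto:
  assumes "state \<phi>" "X \<longlonglongrightarrow> x"
  shows "(\<lambda>n. \<phi> (X n)) \<longlonglongrightarrow> \<phi> x"
proof -
  interpret positive_functional UNIV \<phi>
    using assms(1) by (rule state_positive_functional)
  have "bounded_linear \<phi>"
  proof (rule bounded_linear_intro[where K = 1])
    show "\<phi> (r *\<^sub>R x) = r *\<^sub>R \<phi> x" for r x
      using f_scaleC[of x "complex_of_real r"] by (simp add: scaleC_of_real scaleR_conv_of_real)
  qed (use state_bounded[OF assms(1)] f_add in auto)
  then show ?thesis using assms(2) by (rule bounded_linear.tendsto)
qed

lemma states_eqI:
  assumes "state \<phi>" "state \<psi>" "closure S = UNIV" "\<And>x. x \<in> S \<Longrightarrow> \<phi> x = \<psi> x"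
  shows "\<phi> = \<psi>"
proof
  fix x
  obtain X where X: "\<And>n. X n \<in> S" "X \<longlonglongrightarrow> x"
    using assms(3) closure_sequential[of x S] by auto
  have "(\<lambda>n. \<phi> (X n)) \<longlonglongrightarrow> \<psi> x"
    using state_tendsto[OF assms(2) X(2)] assms(4) X(1) by simp
  then show "\<phi> x = \<psi> x"
    using state_tendsto[OF assms(1) X(2)] LIMSEQ_unique by blast
qed

lemma state_comp: "state \<phi> \<Longrightarrow> unital_star_hom j \<Longrightarrow> state (\<lambda>a. \<phi> (j a))"
  unfolding state_def unital_star_hom_def by metis

text \<open>Continuity in \<^term>\<open>a\<close> without using that *-homomorphisms are contractive: by Cauchy-Schwarz it
  reduces to the boundedness of the state \<^term>\<open>\<lambda>a. \<phi> (j a)\<close>.\<close>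

lemma state_hom_tendsto:
  assumes \<phi>: "state \<phi>" and j: "unital_star_hom j" and X: "X \<longlonglongrightarrow> a"
  shows "(\<lambda>n. \<phi> (j (X n) * y)) \<longlonglongrightarrow> \<phi> (j a * y)"
    and "(\<lambda>n. \<phi> (y * j (X n))) \<longlonglongrightarrow> \<phi> (y * j a)"
proof -
  interpret positive_functional UNIV \<phi>
    using \<phi> by (rule state_positive_functional)
  note simps = unital_star_hom_simps[OF j]
  have lim: "(\<lambda>n. \<phi> (j (X n) * y)) \<longlonglongrightarrow> \<phi> (j a * y)" if "X \<longlonglongrightarrow> a" for X a y
  proof -
    \<comment> \<open>Cauchy-Schwarz is applied to \<open>star (j b)\<close>, whose squared length
      is a value of the state \<open>\<lambda>a. \<phi> (j a)\<close>.\<close>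
    have bound: "(cmod (\<phi> (j b * y)))\<^sup>2 \<le> (norm b)\<^sup>2 * sqn y" for b
    proof -
      have "(cmod (\<phi> (star (star (j b)) * y)))\<^sup>2 \<le> sqn (star (j b)) * sqn y"
        by (rule Cauchy_Schwarz) auto
      also have "sqn (star (j b)) = Re (\<phi> (j (star (star b) * star b)))"
        by (simp add: sqn_def simps)
      also have "\<dots> \<le> norm (star (star b) * star b)"
        using state_bounded[OF state_comp[OF \<phi> j]] complex_Re_le_cmod order_trans by blast
      also have "\<dots> = (norm b)\<^sup>2"
        by (simp only: cstar_identity norm_star)
      finally show ?thesis
        using sqn_nonneg[of y] by (simp add: star_star mult_right_mono)
    qed
    have "cmod (\<phi> (j (X n) * y) - \<phi> (j a * y)) \<le> norm (X n - a) * sqrt (sqn y)" for n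
    proof -
      have "\<phi> (j (X n) * y) - \<phi> (j a * y) = \<phi> (j (X n - a) * y)"
        by (simp add: simps left_diff_distrib f_diff)
      then have "(cmod (\<phi> (j (X n) * y) - \<phi> (j a * y)))\<^sup>2 \<le> (norm (X n - a) * sqrt (sqn y))\<^sup>2"
        using bound[of "X n - a"] sqn_nonneg[of y] by (simp add: power_mult_distrib)
      then show ?thesis by (rule power2_le_imp_le) (simp add: sqn_nonneg)
    qed
    moreover have "(\<lambda>n. norm (X n - a) * sqrt (sqn y)) \<longlonglongrightarrow> 0"
      using that by (intro tendsto_mult_left_zero) (simp add: LIM_zero tendsto_norm_zero)
    ultimately have "(\<lambda>n. \<phi> (j (X n) * y) - \<phi> (j a * y)) \<longlonglongrightarrow> 0"
      by (rule Lim_null_comparison[OF always_eventually[OF allI]])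
    then show ?thesis by (rule LIM_zero_cancel)
  qed
  show "(\<lambda>n. \<phi> (j (X n) * y)) \<longlonglongrightarrow> \<phi> (j a * y)" using X by (rule lim)
  have flip: "\<phi> (y * j b) = cnj (\<phi> (j (star b) * star y))" for b
    using f_star[of "y * j b"] by (simp add: star_mult simps)
  show "(\<lambda>n. \<phi> (y * j (X n))) \<longlonglongrightarrow> \<phi> (y * j a)"
    unfolding flip by (intro tendsto_cnj lim tendsto_star X)
qed

section \<open>The product functional on the twisted tensor product\<close>

locale twisted_product_functional = graded_cstar_algebra \<gamma> + twisted_tensor_product \<gamma> v \<iota> j\<^sub>1 j\<^sub>2
  for \<gamma> :: "'g::{topological_ab_group_add,t2_space} \<Rightarrow> 'a::unital_cstar_algebra \<Rightarrow> 'a"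
    and v :: "('g \<Rightarrow> complex) \<Rightarrow> ('g \<Rightarrow> complex) \<Rightarrow> complex"
    and \<iota> :: "'a tensor \<Rightarrow> 'b::unital_cstar_algebra"
    and j\<^sub>1 j\<^sub>2 :: "'a \<Rightarrow> 'b" +
  fixes \<omega> :: "'a \<Rightarrow> complex"
  assumes bichar: "bicharacter v" and state: "state \<omega>"
begin

sublocale \<omega>: positive_functional UNIV \<omega>
  using state by (rule state_positive_functional)

lemmas left_simps = unital_star_hom_simps[OF left_hom(1)]
lemmas right_simps = unital_star_hom_simps[OF right_hom(1)]

section \<open>Bicharacter identities and commutation of the two copies of the algebra\<close>

lemma dual_group_one: "(\<lambda>_. 1) \<in> dual_group"
  by (simp add: dual_group_def)

lemma dual_group_norm: "\<xi> \<in> dual_group \<Longrightarrow> cnj (\<xi> g) * \<xi> g = 1"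
  using complex_norm_square[of "\<xi> g"] by (simp add: dual_group_def mult.commute)

lemma homogeneous_one: "1 \<in> homogeneous \<gamma> (\<lambda>_. 1)"
  by (simp add: homogeneous_def action_simps)

lemma v_norm: "\<xi> \<in> dual_group \<Longrightarrow> \<eta> \<in> dual_group \<Longrightarrow> cmod (v \<xi> \<eta>) = 1"
  using bichar by (simp add: bicharacter_def)

lemma v_cnj_cancel: "\<xi> \<in> dual_group \<Longrightarrow> \<eta> \<in> dual_group \<Longrightarrow> cnj (v \<xi> \<eta>) * v \<xi> \<eta> = 1"
  using complex_norm_square[of "v \<xi> \<eta>"] by (simp add: v_norm mult.commute)

lemma v_mult:
  assumes "\<xi> \<in> dual_group" "\<eta> \<in> dual_group" "\<theta> \<in> dual_group"
  shows "v (\<lambda>g. \<xi> g * \<eta> g) \<theta> = v \<xi> \<theta> * v \<eta> \<theta>" "v \<theta> (\<lambda>g. \<xi> g * \<eta> g) = v \<theta> \<xi> * v \<theta> \<eta>"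
  using bichar assms by (simp_all add: bicharacter_def)

lemma v_one:
  assumes "\<xi> \<in> dual_group"
  shows "v (\<lambda>_. 1) \<xi> = 1" "v \<xi> (\<lambda>_. 1) = 1"
proof -
  have "v (\<lambda>_. 1) \<xi> \<noteq> 0" "v \<xi> (\<lambda>_. 1) \<noteq> 0"
    using v_norm[OF dual_group_one assms] v_norm[OF assms dual_group_one] by auto
  then show "v (\<lambda>_. 1) \<xi> = 1" "v \<xi> (\<lambda>_. 1) = 1"
    using v_mult[OF dual_group_one dual_group_one assms] by simp_all
qed

lemma v_cnj:
  assumes "\<xi> \<in> dual_group" "\<eta> \<in> dual_group"
  shows "v (\<lambda>g. cnj (\<xi> g)) \<eta> = cnj (v \<xi> \<eta>)" "v \<xi> (\<lambda>g. cnj (\<eta> g)) = cnj (v \<xi> \<eta>)"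
proof -
  have "v (\<lambda>g. cnj (\<xi> g)) \<eta> * v \<xi> \<eta> = 1"
    using v_mult(1)[OF dual_group_cnj[OF assms(1)] assms] v_one(1)[OF assms(2)] dual_group_norm[OF assms(1)]
    by simp
  then show "v (\<lambda>g. cnj (\<xi> g)) \<eta> = cnj (v \<xi> \<eta>)"
    using v_cnj_cancel[OF assms] by (metis mult.assoc mult.commute mult.right_neutral)
  have "v \<xi> (\<lambda>g. cnj (\<eta> g)) * v \<xi> \<eta> = 1"
    using v_mult(2)[OF dual_group_cnj[OF assms(2)] assms(2,1)] v_one(2)[OF assms(1)] dual_group_norm[OF assms(2)]
    by simp
  then show "v \<xi> (\<lambda>g. cnj (\<eta> g)) = cnj (v \<xi> \<eta>)"
    using v_cnj_cancel[OF assms] by (metis mult.assoc mult.commute mult.right_neutral)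
qed

lemma iota_tens_mult:
  assumes d: "\<xi>\<^sub>1 \<in> dual_group" "\<xi>\<^sub>2 \<in> dual_group" "\<xi>\<^sub>3 \<in> dual_group" "\<xi>\<^sub>4 \<in> dual_group"
    and h: "a \<in> homogeneous \<gamma> \<xi>\<^sub>1" "b \<in> homogeneous \<gamma> \<xi>\<^sub>2" "c \<in> homogeneous \<gamma> \<xi>\<^sub>3" "d \<in> homogeneous \<gamma> \<xi>\<^sub>4"
  shows "\<iota> (tens \<gamma> a b) * \<iota> (tens \<gamma> c d) = cnj (v \<xi>\<^sub>3 \<xi>\<^sub>2) *\<^sub>C \<iota> (tens \<gamma> (a * c) (b * d))"
proof -
  have U: "a \<in> U" "b \<in> U" "c \<in> U" "d \<in> U" using d h homogeneous_U by auto
  have "twisted_mult \<gamma> v (tens \<gamma> a b) (tens \<gamma> c d) =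
      scale_tensor (cnj (v \<xi>\<^sub>3 \<xi>\<^sub>2)) (tens \<gamma> (a * c) (b * d))"
    using twisted_mult_well_defined[of v] d h unfolding is_twisted_mult_def by blast
  then show ?thesis
    using U by (metis alg_tensor_closed(4) completion_mult completion_scale U_mult)
qed

text \<open>The factors that meet in the middle are both 1, so the phase is \<open>v\<close> at
  trivial characters, which is 1. From here on elementary tensors are handled as products in the
  completion.\<close>

lemma iota_tens:
  assumes "\<xi> \<in> dual_group" "\<eta> \<in> dual_group" "a \<in> homogeneous \<gamma> \<xi>" "b \<in> homogeneous \<gamma> \<eta>"
  shows "\<iota> (tens \<gamma> a b) = j\<^sub>1 a * j\<^sub>2 b"
  using iota_tens_mult[OF assms(1) dual_group_one dual_group_one assms(2) assms(3) homogeneous_one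
      homogeneous_one assms(4)] v_one[OF dual_group_one] homogeneous_U assms
  by (simp add: left_extends right_extends)

text \<open>The defining product formula for \<open>1 \<otimes> b\<close> times
  \<open>a \<otimes> 1\<close>; every later reordering of the two copies rests on it.\<close>

lemma twisted_commute:
  assumes "\<xi> \<in> dual_group" "\<eta> \<in> dual_group" "a \<in> homogeneous \<gamma> \<xi>" "b \<in> homogeneous \<gamma> \<eta>"
  shows "j\<^sub>2 b * j\<^sub>1 a = cnj (v \<xi> \<eta>) *\<^sub>C (j\<^sub>1 a * j\<^sub>2 b)"
  using iota_tens_mult[OF dual_group_one assms(2,1) dual_group_one homogeneous_one assms(4,3)
      homogeneous_one] iota_tens[OF assms] homogeneous_U assms
  by (simp add: left_extends right_extends)

text \<open>The adjoint reverses the factors; swapping them back costs a phase at the conjugate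
  degrees, and conjugating both arguments of \<open>v\<close> leaves its value unchanged.\<close>

lemma star_product:
  assumes "\<xi> \<in> dual_group" "\<eta> \<in> dual_group" "a \<in> homogeneous \<gamma> \<xi>" "b \<in> homogeneous \<gamma> \<eta>"
  shows "star (j\<^sub>1 a * j\<^sub>2 b) = cnj (v \<xi> \<eta>) *\<^sub>C (j\<^sub>1 (star a) * j\<^sub>2 (star b))"
  using twisted_commute[OF dual_group_cnj[OF assms(1)] dual_group_cnj[OF assms(2)]
      homogeneous_closed(5)[OF assms(3)] homogeneous_closed(5)[OF assms(4)]]
  by (simp add: star_mult left_simps right_simps v_cnj assms dual_group_cnj)

text \<open>Only the inner factors \<open>b\<close> and \<open>c\<close> change places, so
  \<open>a\<close> and \<open>d\<close> may be arbitrary.\<close>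

lemma product_mult:
  assumes "\<beta> \<in> dual_group" "\<alpha> \<in> dual_group" "b \<in> homogeneous \<gamma> \<beta>" "c \<in> homogeneous \<gamma> \<alpha>"
  shows "(j\<^sub>1 a * j\<^sub>2 b) * (j\<^sub>1 c * j\<^sub>2 d) = cnj (v \<alpha> \<beta>) *\<^sub>C (j\<^sub>1 (a * c) * j\<^sub>2 (b * d))"
proof -
  have "(j\<^sub>1 a * j\<^sub>2 b) * (j\<^sub>1 c * j\<^sub>2 d) = j\<^sub>1 a * (j\<^sub>2 b * j\<^sub>1 c) * j\<^sub>2 d"
    by (simp add: mult.assoc)
  also have "\<dots> = cnj (v \<alpha> \<beta>) *\<^sub>C (j\<^sub>1 (a * c) * j\<^sub>2 (b * d))"
    unfolding twisted_commute[OF assms(2,1,4,3)]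
    by (simp add: left_simps right_simps mult_scaleC_left mult_scaleC_right mult.assoc)
  finally show ?thesis .
qed

section \<open>The dense *-subalgebra spanned by products of homogeneous elements\<close>

definition product_span :: "'b set" where "product_span = \<iota> ` alg_tensor \<gamma>"

abbreviation (input) B where "B \<equiv> product_span"

lemma closure_B: "closure B = UNIV"
  using completion_dense by (simp add: product_span_def)

lemma product_in_B:
  assumes "\<xi> \<in> dual_group" "\<eta> \<in> dual_group" "a \<in> homogeneous \<gamma> \<xi>" "b \<in> homogeneous \<gamma> \<eta>"
  shows "j\<^sub>1 a * j\<^sub>2 b \<in> B"
  using iota_tens[OF assms] alg_tensor_closed(4) homogeneous_U assms
  unfolding product_span_def by (metis imageI)

lemma iota_zero: "\<iota> 0 = 0"
  using completion_scale[OF alg_tensor_closed(3), of 0] by simp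

lemma B_add: "x \<in> B \<Longrightarrow> y \<in> B \<Longrightarrow> x + y \<in> B"
  unfolding product_span_def using alg_tensor_closed(1) completion_add by (metis (no_types) imageE imageI)

lemma B_scaleC: "x \<in> B \<Longrightarrow> c *\<^sub>C x \<in> B"
  unfolding product_span_def using alg_tensor_closed(2) completion_scale by (metis (no_types) imageE imageI)

lemma B_zero: "0 \<in> B"
  unfolding product_span_def using alg_tensor_closed(3) iota_zero by (metis imageI)

lemma B_induct [consumes 1, case_names zero add]:
  assumes "z \<in> B" "P 0"
    and step: "\<And>z a b \<xi> \<eta>. z \<in> B \<Longrightarrow> P z \<Longrightarrow> \<xi> \<in> dual_group \<Longrightarrow> \<eta> \<in> dual_group \<Longrightarrow>
      a \<in> homogeneous \<gamma> \<xi> \<Longrightarrow> b \<in> homogeneous \<gamma> \<eta> \<Longrightarrow> P (z + j\<^sub>1 a * j\<^sub>2 b)"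
  shows "P z"
proof -
  obtain x where x: "x \<in> alg_tensor \<gamma>" "z = \<iota> x"
    using assms(1) by (auto simp: product_span_def)
  have "P (\<iota> x)" using x(1)
  proof (induction rule: alg_tensor_induct)
    case zero
    show ?case unfolding iota_zero by (rule assms(2))
  next
    case (add x a b \<xi> \<eta>)
    have "tens \<gamma> a b \<in> alg_tensor \<gamma>" using add.hyps homogeneous_U alg_tensor_closed(4) by blast
    moreover have "\<iota> x \<in> B" using add.hyps by (simp add: product_span_def)
    moreover have "\<iota> (x + tens \<gamma> a b) = \<iota> x + j\<^sub>1 a * j\<^sub>2 b"
      unfolding iota_tens[OF add.hyps(2-5), symmetric] using add.hyps(1) calculation(1)
      by (rule completion_add)
    ultimately show ?case
      using step[OF _ add.IH add.hyps(2-5)] by metis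
  qed
  then show ?thesis using x by simp
qed

lemma B_sum: "(\<And>i. i \<in> I \<Longrightarrow> x i \<in> B) \<Longrightarrow> (\<Sum>i\<in>I. x i) \<in> B"
  by (induction I rule: infinite_finite_induct) (auto simp: B_zero B_add)

lemma left_in_B: "\<xi> \<in> dual_group \<Longrightarrow> a \<in> homogeneous \<gamma> \<xi> \<Longrightarrow> j\<^sub>1 a \<in> B"
  using product_in_B[OF _ dual_group_one _ homogeneous_one] by (simp add: right_simps)

lemma right_in_B: "\<xi> \<in> dual_group \<Longrightarrow> b \<in> homogeneous \<gamma> \<xi> \<Longrightarrow> j\<^sub>2 b \<in> B"
  using product_in_B[OF dual_group_one _ homogeneous_one] by (simp add: left_simps)

lemma B_one: "1 \<in> B"
  using left_in_B[OF dual_group_one homogeneous_one] by (simp add: left_simps)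

lemma B_mult:
  assumes "x \<in> B" "y \<in> B"
  shows "x * y \<in> B"
  using assms(1)
proof (induction rule: B_induct)
  case zero
  then show ?case by (simp add: B_zero)
next
  case (add x a b \<xi> \<eta>)
  have "j\<^sub>1 a * j\<^sub>2 b * y \<in> B" using assms(2)
  proof (induction rule: B_induct)
    case zero
    then show ?case by (simp add: B_zero)
  next
    case (add y c d \<xi>' \<eta>')
    note h = \<open>\<xi> \<in> dual_group\<close> \<open>\<eta> \<in> dual_group\<close> \<open>a \<in> homogeneous \<gamma> \<xi>\<close> \<open>b \<in> homogeneous \<gamma> \<eta>\<close>
    have "j\<^sub>1 (a * c) * j\<^sub>2 (b * d) \<in> B"
      using h add.hyps by (intro product_in_B[OF dual_group_mult dual_group_mult] homogeneous_closed(4))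
    then show ?case
      using add.IH product_mult[OF h(2) add.hyps(2) h(4) add.hyps(4)]
      by (simp add: distrib_left B_add B_scaleC)
  qed
  then show ?case using add.IH by (simp add: distrib_right B_add)
qed

lemma B_star: "x \<in> B \<Longrightarrow> star x \<in> B"
proof (induction rule: B_induct)
  case zero
  then show ?case by (simp add: B_zero)
next
  case (add x a b \<xi> \<eta>)
  have "j\<^sub>1 (star a) * j\<^sub>2 (star b) \<in> B"
    using add.hyps by (intro product_in_B[OF dual_group_cnj dual_group_cnj] homogeneous_closed(5))
  then show ?case using add star_product[OF add.hyps(2-5)] by (simp add: star_add B_add B_scaleC)
qed

lemma B_sum_form:
  assumes "z \<in> B"
  obtains n :: nat and a b \<alpha> \<beta> where
    "\<And>i. i < n \<Longrightarrow> \<alpha> i \<in> dual_group \<and> \<beta> i \<in> dual_group \<and> a i \<in> homogeneous \<gamma> (\<alpha> i) \<and> b i \<in> homogeneous \<gamma> (\<beta> i)"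
    "z = (\<Sum>i<n. j\<^sub>1 (a i) * j\<^sub>2 (b i))"
proof -
  have "\<exists>(n::nat) a b \<alpha> \<beta>. (\<forall>i<n. \<alpha> i \<in> dual_group \<and> \<beta> i \<in> dual_group \<and> a i \<in> homogeneous \<gamma> (\<alpha> i) \<and>
      b i \<in> homogeneous \<gamma> (\<beta> i)) \<and> z = (\<Sum>i<n. j\<^sub>1 (a i) * j\<^sub>2 (b i))" (is "?P z")
    using assms
  proof (induction rule: B_induct)
    case zero
    show ?case by (rule exI[of _ 0]) simp
  next
    case (add z c d \<xi> \<eta>)
    then obtain n :: nat and a b \<alpha> \<beta> where *: "\<forall>i<n. \<alpha> i \<in> dual_group \<and> \<beta> i \<in> dual_group \<and>
        a i \<in> homogeneous \<gamma> (\<alpha> i) \<and> b i \<in> homogeneous \<gamma> (\<beta> i)" "z = (\<Sum>i<n. j\<^sub>1 (a i) * j\<^sub>2 (b i))"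
      by blast
    show ?case
      using add.hyps *
      by (intro exI[of _ "Suc n"] exI[of _ "a(n := c)"] exI[of _ "b(n := d)"] exI[of _ "\<alpha>(n := \<xi>)"]
          exI[of _ "\<beta>(n := \<eta>)"]) (auto simp: less_Suc_eq)
  qed
  then show ?thesis using that by blast
qed

section \<open>The product functional and its values on products with adjoints\<close>

lemma inj_on_iota: "inj_on \<iota> (alg_tensor \<gamma>)"
proof (rule inj_onI)
  fix x y assume xy: "x \<in> alg_tensor \<gamma>" "y \<in> alg_tensor \<gamma>" "\<iota> x = \<iota> y"
  let ?z = "x + scale_tensor (-1) y"
  have z: "?z \<in> alg_tensor \<gamma>" using xy alg_tensor_closed by blast
  have "\<iota> ?z = 0"
    using xy by (simp add: completion_add completion_scale alg_tensor_closed(2) scaleC_minus1)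
  moreover have "\<forall>x\<in>alg_tensor \<gamma>. norm (\<iota> x) = 0 \<longleftrightarrow> x = 0"
    using completion_norm unfolding maximal_twisted_cstar_norm_def twisted_cstar_norm_def by blast
  ultimately have "?z = 0" using z by (metis norm_zero)
  then show "x = y" by (auto simp: fun_eq_iff scale_tensor_def)
qed

text \<open>A tensor is encoded as a functional on bilinear forms, so evaluating it at
  \<open>\<lambda>a b. \<omega> a * \<omega> b\<close> is well defined without choosing a
  decomposition into elementary tensors. The value is meaningful on \<open>product_span\<close>
  only.\<close>

definition product_functional :: "'b \<Rightarrow> complex"
  where "product_functional z = inv_into (alg_tensor \<gamma>) \<iota> z (\<lambda>a b. \<omega> a * \<omega> b)"

abbreviation (input) F where "F \<equiv> product_functional"

lemma F_iota: "x \<in> alg_tensor \<gamma> \<Longrightarrow> F (\<iota> x) = x (\<lambda>a b. \<omega> a * \<omega> b)"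
  by (simp add: product_functional_def inv_into_f_f[OF inj_on_iota])

lemma F_product:
  assumes "\<xi> \<in> dual_group" "\<eta> \<in> dual_group" "a \<in> homogeneous \<gamma> \<xi>" "b \<in> homogeneous \<gamma> \<eta>"
  shows "F (j\<^sub>1 a * j\<^sub>2 b) = \<omega> a * \<omega> b"
proof -
  have "bilinear_form_on U (\<lambda>a b. \<omega> a * \<omega> b)"
    by (simp add: bilinear_form_on_def \<omega>.f_add \<omega>.f_scaleC algebra_simps)
  then have "tens \<gamma> a b (\<lambda>a b. \<omega> a * \<omega> b) = \<omega> a * \<omega> b"
    by (simp add: tens_def elem_tensor_def)
  then show ?thesis
    using F_iota[OF alg_tensor_closed(4)[OF homogeneous_U homogeneous_U]] assms
    unfolding iota_tens[OF assms, symmetric] by metis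
qed

lemma F_add: "x \<in> B \<Longrightarrow> y \<in> B \<Longrightarrow> F (x + y) = F x + F y"
  unfolding product_span_def
  by (auto simp: completion_add[symmetric] F_iota alg_tensor_closed(1))

lemma F_scaleC: "x \<in> B \<Longrightarrow> F (c *\<^sub>C x) = c * F x"
  unfolding product_span_def
  by (auto simp: completion_scale[symmetric] F_iota alg_tensor_closed(2)) (simp add: scale_tensor_def)

lemma F_zero: "F 0 = 0"
  using F_scaleC[OF B_zero, of 0] by simp

lemma F_sum: "(\<And>i. i \<in> I \<Longrightarrow> x i \<in> B) \<Longrightarrow> F (\<Sum>i\<in>I. x i) = (\<Sum>i\<in>I. F (x i))"
  by (induction I rule: infinite_finite_induct) (auto simp: F_zero F_add B_sum)

text \<open>The involution contributes \<open>cnj (v \<alpha> \<beta>)\<close>, and moving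
  \<open>star b\<close> past \<open>c\<close> contributes \<open>v \<alpha>' \<beta>\<close>;
  multiplicativity in the first variable joins the two.\<close>

lemma F_star_product:
  assumes d: "\<alpha> \<in> dual_group" "\<beta> \<in> dual_group" "\<alpha>' \<in> dual_group" "\<beta>' \<in> dual_group"
    and h: "a \<in> homogeneous \<gamma> \<alpha>" "b \<in> homogeneous \<gamma> \<beta>" "c \<in> homogeneous \<gamma> \<alpha>'" "d \<in> homogeneous \<gamma> \<beta>'"
  shows "F (star (j\<^sub>1 a * j\<^sub>2 b) * (j\<^sub>1 c * j\<^sub>2 d)) =
    v (\<lambda>g. cnj (\<alpha> g) * \<alpha>' g) \<beta> * (\<omega> (star a * c) * \<omega> (star b * d))"
proof -
  note dc = dual_group_cnj[OF d(1)] dual_group_cnj[OF d(2)]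
  note hs = homogeneous_closed(5)[OF h(1)] homogeneous_closed(5)[OF h(2)]
  note hp = homogeneous_closed(4)[OF hs(1) h(3)] homogeneous_closed(4)[OF hs(2) h(4)]
  note dm = dual_group_mult[OF dc(1) d(3)] dual_group_mult[OF dc(2) d(4)]
  have "star (j\<^sub>1 a * j\<^sub>2 b) * (j\<^sub>1 c * j\<^sub>2 d) =
      (cnj (v \<alpha> \<beta>) * v \<alpha>' \<beta>) *\<^sub>C (j\<^sub>1 (star a * c) * j\<^sub>2 (star b * d))"
    unfolding star_product[OF d(1,2) h(1,2)] mult_scaleC_left product_mult[OF dc(2) d(3) hs(2) h(3)]
    by (simp add: scaleC_scaleC v_cnj d)
  then show ?thesis
    using F_scaleC[OF product_in_B[OF dm hp]] F_product[OF dm hp]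
    by (simp add: v_mult(1)[OF dc(1) d(3,2)] v_cnj(1)[OF d(1,2)])
qed

text \<open>The two families share their degrees but may differ: \<open>F_positive\<close> takes
  them equal, \<open>F_neutral_tendsto\<close> multiplies the second one by a neutral
  element.\<close>

lemma F_expand:
  assumes "\<And>i. i \<in> I \<Longrightarrow> \<alpha> i \<in> dual_group" "\<And>i. i \<in> I \<Longrightarrow> \<beta> i \<in> dual_group"
    and "\<And>i. i \<in> I \<Longrightarrow> a i \<in> homogeneous \<gamma> (\<alpha> i)" "\<And>i. i \<in> I \<Longrightarrow> b i \<in> homogeneous \<gamma> (\<beta> i)"
    and "\<And>i. i \<in> I \<Longrightarrow> c i \<in> homogeneous \<gamma> (\<alpha> i)" "\<And>i. i \<in> I \<Longrightarrow> d i \<in> homogeneous \<gamma> (\<beta> i)"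
  shows "F (star (\<Sum>i\<in>I. j\<^sub>1 (a i) * j\<^sub>2 (b i)) * (\<Sum>j\<in>I. j\<^sub>1 (c j) * j\<^sub>2 (d j))) =
    (\<Sum>i\<in>I. \<Sum>j\<in>I. v (\<lambda>g. cnj (\<alpha> i g) * \<alpha> j g) (\<beta> i) *
      (\<omega> (star (a i) * c j) * \<omega> (star (b i) * d j)))"
proof -
  have mem: "star (j\<^sub>1 (a i) * j\<^sub>2 (b i)) * (j\<^sub>1 (c j) * j\<^sub>2 (d j)) \<in> B" if "i \<in> I" "j \<in> I" for i j
    using product_in_B[of "\<alpha> i" "\<beta> i" "a i" "b i"] product_in_B[of "\<alpha> j" "\<beta> j" "c j" "d j"] assms that
    by (simp add: B_mult B_star)
  have "F (star (\<Sum>i\<in>I. j\<^sub>1 (a i) * j\<^sub>2 (b i)) * (\<Sum>j\<in>I. j\<^sub>1 (c j) * j\<^sub>2 (d j))) =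
      F (\<Sum>i\<in>I. \<Sum>j\<in>I. star (j\<^sub>1 (a i) * j\<^sub>2 (b i)) * (j\<^sub>1 (c j) * j\<^sub>2 (d j)))"
    by (simp only: star_sum sum_product)
  also have "\<dots> = (\<Sum>i\<in>I. F (\<Sum>j\<in>I. star (j\<^sub>1 (a i) * j\<^sub>2 (b i)) * (j\<^sub>1 (c j) * j\<^sub>2 (d j))))"
    using mem by (intro F_sum B_sum) auto
  also have "\<dots> = (\<Sum>i\<in>I. \<Sum>j\<in>I. F (star (j\<^sub>1 (a i) * j\<^sub>2 (b i)) * (j\<^sub>1 (c j) * j\<^sub>2 (d j))))"
    using mem by (intro sum.cong refl F_sum) auto
  also have "\<dots> = (\<Sum>i\<in>I. \<Sum>j\<in>I. v (\<lambda>g. cnj (\<alpha> i g) * \<alpha> j g) (\<beta> i) *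
      (\<omega> (star (a i) * c j) * \<omega> (star (b i) * d j)))"
  proof (intro sum.cong refl)
    fix i j assume "i \<in> I" "j \<in> I"
    then show "F (star (j\<^sub>1 (a i) * j\<^sub>2 (b i)) * (j\<^sub>1 (c j) * j\<^sub>2 (d j))) =
        v (\<lambda>g. cnj (\<alpha> i g) * \<alpha> j g) (\<beta> i) * (\<omega> (star (a i) * c j) * \<omega> (star (b i) * d j))"
      using assms by (intro F_star_product[of "\<alpha> i" "\<beta> i" "\<alpha> j" "\<beta> j"]) auto
  qed
  finally show ?thesis .
qed

text \<open>For \<^term>\<open>c\<close> of neutral degree, \<open>j\<^sub>1 c * z\<close> and \<open>j\<^sub>2 c * z\<close> have the expansion of \<^term>\<open>z\<close> with
  all degrees unchanged, so the twisting coefficients do not depend on \<^term>\<open>c\<close>.\<close>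

lemma F_neutral_tendsto:
  assumes z: "z \<in> B" and X: "X \<longlonglongrightarrow> c" "\<And>n. X n \<in> homogeneous \<gamma> (\<lambda>_. 1)" "c \<in> homogeneous \<gamma> (\<lambda>_. 1)"
  shows "(\<lambda>n. F (star z * (j\<^sub>1 (X n) * z))) \<longlonglongrightarrow> F (star z * (j\<^sub>1 c * z))"
    and "(\<lambda>n. F (star z * (j\<^sub>2 (X n) * z))) \<longlonglongrightarrow> F (star z * (j\<^sub>2 c * z))"
proof -
  obtain n :: nat and a b \<alpha> \<beta> where
    h: "\<And>i. i < n \<Longrightarrow> \<alpha> i \<in> dual_group \<and> \<beta> i \<in> dual_group \<and> a i \<in> homogeneous \<gamma> (\<alpha> i) \<and> b i \<in> homogeneous \<gamma> (\<beta> i)"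
    and z_eq: "z = (\<Sum>i<n. j\<^sub>1 (a i) * j\<^sub>2 (b i))"
    using z by (rule B_sum_form) blast
  define \<kappa> where "\<kappa> i j = v (\<lambda>g. cnj (\<alpha> i g) * \<alpha> j g) (\<beta> i)" for i j
  have expand: "F (star z * (\<Sum>j<n. j\<^sub>1 (a' j) * j\<^sub>2 (b' j))) =
      (\<Sum>i<n. \<Sum>j<n. \<kappa> i j * (\<omega> (star (a i) * a' j) * \<omega> (star (b i) * b' j)))"
    if "\<And>i. i < n \<Longrightarrow> a' i \<in> homogeneous \<gamma> (\<alpha> i) \<and> b' i \<in> homogeneous \<gamma> (\<beta> i)" for a' b'
    unfolding z_eq \<kappa>_def by (rule F_expand) (use h that in auto)
  have left: "F (star z * (j\<^sub>1 c * z)) =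
      (\<Sum>i<n. \<Sum>j<n. \<kappa> i j * (\<omega> (star (a i) * (c * a j)) * \<omega> (star (b i) * b j)))"
    if c: "c \<in> homogeneous \<gamma> (\<lambda>_. 1)" for c
  proof -
    have "c * a i \<in> homogeneous \<gamma> (\<alpha> i)" if "i < n" for i
      using homogeneous_closed(4)[OF c] h[OF that] by fastforce
    then show ?thesis
      using expand[of "\<lambda>i. c * a i" b] h
      by (simp add: z_eq sum_distrib_left left_simps mult.assoc)
  qed
  have right: "F (star z * (j\<^sub>2 c * z)) =
      (\<Sum>i<n. \<Sum>j<n. \<kappa> i j * (\<omega> (star (a i) * a j) * \<omega> (star (b i) * (c * b j))))"
    if c: "c \<in> homogeneous \<gamma> (\<lambda>_. 1)" for c
  proof -
    have "c * b i \<in> homogeneous \<gamma> (\<beta> i)" if "i < n" for i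
      using homogeneous_closed(4)[OF c] h[OF that] by fastforce
    \<comment> \<open>A neutral \<open>c\<close> passes \<open>j\<^sub>1 (a i)\<close> without a
      phase, since \<open>v\<close> is 1 at a trivial second argument.\<close>
    moreover have "j\<^sub>2 c * (j\<^sub>1 (a i) * j\<^sub>2 (b i)) = j\<^sub>1 (a i) * j\<^sub>2 (c * b i)" if "i < n" for i
    proof -
      have "j\<^sub>2 c * j\<^sub>1 (a i) = j\<^sub>1 (a i) * j\<^sub>2 c"
        using twisted_commute[of "\<alpha> i" "\<lambda>_. 1" "a i" c] dual_group_one h[OF that] c by (simp add: v_one)
      then show ?thesis by (simp add: right_simps flip: mult.assoc)
    qed
    then have "j\<^sub>2 c * z = (\<Sum>i<n. j\<^sub>1 (a i) * j\<^sub>2 (c * b i))"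
      by (simp add: z_eq sum_distrib_left)
    ultimately show ?thesis
      using expand[of a "\<lambda>i. c * b i"] h by simp
  qed
  show "(\<lambda>n. F (star z * (j\<^sub>1 (X n) * z))) \<longlonglongrightarrow> F (star z * (j\<^sub>1 c * z))"
    unfolding left[OF X(2)] left[OF X(3)]
    by (intro tendsto_sum tendsto_mult tendsto_const state_tendsto[OF state] X(1))
  show "(\<lambda>n. F (star z * (j\<^sub>2 (X n) * z))) \<longlonglongrightarrow> F (star z * (j\<^sub>2 c * z))"
    unfolding right[OF X(2)] right[OF X(3)]
    by (intro tendsto_sum tendsto_mult tendsto_const state_tendsto[OF state] X(1))
qed

section \<open>Uniqueness of the product state and necessity of the condition on
  \<open>v\<close>\<close>

lemma state_product_on_B:
  assumes "state \<phi>" "\<And>a b. \<phi> (j\<^sub>1 a * j\<^sub>2 b) = \<omega> a * \<omega> b" "z \<in> B"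
  shows "\<phi> z = F z"
proof -
  interpret \<phi>: positive_functional UNIV \<phi>
    using assms(1) by (rule state_positive_functional)
  show ?thesis using assms(3)
  proof (induction rule: B_induct)
    case zero
    then show ?case by (simp add: F_zero \<phi>.f_zero)
  next
    case (add z a b \<xi> \<eta>)
    then show ?case
      using F_add[OF add.hyps(1) product_in_B[OF add.hyps(2-5)]] F_product[OF add.hyps(2-5)]
      by (simp add: \<phi>.f_add assms(2))
  qed
qed

lemma product_state_unique:
  assumes "state \<phi>" "\<And>a b. \<phi> (j\<^sub>1 a * j\<^sub>2 b) = \<omega> a * \<omega> b"
    and "state \<psi>" "\<And>a b. \<psi> (j\<^sub>1 a * j\<^sub>2 b) = \<omega> a * \<omega> b"
  shows "\<phi> = \<psi>"
  using states_eqI[OF assms(1,3) closure_B] state_product_on_B[OF assms(1,2)]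
    state_product_on_B[OF assms(3,4)] by simp

lemma product_state_imp_trivial:
  assumes "state \<phi>" "\<And>a b. \<phi> (j\<^sub>1 a * j\<^sub>2 b) = \<omega> a * \<omega> b"
    and \<eta>: "\<eta>\<^sub>1 \<in> spectral_support \<gamma> \<omega>" "\<eta>\<^sub>2 \<in> spectral_support \<gamma> \<omega>"
  shows "v \<eta>\<^sub>1 \<eta>\<^sub>2 = 1"
proof -
  interpret \<phi>: positive_functional UNIV \<phi>
    using assms(1) by (rule state_positive_functional)
  obtain a b where d: "\<eta>\<^sub>1 \<in> dual_group" "\<eta>\<^sub>2 \<in> dual_group"
    and h: "a \<in> homogeneous \<gamma> \<eta>\<^sub>1" "b \<in> homogeneous \<gamma> \<eta>\<^sub>2" and nz: "\<omega> a \<noteq> 0" "\<omega> b \<noteq> 0"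
    using \<eta> by (auto simp: spectral_support_def)
  have "\<phi> (star (j\<^sub>1 a * j\<^sub>2 b)) = cnj (\<omega> a * \<omega> b)"
    using \<phi>.f_star[of "j\<^sub>1 a * j\<^sub>2 b"] by (simp add: assms(2))
  moreover have "\<phi> (star (j\<^sub>1 a * j\<^sub>2 b)) = cnj (v \<eta>\<^sub>1 \<eta>\<^sub>2) * (\<omega> (star a) * \<omega> (star b))"
    unfolding star_product[OF d h] by (simp add: \<phi>.f_scaleC assms(2))
  ultimately have "cnj (v \<eta>\<^sub>1 \<eta>\<^sub>2) * (cnj (\<omega> a) * cnj (\<omega> b)) = cnj (\<omega> a) * cnj (\<omega> b)"
    by (simp add: \<omega>.f_star)
  then have "cnj (v \<eta>\<^sub>1 \<eta>\<^sub>2) = 1" using nz by simp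
  then show ?thesis by (metis complex_cnj_cnj complex_cnj_one)
qed

end

section \<open>Positivity of the product functional when \<open>v\<close> is trivial on the
  support\<close>

locale twisted_product_trivial = twisted_product_functional \<gamma> v \<iota> j\<^sub>1 j\<^sub>2 \<omega>
  for \<gamma> :: "'g::{topological_ab_group_add,t2_space} \<Rightarrow> 'a::unital_cstar_algebra \<Rightarrow> 'a"
    and v :: "('g \<Rightarrow> complex) \<Rightarrow> ('g \<Rightarrow> complex) \<Rightarrow> complex"
    and \<iota> :: "'a tensor \<Rightarrow> 'b::unital_cstar_algebra"
    and j\<^sub>1 j\<^sub>2 :: "'a \<Rightarrow> 'b"
    and \<omega> :: "'a \<Rightarrow> complex" +
  assumes trivial: "\<eta>\<^sub>1 \<in> spectral_support \<gamma> \<omega> \<Longrightarrow> \<eta>\<^sub>2 \<in> spectral_support \<gamma> \<omega> \<Longrightarrow> v \<eta>\<^sub>1 \<eta>\<^sub>2 = 1"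
begin

text \<open>The support need not be a subgroup, but its annihilator in the second variable is one,
  which splits the dual into cosets; under \<open>trivial\<close> it contains the support.\<close>

definition annihilator :: "('g \<Rightarrow> complex) set" where
  "annihilator = {\<theta> \<in> dual_group. \<forall>\<eta>\<in>spectral_support \<gamma> \<omega>. v \<eta> \<theta> = 1}"

text \<open>The predicate depends only on the coset of \<open>\<beta>\<close> modulo the
  annihilator, so \<open>SOME\<close> selects one representative for the whole coset.\<close>

definition coset_rep :: "('g \<Rightarrow> complex) \<Rightarrow> ('g \<Rightarrow> complex)" where
  "coset_rep \<beta> = (SOME \<theta>. \<theta> \<in> dual_group \<and> (\<lambda>g. cnj (\<theta> g) * \<beta> g) \<in> annihilator)"

lemma support_dual: "\<eta> \<in> spectral_support \<gamma> \<omega> \<Longrightarrow> \<eta> \<in> dual_group"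
  by (simp add: spectral_support_def)

lemma annihilator_dual: "\<theta> \<in> annihilator \<Longrightarrow> \<theta> \<in> dual_group"
  by (simp add: annihilator_def)

lemma annihilator_mult:
  "\<theta> \<in> annihilator \<Longrightarrow> \<theta>' \<in> annihilator \<Longrightarrow> (\<lambda>g. \<theta> g * \<theta>' g) \<in> annihilator"
  using support_dual by (auto simp: annihilator_def dual_group_mult v_mult)

lemma annihilator_cnj: "\<theta> \<in> annihilator \<Longrightarrow> (\<lambda>g. cnj (\<theta> g)) \<in> annihilator"
  using support_dual by (auto simp: annihilator_def dual_group_cnj v_cnj)

lemma coset_rep:
  assumes "\<beta> \<in> dual_group"
  shows "coset_rep \<beta> \<in> dual_group" "(\<lambda>g. cnj (coset_rep \<beta> g) * \<beta> g) \<in> annihilator"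
proof -
  \<comment> \<open>\<open>\<beta>\<close> represents its own coset, which shows that the choice is
    possible.\<close>
  have "(\<lambda>g. cnj (\<beta> g) * \<beta> g) \<in> annihilator"
    using support_dual by (auto simp: annihilator_def dual_group_norm[OF assms] dual_group_one v_one)
  then have "coset_rep \<beta> \<in> dual_group \<and> (\<lambda>g. cnj (coset_rep \<beta> g) * \<beta> g) \<in> annihilator"
    unfolding coset_rep_def using assms by (intro someI_ex[where P = "\<lambda>\<theta>. \<theta> \<in> dual_group \<and> _ \<theta>"]) blast
  then show "coset_rep \<beta> \<in> dual_group" "(\<lambda>g. cnj (coset_rep \<beta> g) * \<beta> g) \<in> annihilator"
    by blast+
qed

lemma coset_rep_eq:
  assumes d: "\<beta> \<in> dual_group" "\<beta>' \<in> dual_group" and ann: "(\<lambda>g. cnj (\<beta> g) * \<beta>' g) \<in> annihilator"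
  shows "coset_rep \<beta> = coset_rep \<beta>'"
proof -
  have "(\<lambda>g. cnj (\<theta> g) * \<beta> g) \<in> annihilator \<longleftrightarrow> (\<lambda>g. cnj (\<theta> g) * \<beta>' g) \<in> annihilator" for \<theta>
  proof
    assume "(\<lambda>g. cnj (\<theta> g) * \<beta> g) \<in> annihilator"
    from annihilator_mult[OF this ann]
    have "(\<lambda>g. cnj (\<theta> g) * ((cnj (\<beta> g) * \<beta> g) * \<beta>' g)) \<in> annihilator"
      by (simp add: mult_ac)
    then show "(\<lambda>g. cnj (\<theta> g) * \<beta>' g) \<in> annihilator"
      by (simp only: dual_group_norm[OF d(1)] mult_1)
  next
    assume "(\<lambda>g. cnj (\<theta> g) * \<beta>' g) \<in> annihilator"
    from annihilator_mult[OF this annihilator_cnj[OF ann]]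
    have "(\<lambda>g. cnj (\<theta> g) * ((cnj (\<beta>' g) * \<beta>' g) * \<beta> g)) \<in> annihilator"
      by (simp add: mult_ac)
    then show "(\<lambda>g. cnj (\<theta> g) * \<beta> g) \<in> annihilator"
      by (simp only: dual_group_norm[OF d(2)] mult_1)
  qed
  then show ?thesis by (simp add: coset_rep_def)
qed

text \<open>Where the product of states does not vanish, the twisting coefficient is a coboundary. The
  difference of the first degrees lies in the support, so the second degree only matters modulo the
  annihilator of the support, which by assumption contains the difference of the second degrees.\<close>

lemma coefficient_coboundary:
  assumes d: "\<alpha> \<in> dual_group" "\<beta> \<in> dual_group" "\<alpha>' \<in> dual_group" "\<beta>' \<in> dual_group"
    and h: "a \<in> homogeneous \<gamma> \<alpha>" "b \<in> homogeneous \<gamma> \<beta>" "c \<in> homogeneous \<gamma> \<alpha>'" "e \<in> homogeneous \<gamma> \<beta>'"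
  shows "v (\<lambda>g. cnj (\<alpha> g) * \<alpha>' g) \<beta> * (\<omega> (star a * c) * \<omega> (star b * e)) =
    \<omega> (star a * c) * (cnj (v \<alpha> (coset_rep \<beta>)) * v \<alpha>' (coset_rep \<beta>') * \<omega> (star b * e))"
proof (cases "\<omega> (star a * c) = 0 \<or> \<omega> (star b * e) = 0")
  case False
  let ?\<delta> = "\<lambda>g. cnj (\<alpha> g) * \<alpha>' g" and ?\<epsilon> = "\<lambda>g. cnj (\<beta> g) * \<beta>' g" and ?r = "coset_rep \<beta>"
  have "star a * c \<in> homogeneous \<gamma> ?\<delta>" "star b * e \<in> homogeneous \<gamma> ?\<epsilon>"
    using h by (auto intro: homogeneous_closed(4) homogeneous_closed(5))
  then have supp: "?\<delta> \<in> spectral_support \<gamma> \<omega>" "?\<epsilon> \<in> spectral_support \<gamma> \<omega>"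
    using False d by (auto simp: spectral_support_def intro: dual_group_mult dual_group_cnj)
  then have "?\<epsilon> \<in> annihilator"
    using trivial support_dual by (auto simp: annihilator_def)
  then have rep: "coset_rep \<beta>' = ?r" using coset_rep_eq d by metis
  note r = coset_rep[OF d(2)]
  have "?r g * (cnj (?r g) * \<beta> g) = \<beta> g" for g
    using dual_group_norm[OF r(1), of g] by (metis mult.assoc mult.commute mult_1)
  then have "v ?\<delta> \<beta> = v ?\<delta> (\<lambda>g. ?r g * (cnj (?r g) * \<beta> g))"
    by (simp only:)
  also have "\<dots> = v ?\<delta> ?r * v ?\<delta> (\<lambda>g. cnj (?r g) * \<beta> g)"
    by (rule v_mult(2)[OF r(1) annihilator_dual[OF r(2)] support_dual[OF supp(1)]])
  also have "v ?\<delta> (\<lambda>g. cnj (?r g) * \<beta> g) = 1"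
    using r(2) supp(1) by (simp add: annihilator_def)
  also have "v ?\<delta> ?r = cnj (v \<alpha> ?r) * v \<alpha>' ?r"
    using v_mult(1)[OF dual_group_cnj[OF d(1)] d(3) r(1)] v_cnj(1)[OF d(1) r(1)] by simp
  finally show ?thesis unfolding rep by simp
qed auto

text \<open>The coboundary phases are absorbed by rescaling each \<open>b i\<close> to
  \<open>u i *\<^sub>C b i\<close>; what remains is the entrywise product of two Gram matrices, to
  which Schur's theorem applies.\<close>

lemma F_positive:
  assumes "z \<in> B"
  shows "F (star z * z) \<in> \<real>\<^sub>\<ge>\<^sub>0"
proof -
  obtain n :: nat and a b \<alpha> \<beta> where
    h: "\<And>i. i < n \<Longrightarrow> \<alpha> i \<in> dual_group \<and> \<beta> i \<in> dual_group \<and> a i \<in> homogeneous \<gamma> (\<alpha> i) \<and> b i \<in> homogeneous \<gamma> (\<beta> i)"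
    and z_eq: "z = (\<Sum>i<n. j\<^sub>1 (a i) * j\<^sub>2 (b i))"
    using assms by (rule B_sum_form) blast
  define u where "u i = v (\<alpha> i) (coset_rep (\<beta> i))" for i
  have "F (star z * z) = (\<Sum>i<n. \<Sum>j<n. v (\<lambda>g. cnj (\<alpha> i g) * \<alpha> j g) (\<beta> i) *
      (\<omega> (star (a i) * a j) * \<omega> (star (b i) * b j)))"
    unfolding z_eq by (rule F_expand) (use h in auto)
  also have "\<dots> = (\<Sum>i<n. \<Sum>j<n. \<omega> (star (a i) * a j) * \<omega> (star (u i *\<^sub>C b i) * (u j *\<^sub>C b j)))"
  proof (intro sum.cong refl)
    fix i j assume "i \<in> {..<n}" "j \<in> {..<n}"
    then show "v (\<lambda>g. cnj (\<alpha> i g) * \<alpha> j g) (\<beta> i) * (\<omega> (star (a i) * a j) * \<omega> (star (b i) * b j)) =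
        \<omega> (star (a i) * a j) * \<omega> (star (u i *\<^sub>C b i) * (u j *\<^sub>C b j))"
      using h coefficient_coboundary[of "\<alpha> i" "\<beta> i" "\<alpha> j" "\<beta> j" "a i" "b i" "a j" "b j"]
      by (simp add: u_def star_scaleC mult_scaleC_left mult_scaleC_right scaleC_scaleC \<omega>.f_scaleC mult_ac)
  qed
  also have "\<dots> \<in> \<real>\<^sub>\<ge>\<^sub>0"
    by (rule \<omega>.schur_product) (auto intro: \<omega>.psd_gram)
  finally show ?thesis .
qed

sublocale positive_functional product_span product_functional
proof
  show "F 1 = 1"
    using F_product[OF dual_group_one dual_group_one homogeneous_one homogeneous_one]
    by (simp add: left_simps right_simps \<omega>.f_one)
qed (auto intro: B_one B_add B_scaleC B_mult B_star F_add F_scaleC F_positive)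

section \<open>Boundedness of the GNS representation by means of the fixed-point algebra\<close>

lemma neutral_subalgebra:
  fixes a b :: 'a
  assumes "a \<in> homogeneous \<gamma> (\<lambda>_. 1)"
  shows "b \<in> homogeneous \<gamma> (\<lambda>_. 1) \<Longrightarrow> a * b \<in> homogeneous \<gamma> (\<lambda>_. 1)"
    and "r *\<^sub>R a \<in> homogeneous \<gamma> (\<lambda>_. 1)"
    and "sqrt_partial a n \<in> homogeneous \<gamma> (\<lambda>_. 1)"
proof -
  have mult: "a * b \<in> homogeneous \<gamma> (\<lambda>_. 1)"
    if "a \<in> homogeneous \<gamma> (\<lambda>_. 1)" "b \<in> homogeneous \<gamma> (\<lambda>_. 1)" for a b :: 'a
    using homogeneous_closed(4)[OF that] by simp
  have scale: "r *\<^sub>R a \<in> homogeneous \<gamma> (\<lambda>_. 1)" if "a \<in> homogeneous \<gamma> (\<lambda>_. 1)" for a :: 'a and r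
    unfolding scaleC_of_real[symmetric] using homogeneous_closed(3)[OF that] .
  have power: "a ^ n \<in> homogeneous \<gamma> (\<lambda>_. 1)" for n
    by (induction n) (auto intro: homogeneous_one mult assms)
  show "b \<in> homogeneous \<gamma> (\<lambda>_. 1) \<Longrightarrow> a * b \<in> homogeneous \<gamma> (\<lambda>_. 1)"
    using mult assms .
  show "r *\<^sub>R a \<in> homogeneous \<gamma> (\<lambda>_. 1)"
    using scale assms .
  have "(\<Sum>k\<in>K. c k *\<^sub>R a ^ k) \<in> homogeneous \<gamma> (\<lambda>_. 1)" for K :: "nat set" and c
    by (induction K rule: infinite_finite_induct)
      (auto intro: homogeneous_closed(1,2) scale power)
  then show "sqrt_partial a n \<in> homogeneous \<gamma> (\<lambda>_. 1)"
    unfolding sqrt_partial_def .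
qed

text \<open>The element \<^term>\<open>star a * a\<close> is neutral, so \<open>r - star a * a\<close> is a limit of squares of
  neutral elements, to which positivity applies.\<close>

lemma op_bound_hom:
  assumes j: "unital_star_hom j" and mem: "\<And>\<xi> a. \<xi> \<in> dual_group \<Longrightarrow> a \<in> homogeneous \<gamma> \<xi> \<Longrightarrow> j a \<in> B"
    and lim: "\<And>z X c. z \<in> B \<Longrightarrow> X \<longlonglongrightarrow> c \<Longrightarrow> (\<And>n. X n \<in> homogeneous \<gamma> (\<lambda>_. 1)) \<Longrightarrow>
      c \<in> homogeneous \<gamma> (\<lambda>_. 1) \<Longrightarrow> (\<lambda>n. F (star z * (j (X n) * z))) \<longlonglongrightarrow> F (star z * (j c * z))"
    and a: "\<xi> \<in> dual_group" "a \<in> homogeneous \<gamma> \<xi>"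
  shows "\<exists>C. op_bound (j a) C"
proof -
  note simps = unital_star_hom_simps[OF j]
  \<comment> \<open>Adding 1 keeps \<open>r\<close> positive and makes \<open>norm h\<close>
    strictly less than 1.\<close>
  define r where "r = (norm a)\<^sup>2 + 1"
  have r0: "r > 0" by (simp add: r_def add_nonneg_pos)
  define h where "h = (1 / r) *\<^sub>R (star a * a)"
  have aa: "star a * a \<in> homogeneous \<gamma> (\<lambda>_. 1)"
    using homogeneous_closed(4)[OF homogeneous_closed(5)[OF a(2)] a(2)] dual_group_norm[OF a(1)] by simp
  have hV: "h \<in> homogeneous \<gamma> (\<lambda>_. 1)"
    unfolding h_def by (rule neutral_subalgebra(2)[OF aa])
  have hstar: "star h = h" by (simp add: h_def star_scaleR star_mult star_star)
  have "norm h < 1" using r0 by (simp add: h_def cstar_identity) (simp add: r_def)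
  then obtain s where s: "sqrt_partial h \<longlonglongrightarrow> s" "s * s = 1 - h"
    by (rule sqrt_partial_tendsto)
  let ?s = "sqrt_partial h"
  have sV: "?s n \<in> homogeneous \<gamma> (\<lambda>_. 1)" for n
    by (rule neutral_subalgebra(3)[OF hV])
  have "1 + (-1) *\<^sub>C h \<in> homogeneous \<gamma> (\<lambda>_. 1)"
    by (intro homogeneous_closed(2,3) homogeneous_one hV)
  then have limV: "s * s \<in> homogeneous \<gamma> (\<lambda>_. 1)"
    using s(2) by (simp add: scaleC_minus1)
  have "sqn (j a * z) \<le> r * sqn z" if z: "z \<in> B" for z
  proof -
    \<comment> \<open>Positivity of \<open>F\<close> is used at the partial sums, which are
      self-adjoint and neutral; \<open>lim\<close> carries the inequality over to
      \<open>s * s\<close>, which is neutral by its value \<open>1 - h\<close>.\<close>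
    have "(\<lambda>n. F (star z * (j (?s n * ?s n) * z))) \<longlonglongrightarrow> F (star z * (j (s * s) * z))"
      by (rule lim[OF z tendsto_mult[OF s(1) s(1)] neutral_subalgebra(1)[OF sV sV] limV])
    then have "(\<lambda>n. Re (F (star z * (j (?s n * ?s n) * z)))) \<longlonglongrightarrow> Re (F (star z * (j (s * s) * z)))"
      by (rule tendsto_Re)
    moreover have "0 \<le> Re (F (star z * (j (?s n * ?s n) * z)))" for n
    proof -
      have "star (j (?s n)) = j (?s n)"
        by (simp only: simps(4)[symmetric] star_sqrt_partial[OF hstar])
      moreover have "0 \<le> sqn (j (?s n) * z)"
        using mem[OF dual_group_one sV] z by (intro sqn_nonneg B_mult)
      ultimately show ?thesis
        by (simp add: sqn_def star_mult simps mult.assoc)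
    qed
    ultimately have "0 \<le> Re (F (star z * (j (s * s) * z)))"
      by - (rule LIMSEQ_le_const, auto)
    moreover have "star z * (j (s * s) * z) =
        star z * z - complex_of_real (1 / r) *\<^sub>C (star (j a * z) * (j a * z))"
      unfolding s(2) h_def scaleC_of_real
      by (simp add: simps star_mult left_diff_distrib right_diff_distrib mult.assoc)
    moreover have "j a * z \<in> B" using mem[OF a] z by (rule B_mult)
    ultimately have "0 \<le> sqn z - sqn (j a * z) / r"
      using z by (simp add: f_diff f_scaleC B_mult B_star B_scaleC sqn_def)
    then show ?thesis using r0 by (simp add: field_simps)
  qed
  then have "op_bound (j a) (sqrt r)"
    using r0 by (auto simp: op_bound_def seminorm_def real_sqrt_mult[symmetric])
  then show ?thesis by blast
qed

sublocale bounded_positive_functional product_span product_functional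
proof
  fix x assume "x \<in> B"
  then show "\<exists>C. op_bound x C"
  proof (induction rule: B_induct)
    case zero
    have "op_bound 0 0" by (simp add: op_bound_def seminorm_def sqn_def f_zero)
    then show ?case by blast
  next
    case (add x a b \<xi> \<eta>)
    \<comment> \<open>Sums and products of bounded operators are bounded, so the two tensor factors
      can be treated separately.\<close>
    have "\<exists>C. op_bound (j\<^sub>1 a) C"
      by (rule op_bound_hom[OF left_hom(1) _ _ add.hyps(2,4)])
        (auto intro: left_in_B F_neutral_tendsto(1))
    moreover have "\<exists>D. op_bound (j\<^sub>2 b) D"
      by (rule op_bound_hom[OF right_hom(1) _ _ add.hyps(3,5)])
        (auto intro: right_in_B F_neutral_tendsto(2))
    ultimately obtain C D where "op_bound (j\<^sub>1 a) C" "op_bound (j\<^sub>2 b) D" by blast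
    then have "op_bound (j\<^sub>1 a * j\<^sub>2 b) (C * D)"
      using left_in_B right_in_B add.hyps by (blast intro: op_bound_mult)
    then show ?case
      using add.IH op_bound_add add.hyps(1) product_in_B[OF add.hyps(2-5)] by blast
  qed
qed

section \<open>Comparison with the maximal norm and extension to the completion\<close>

lemma twisted_star_closed: "x \<in> alg_tensor \<gamma> \<Longrightarrow> twisted_star \<gamma> v x \<in> alg_tensor \<gamma>"
proof (induction rule: alg_tensor_induct)
  case zero
  have "twisted_star \<gamma> v (scale_tensor 0 0) = scale_tensor (cnj 0) (twisted_star \<gamma> v 0)"
    using twisted_star_well_defined[of v] alg_tensor_closed(3) unfolding is_twisted_star_def by blast
  then show ?case by (simp only: scale_tensor_zero complex_cnj_zero alg_tensor_closed(3))
next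
  case (add x a b \<xi> \<eta>)
  have "tens \<gamma> a b \<in> alg_tensor \<gamma>" using add.hyps homogeneous_U alg_tensor_closed(4) by blast
  then have "twisted_star \<gamma> v (x + tens \<gamma> a b) = twisted_star \<gamma> v x + twisted_star \<gamma> v (tens \<gamma> a b)"
    using twisted_star_well_defined[of v] add.hyps(1) unfolding is_twisted_star_def by blast
  moreover have "twisted_star \<gamma> v (tens \<gamma> a b) = scale_tensor (cnj (v \<xi> \<eta>)) (tens \<gamma> (star a) (star b))"
    using twisted_star_well_defined[of v] add.hyps(2-5) unfolding is_twisted_star_def by blast
  moreover have "tens \<gamma> (star a) (star b) \<in> alg_tensor \<gamma>"
    using add.hyps star_homogeneous_U alg_tensor_closed(4) by blast
  ultimately show ?case
    using alg_tensor_closed(1)[OF add.IH] alg_tensor_closed(2) by metis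
qed

text \<open>The maximum of the given norm and the GNS seminorm is again a C*-norm, so maximality of the
  former bounds the latter.\<close>

lemma F_le_norm:
  assumes "z \<in> B"
  shows "cmod (F z) \<le> norm z"
proof -
  have mem: "\<iota> x \<in> B" if "x \<in> alg_tensor \<gamma>" for x
    using that by (simp add: product_span_def)
  \<comment> \<open>The GNS seminorm may vanish on nonzero elements; the maximum with the definite
    norm repairs this.\<close>
  define q where "q x = max (norm (\<iota> x)) (op_norm (\<iota> x))" for x
  have p: "twisted_cstar_norm \<gamma> v (\<lambda>x. norm (\<iota> x))"
    using completion_norm by (simp add: maximal_twisted_cstar_norm_def)
  have "twisted_cstar_norm \<gamma> v q"
    unfolding twisted_cstar_norm_def
  proof (intro conjI ballI allI)
    fix x assume x: "x \<in> alg_tensor \<gamma>"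
    note xB = mem[OF x]
    show "0 \<le> q x" by (simp add: q_def le_max_iff_disj)
    show "q (scale_tensor k x) = cmod k * q x" for k
      using xB by (simp add: q_def completion_scale[OF x] norm_scaleC op_norm_scaleC max_mult_distrib_left)
    \<comment> \<open>\<open>completion_mult\<close> applies because the involution preserves the
      algebraic tensor product.\<close>
    have "\<iota> (twisted_mult \<gamma> v (twisted_star \<gamma> v x) x) = star (\<iota> x) * \<iota> x"
      using completion_mult[OF twisted_star_closed[OF x] x] completion_star[OF x] by simp
    \<comment> \<open>Squaring is monotone on nonnegative numbers, so the maximum of two
      C*-seminorms inherits the C*-identity.\<close>
    then show "q (twisted_mult \<gamma> v (twisted_star \<gamma> v x) x) = (q x)\<^sup>2"
      using op_norm_nonneg[OF xB]
      by (auto simp: q_def cstar_identity op_norm_cstar[OF xB] max_def power_mono_iff)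
    have "op_norm 0 = 0" using op_norm_scaleC[OF B_zero, of 0] by simp
    moreover have "norm (\<iota> x) = 0 \<longleftrightarrow> x = 0" using p x unfolding twisted_cstar_norm_def by blast
    ultimately show "(q x = 0) = (x = 0)"
      using op_norm_nonneg[OF xB] by (auto simp: q_def max_def iota_zero split: if_splits)
    fix y assume y: "y \<in> alg_tensor \<gamma>"
    note yB = mem[OF y]
    show "q (x + y) \<le> q x + q y"
      using norm_triangle_ineq[of "\<iota> x" "\<iota> y"] op_norm_add[OF xB yB]
      by (simp add: q_def completion_add[OF x y]) linarith
    have "norm (\<iota> x * \<iota> y) \<le> q x * q y"
      by (rule order_trans[OF norm_mult_ineq]) (auto simp: q_def intro!: mult_mono le_max_iff_disj[THEN iffD2])
    moreover have "op_norm (\<iota> x * \<iota> y) \<le> q x * q y"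
      using op_norm_nonneg[OF xB] op_norm_nonneg[OF yB]
      by (intro order_trans[OF op_norm_mult[OF xB yB]] mult_mono) (auto simp: q_def le_max_iff_disj)
    ultimately show "q (twisted_mult \<gamma> v x y) \<le> q x * q y"
      unfolding q_def[of "twisted_mult \<gamma> v x y"] completion_mult[OF x y] by (rule max.boundedI)
  qed
  then have "q x \<le> norm (\<iota> x)" if "x \<in> alg_tensor \<gamma>" for x
    using completion_norm that unfolding maximal_twisted_cstar_norm_def by blast
  then have "op_norm z \<le> norm z"
    using assms by (auto simp: product_span_def q_def)
  then show ?thesis using f_le_op_norm[OF assms] by linarith
qed

text \<open>Linearity carries the product formula from homogeneous elements to \<open>U\<close>;
  density then removes the restriction from one argument at a time, because
  \<open>state_hom_tendsto\<close> gives continuity in each argument separately.\<close>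

theorem product_state_exists:
  "\<exists>\<phi>. state \<phi> \<and> (\<forall>a b. \<phi> (j\<^sub>1 a * j\<^sub>2 b) = \<omega> a * \<omega> b)"
proof -
  obtain \<phi> where \<phi>: "state \<phi>" and eq: "\<And>z. z \<in> B \<Longrightarrow> \<phi> z = F z"
    using extends_to_state[OF closure_B F_le_norm] by blast
  interpret \<phi>: positive_functional UNIV \<phi>
    using \<phi> by (rule state_positive_functional)
  have UU: "\<phi> (j\<^sub>1 a * j\<^sub>2 b) = \<omega> a * \<omega> b" if "a \<in> U" "b \<in> U" for a b
    using that(1)
  proof (induction rule: U_induct)
    case zero
    then show ?case using left_simps(2)[of 0 0] by (simp add: \<phi>.f_zero \<omega>.f_zero)
  next
    case (add a c \<xi>)
    have "\<phi> (j\<^sub>1 c * j\<^sub>2 b) = \<omega> c * \<omega> b"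
      using that(2)
    proof (induction rule: U_induct)
      case zero
      then show ?case using right_simps(2)[of 0 0] by (simp add: \<phi>.f_zero \<omega>.f_zero)
    next
      case inner: (add b d \<eta>)
      then show ?case
        using add.hyps eq[OF product_in_B] F_product
        by (simp add: right_simps distrib_left \<phi>.f_add \<omega>.f_add)
    qed
    then show ?case using add.IH by (simp add: left_simps distrib_right \<phi>.f_add \<omega>.f_add)
  qed
  have approx: "\<exists>X. (\<forall>n. X n \<in> U) \<and> X \<longlonglongrightarrow> a" for a
    using dense_algebraic_sum closure_sequential[of a U] by simp
  have AU: "\<phi> (j\<^sub>1 a * j\<^sub>2 b) = \<omega> a * \<omega> b" if b: "b \<in> U" for a b
  proof -
    obtain X where X: "\<And>n. X n \<in> U" "X \<longlonglongrightarrow> a" using approx by metis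
    have "(\<lambda>n. \<omega> (X n) * \<omega> b) \<longlonglongrightarrow> \<phi> (j\<^sub>1 a * j\<^sub>2 b)"
      using state_hom_tendsto(1)[OF \<phi> left_hom(1) X(2), of "j\<^sub>2 b"] UU[OF X(1) b] by simp
    moreover have "(\<lambda>n. \<omega> (X n) * \<omega> b) \<longlonglongrightarrow> \<omega> a * \<omega> b"
      by (intro tendsto_mult tendsto_const state_tendsto[OF state X(2)])
    ultimately show ?thesis by (rule LIMSEQ_unique)
  qed
  have "\<phi> (j\<^sub>1 a * j\<^sub>2 b) = \<omega> a * \<omega> b" for a b
  proof -
    obtain X where X: "\<And>n. X n \<in> U" "X \<longlonglongrightarrow> b" using approx by metis
    have "(\<lambda>n. \<omega> a * \<omega> (X n)) \<longlonglongrightarrow> \<phi> (j\<^sub>1 a * j\<^sub>2 b)"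
      using state_hom_tendsto(2)[OF \<phi> right_hom(1) X(2), of "j\<^sub>1 a"] AU[OF X(1)] by simp
    moreover have "(\<lambda>n. \<omega> a * \<omega> (X n)) \<longlonglongrightarrow> \<omega> a * \<omega> b"
      by (intro tendsto_mult tendsto_const state_tendsto[OF state X(2)])
    ultimately show ?thesis by (rule LIMSEQ_unique)
  qed
  with \<phi> show ?thesis by blast
qed

end

theorem theorem3p7:
  fixes \<gamma> :: "'g::{topological_ab_group_add,t2_space} \<Rightarrow> 'a::unital_cstar_algebra \<Rightarrow> 'a"
    and v :: "('g \<Rightarrow> complex) \<Rightarrow> ('g \<Rightarrow> complex) \<Rightarrow> complex"
    and \<iota> :: "'a tensor \<Rightarrow> 'b::unital_cstar_algebra"
    and j\<^sub>1 j\<^sub>2 :: "'a \<Rightarrow> 'b"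
    and \<omega> :: "'a \<Rightarrow> complex"
  assumes "graded_cstar_algebra \<gamma>"
    and "bicharacter v"
    and "twisted_tensor_product \<gamma> v \<iota> j\<^sub>1 j\<^sub>2"
    and "state \<omega>"
  shows "((\<exists>\<phi> :: 'b \<Rightarrow> complex. state \<phi> \<and> (\<forall>a b. \<phi> (j\<^sub>1 a * j\<^sub>2 b) = \<omega> a * \<omega> b)) \<longleftrightarrow>
      (\<forall>\<eta>\<^sub>1\<in>spectral_support \<gamma> \<omega>. \<forall>\<eta>\<^sub>2\<in>spectral_support \<gamma> \<omega>. v \<eta>\<^sub>1 \<eta>\<^sub>2 = 1)) \<and>
    (\<forall>\<phi> \<psi> :: 'b \<Rightarrow> complex.
      state \<phi> \<and> (\<forall>a b. \<phi> (j\<^sub>1 a * j\<^sub>2 b) = \<omega> a * \<omega> b) \<and>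
      state \<psi> \<and> (\<forall>a b. \<psi> (j\<^sub>1 a * j\<^sub>2 b) = \<omega> a * \<omega> b) \<longrightarrow> \<phi> = \<psi>)"
proof -
  interpret twisted_product_functional \<gamma> v \<iota> j\<^sub>1 j\<^sub>2 \<omega>
    using assms by (intro twisted_product_functional.intro twisted_product_functional_axioms.intro)
  have "\<exists>\<phi>. state \<phi> \<and> (\<forall>a b. \<phi> (j\<^sub>1 a * j\<^sub>2 b) = \<omega> a * \<omega> b)"
    if "\<forall>\<eta>\<^sub>1\<in>spectral_support \<gamma> \<omega>. \<forall>\<eta>\<^sub>2\<in>spectral_support \<gamma> \<omega>. v \<eta>\<^sub>1 \<eta>\<^sub>2 = 1"
  proof -
    interpret twisted_product_trivial \<gamma> v \<iota> j\<^sub>1 j\<^sub>2 \<omega>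
      using that by unfold_locales blast
    show ?thesis by (rule product_state_exists)
  qed
  then show ?thesis
    using product_state_imp_trivial product_state_unique by blast
qed

end
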